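(* Let $d\ge2$. There exists a filter $\tilde h$ belonging to $W^{\lfloor\frac{d-1}{2}\rfloor}BV$ such that $$\sup_{L\ge1}\|V_L^{\tilde h}\|=\infty,$$ the supremum being over all integers $L\ge1$.
   Context: Let $\mathbb{S}^d=\{x\in\mathbb{R}^{d+1}:|x|=1\}$, with $\sigma$ the rotation-invariant measure on $\mathbb{S}^d$ normalized by $\sigma(\mathbb{S}^d)=1$. $L_\infty(\mathbb{S}^d)$ is the space of real essentially bounded measurable functions on $\mathbb{S}^d$ with norm $\|\cdot\|_\infty$, and $\langle f,g\rangle=\int_{\mathbb{S}^d}fg\,d\sigma$. $\mathcal{H}_\ell^d$ is the space of spherical harmonics of degree $\ell$ on $\mathbb{S}^d$, of dimension $Z(d,\ell)$. $\{Y_{\ell,k}: k=1,\dots,Z(d,\ell)\}$ is a fixed basis of $\mathcal{H}_\ell^d$, orthonormal in $L_2(\mathbb{S}^d)$. Filter: a real-valued continuous function $h$ on $[0,\infty)$ with $h(t)=1$ for $t\in[0,1]$ and $h(t)=0$ for $t\ge 2$. For an integer $r\ge1$, $W^rBV$ denotes the set of absolutely continuous functions $h$ whose derivatives of all orders up to $r-1$ are absolutely continuous and whose right and left derivatives of order $r$, $h^{(r)}_+$ and $h^{(r)}_-$ (the one-sided derivatives of $h^{(r-1)}$), exist everywhere and are of bounded variation. Here the domain is $[0,\infty)$, with only the right derivative considered at $0$. For $r=0$ (which occurs when $d=2$), $W^0BV$ denotes the set of absolutely continuous functions of bounded variation. For a filter $h$, an integer $L\ge1$ and $f\in L_\infty(\mathbb{S}^d)$,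 $$V_L^h(f)=\sum_{\ell=0}^\infty\sum_{k=1}^{Z(d,\ell)}h\!\left(\tfrac{\ell}{L}\right)\langle f,Y_{\ell,k}\rangle Y_{\ell,k},$$ and $\|V_L^h\|=\sup\{\|V_L^h f\|_\infty: f\in L_\infty(\mathbb{S}^d),\ \|f\|_\infty\le1\}$. *)

theory Defs
  imports
    "HOL-Analysis.Analysis"
    "HOL-Library.Function_Algebras"
    "HOL-Probability.Essential_Supremum"
begin

text \<open>
  The sphere \<open>S\<^sup>d\<close> is \<^term>\<open>sphere (0 :: real^'n) 1\<close> with \<open>CARD('n) = d + 1\<close>.
\<close>

definition rotation_invariant_sphere_measure :: "(real^'n) measure \<Rightarrow> bool" where
  "rotation_invariant_sphere_measure \<sigma> \<longleftrightarrow>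
     space \<sigma> = sphere 0 1 \<and>
     sets \<sigma> = sets (restrict_space borel (sphere 0 1)) \<and>
     (\<forall>Q. rotation_matrix Q \<longrightarrow> distr \<sigma> \<sigma> ((*v) Q) = \<sigma>) \<and>
     emeasure \<sigma> (sphere 0 1) = 1"

definition Linf_norm :: "'a measure \<Rightarrow> ('a \<Rightarrow> real) \<Rightarrow> ereal" where
  "Linf_norm \<sigma> f = esssup \<sigma> (\<lambda>x. ereal \<bar>f x\<bar>)"

definition Linf :: "'a measure \<Rightarrow> ('a \<Rightarrow> real) set" where
  "Linf \<sigma> = {f \<in> borel_measurable \<sigma>. Linf_norm \<sigma> f < \<infinity>}"

definition L2_inner :: "'a measure \<Rightarrow> ('a \<Rightarrow> real) \<Rightarrow> ('a \<Rightarrow> real) \<Rightarrow> real" where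
  "L2_inner \<sigma> f g = (LINT x|\<sigma>. f x * g x)"

text \<open>Real-valued functions form a real vector space under pointwise operations; this
  makes \<open>span\<close> and \<open>dim\<close> available for spaces of functions.\<close>

global_interpretation fun_space: vector_space "\<lambda>(c::real) (f :: 'a \<Rightarrow> real) x. c * f x"
  by unfold_locales (auto simp: fun_eq_iff algebra_simps)

definition laplacian :: "(real^'n \<Rightarrow> real) \<Rightarrow> real^'n \<Rightarrow> real" where
  "laplacian p x = (\<Sum>i\<in>UNIV. (deriv ^^ 2) (\<lambda>t. p (x + t *\<^sub>R axis i 1)) 0)"

definition harmonic_homogeneous_polynomial :: "nat \<Rightarrow> (real^'n \<Rightarrow> real) \<Rightarrow> bool" where
  "harmonic_homogeneous_polynomial l p \<longleftrightarrow>
     real_polynomial_function p \<and>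
     (\<forall>c x. p (c *\<^sub>R x) = c ^ l * p x) \<and>
     (\<forall>x. laplacian p x = 0)"

text \<open>A function on the sphere is represented by its extension by \<open>0\<close> to the whole space, so
  that equality of representatives is equality on the sphere and the span and the dimension
  below are those of a space of functions on the sphere.\<close>

definition spherical_harmonics :: "nat \<Rightarrow> (real^'n \<Rightarrow> real) set" where
  "spherical_harmonics l =
     {(\<lambda>x. if x \<in> sphere 0 1 then p x else 0) | p. harmonic_homogeneous_polynomial l p}"

text \<open>The argument of type \<^typ>\<open>'n itself\<close> only carries the dimension \<open>d = CARD('n) - 1\<close>.\<close>

definition harm_dim :: "'n::finite itself \<Rightarrow> nat \<Rightarrow> nat" where
  "harm_dim _ l = fun_space.dim (spherical_harmonics l :: (real^'n \<Rightarrow> real) set)"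

definition orthonormal_harmonic_basis ::
    "(real^'n) measure \<Rightarrow> nat \<Rightarrow> (nat \<Rightarrow> real^'n \<Rightarrow> real) \<Rightarrow> bool" where
  "orthonormal_harmonic_basis \<sigma> l Y \<longleftrightarrow>
     fun_space.span (Y ` {1..harm_dim TYPE('n) l}) = spherical_harmonics l \<and>
     (\<forall>j\<in>{1..harm_dim TYPE('n) l}. \<forall>k\<in>{1..harm_dim TYPE('n) l}.
        L2_inner \<sigma> (Y j) (Y k) = (if j = k then 1 else 0))"

text \<open>Functions on \<open>[0, \<infinity>)\<close> are represented by functions on \<^typ>\<open>real\<close> of which only
  the values on \<open>{0..}\<close> matter.\<close>

definition filter_function :: "(real \<Rightarrow> real) \<Rightarrow> bool" where
  "filter_function h \<longleftrightarrow>
     continuous_on {0..} h \<and> (\<forall>t\<in>{0..1}. h t = 1) \<and> (\<forall>t\<ge>2. h t = 0)"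

definition abs_continuous_on :: "real set \<Rightarrow> (real \<Rightarrow> real) \<Rightarrow> bool" where
  "abs_continuous_on A f \<longleftrightarrow>
     (\<forall>\<epsilon>>0. \<exists>\<delta>>0. \<forall>(n::nat) a b.
        (\<forall>i<n. a i \<in> A \<and> b i \<in> A \<and> a i \<le> b i) \<and>
        disjoint_family_on (\<lambda>i. {a i<..<b i}) {..<n} \<and>
        (\<Sum>i<n. b i - a i) < \<delta>
        \<longrightarrow> (\<Sum>i<n. \<bar>f (b i) - f (a i)\<bar>) < \<epsilon>)"

definition bounded_variation_on :: "real set \<Rightarrow> (real \<Rightarrow> real) \<Rightarrow> bool" where
  "bounded_variation_on A f \<longleftrightarrow>
     (\<exists>B. \<forall>(n::nat) x. x ` {..n} \<subseteq> A \<and> mono_on {..n} x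
        \<longrightarrow> (\<Sum>i<n. \<bar>f (x (Suc i)) - f (x i)\<bar>) \<le> B)"

text \<open>In the case \<open>r > 0\<close>, \<open>D j\<close> is the derivative of order \<open>j < r\<close> of \<open>h\<close> (one-sided at
  \<open>0\<close>), and \<open>gp\<close>, \<open>gm\<close> are the right and left derivatives of order \<open>r\<close>.\<close>

definition WBV :: "nat \<Rightarrow> (real \<Rightarrow> real) set" where
  "WBV r = {h.
     if r = 0 then abs_continuous_on {0..} h \<and> bounded_variation_on {0..} h
     else \<exists>D gp gm. D 0 = h \<and>
       (\<forall>j. Suc j < r \<longrightarrow>
          (\<forall>t\<ge>0. (D j has_real_derivative D (Suc j) t) (at t within {0..}))) \<and>
       (\<forall>j<r. abs_continuous_on {0..} (D j)) \<and>
       (\<forall>t\<ge>0. (D (r - 1) has_real_derivative gp t) (at_right t)) \<and>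
       (\<forall>t>0. (D (r - 1) has_real_derivative gm t) (at_left t)) \<and>
       bounded_variation_on {0..} gp \<and> bounded_variation_on {0<..} gm}"

definition filtered_operator ::
    "(real^'n) measure \<Rightarrow> (nat \<Rightarrow> nat \<Rightarrow> real^'n \<Rightarrow> real) \<Rightarrow> (real \<Rightarrow> real) \<Rightarrow> nat
      \<Rightarrow> (real^'n \<Rightarrow> real) \<Rightarrow> real^'n \<Rightarrow> real" where
  "filtered_operator \<sigma> Y h L f x =
     (\<Sum>l. \<Sum>k = 1..harm_dim TYPE('n) l.
        h (real l / real L) * L2_inner \<sigma> f (Y l k) * Y l k x)"

definition filtered_operator_norm ::
    "(real^'n) measure \<Rightarrow> (nat \<Rightarrow> nat \<Rightarrow> real^'n \<Rightarrow> real) \<Rightarrow> (real \<Rightarrow> real) \<Rightarrow> nat \<Rightarrow> ereal" where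
  "filtered_operator_norm \<sigma> Y h L =
     (SUP f\<in>{f \<in> Linf \<sigma>. Linf_norm \<sigma> f \<le> 1}. Linf_norm \<sigma> (filtered_operator \<sigma> Y h L f))"

end

theory Submission
  imports Defs "HOL-Probability.Probability_Measure" "HOL-Real_Asymp.Real_Asymp"
begin

text \<open>
  Test functions are zonal polynomials \<open>f(x) = F(x\<^sub>i)\<close>, and the image of \<open>f\<close> is examined at
  the pole \<open>e\<^sub>i\<close>. If \<open>F = \<Sum> c\<^sub>l R\<^sub>l\<close>, where \<open>R\<^sub>l\<close> is the Gegenbauer polynomial of parameter
  \<open>\<lambda> = (d - 1) / 2\<close> normalised by \<open>R\<^sub>l(1) = 1\<close>, then \<open>V\<^sub>L f\<close> takes the value \<open>\<Sum> c\<^sub>l h(l/L)\<close> there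
  (\<open>filtered_operator_norm_ge\<close>). This rests on the orthogonality of harmonics of different degrees
  with respect to an abstract rotation invariant \<open>\<sigma>\<close>, which comes from the self-adjointness of the
  spherical Laplacian, and on the fact that the essential supremum of a continuous function
  dominates each of its values, because all caps of a given radius have the same, hence
  positive, measure.

  For \<open>d \<ge> 3\<close> the filter is a spline with a kink of order \<open>r = \<lfloor>(d - 1) / 2\<rfloor>\<close> at the end \<open>2\<close> of its
  support, \<open>h(t) = c (2 - t)\<^sub>+\<^sup>r\<close> near \<open>2\<close>. Gegenbauer polynomials of parameter \<open>\<mu>\<close> are
  combinations of two of parameter \<open>\<mu> + 1\<close> (\<open>gegenbauer_lower\<close>); by duality a multiplier on a
  sphere acts on zonal functions as another multiplier on the sphere of two dimensions less. At
  frequencies \<open>2L - k\<close> with \<open>k\<close> fixed and \<open>L \<rightarrow> \<infinity>\<close> this step is, up to a constant, \<open>L\<close> times a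
  difference with step two (\<open>lower_limit\<close>). After \<open>r\<close> steps the kink has become a jump: the
  multiplier tends to \<open>P \<cdot> kink r k\<close>, a nonzero constant for \<open>k \<ge> 0\<close> and zero for
  \<open>k \<le> -2r\<close> (\<open>spline_multiplier_limit\<close>), and the parameter is \<open>0\<close> or \<open>1/2\<close>.

  \<^item> If \<open>d\<close> is odd, the parameter is \<open>0\<close> and \<open>R\<^sub>n(cos \<theta>) = cos n\<theta>\<close>. As in Fejer's example of a
    divergent Fourier series, the cosine polynomials
    \<open>2 sin(2L\<theta>) \<Sum>\<^bsub>k<K\<^esub> a\<^sub>k sin((k+1)\<theta>)\<close> are bounded uniformly, while cutting them at the frequency
    \<open>2L\<close> yields about \<open>\<Sum> a\<^sub>k \<sim> ln K\<close>.
  \<^item> If \<open>d\<close> is even, the parameter is \<open>1/2\<close>. For Legendre polynomials \<open>\<surd>n (P\<^sub>n\<^sub>-\<^sub>1 - P\<^sub>n\<^sub>+\<^sub>1)\<close> is bounded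
    uniformly for even \<open>n\<close> (\<open>legendre_difference_bound\<close>), and a jump between the two frequencies
    yields a value of order \<open>\<surd>L\<close>.

  For \<open>d = 2\<close> there is no step to be made, and a jump is not continuous; there
  \<open>h(t) = (2 - t)\<^sup>1\<^sup>/\<^sup>4\<close> near \<open>2\<close> is absolutely continuous and still leaves a growth of \<open>L\<^sup>1\<^sup>/\<^sup>4\<close>.
\<close>

section \<open>Partial derivatives of polynomials\<close>

text \<open>
  Polynomials are closed under this operator, so that the Laplacian and the generators of
  rotations can be iterated without returning to difference quotients.
\<close>

definition partial_deriv :: "'n \<Rightarrow> (real^'n \<Rightarrow> real) \<Rightarrow> real^'n \<Rightarrow> real" where
  "partial_deriv i p x = deriv (\<lambda>t. p (x + t *\<^sub>R axis i 1)) 0"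

lemma DERIV_along_axis:
  assumes "(p has_derivative D) (at (x + s *\<^sub>R axis i 1))"
  shows "((\<lambda>t. p (x + t *\<^sub>R axis i 1)) has_field_derivative D (axis i 1)) (at s)"
proof -
  have "((\<lambda>t. p (x + t *\<^sub>R axis i 1)) has_derivative (\<lambda>t. D (t *\<^sub>R axis i 1))) (at s)"
  proof (rule has_derivative_compose[where g = p and f = "\<lambda>t. x + t *\<^sub>R axis i 1"])
    show "((\<lambda>t. x + t *\<^sub>R axis i 1) has_derivative (\<lambda>t. t *\<^sub>R axis i 1)) (at s)"
      by (auto intro!: derivative_eq_intros)
  qed (use assms in simp)
  moreover have "D (t *\<^sub>R axis i 1) = D (axis i 1) * t" for t
    using has_derivative_linear[OF assms] by (simp add: linear_scale)
  ultimately show ?thesis by (simp add: has_field_derivative_def)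
qed

lemma partial_deriv_unique:
  assumes "(p has_derivative D) (at x)"
  shows "partial_deriv i p x = D (axis i 1)"
  using DERIV_along_axis[of p D x 0 i] assms unfolding partial_deriv_def by (simp add: DERIV_imp_deriv)

lemma real_polynomial_gradient:
  fixes p :: "real^'n \<Rightarrow> real"
  assumes "real_polynomial_function p"
  shows "\<exists>q. (\<forall>i. real_polynomial_function (q i)) \<and>
             (\<forall>x. (p has_derivative (\<lambda>v. \<Sum>i\<in>UNIV. v $ i * q i x)) (at x))"
  using assms
proof induction
  case (linear f)
  have "f v = (\<Sum>i\<in>UNIV. v $ i * f (axis i 1))" for v
  proof -
    have "f v = f (\<Sum>i\<in>UNIV. (v $ i) *\<^sub>R axis i 1)"
      using basis_expansion[of v] by (simp only: scalar_mult_eq_scaleR)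
    also have "\<dots> = (\<Sum>i\<in>UNIV. v $ i * f (axis i 1))"
      using linear by (simp add: linear_sum linear_scale bounded_linear.linear)
    finally show ?thesis .
  qed
  hence eq: "(\<lambda>v. \<Sum>i\<in>UNIV. v $ i * f (axis i 1)) = f" by (metis (no_types, lifting) ext)
  show ?case
    using linear by (intro exI[of _ "\<lambda>i x. f (axis i 1)"])
       (simp add: eq bounded_linear_imp_has_derivative real_polynomial_function.intros(2))
next
  case (const c)
  show ?case
    by (intro exI[of _ "\<lambda>i x. 0"]) (simp add: real_polynomial_function.intros(2))
next
  case (add f g)
  then obtain q r where
    "\<And>i. real_polynomial_function (q i)" "\<And>i. real_polynomial_function (r i)"
    "\<And>x. (f has_derivative (\<lambda>v. \<Sum>i\<in>UNIV. v $ i * q i x)) (at x)"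
    "\<And>x. (g has_derivative (\<lambda>v. \<Sum>i\<in>UNIV. v $ i * r i x)) (at x)" by blast
  thus ?case
    by (intro exI[of _ "\<lambda>i x. q i x + r i x"])
       (simp add: distrib_left sum.distrib has_derivative_add real_polynomial_function.intros(3))
next
  case (mult f g)
  then obtain q r where
    q: "\<And>i. real_polynomial_function (q i)" "\<And>i. real_polynomial_function (r i)"
    "\<And>x. (f has_derivative (\<lambda>v. \<Sum>i\<in>UNIV. v $ i * q i x)) (at x)"
    "\<And>x. (g has_derivative (\<lambda>v. \<Sum>i\<in>UNIV. v $ i * r i x)) (at x)" by blast
  have "((\<lambda>x. f x * g x) has_derivative
          (\<lambda>v. \<Sum>i\<in>UNIV. v $ i * (q i x * g x + f x * r i x))) (at x)" for x
  proof (rule has_derivative_eq_rhs[OF has_derivative_mult[OF q(3) q(4)]])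
    show "(\<lambda>v. f x * (\<Sum>i\<in>UNIV. v $ i * r i x) + (\<Sum>i\<in>UNIV. v $ i * q i x) * g x) =
          (\<lambda>v. \<Sum>i\<in>UNIV. v $ i * (q i x * g x + f x * r i x))"
      by (rule ext)
         (simp add: sum_distrib_left sum_distrib_right flip: sum.distrib, simp add: algebra_simps)
  qed
  thus ?case
    by (intro exI[of _ "\<lambda>i x. q i x * g x + f x * r i x"] conjI allI
          real_polynomial_function.intros(3) real_polynomial_function.intros(4) q mult.hyps)
qed

lemma sum_axis_mult: "(\<Sum>j\<in>UNIV. axis i (1::real) $ j * q j) = q i"
proof -
  have "(\<Sum>j\<in>UNIV. axis i (1::real) $ j * q j) = (\<Sum>j\<in>UNIV. if j = i then q j else 0)"
    by (intro sum.cong) (auto simp: axis_def)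
  thus ?thesis by simp
qed

lemma
  fixes p :: "real^'n \<Rightarrow> real"
  assumes "real_polynomial_function p"
  shows real_polynomial_partial_deriv [intro]: "real_polynomial_function (partial_deriv i p)"
    and has_derivative_partial_deriv: "(p has_derivative (\<lambda>v. \<Sum>i\<in>UNIV. v $ i * partial_deriv i p x)) (at x)"
proof -
  obtain q where q: "\<And>i. real_polynomial_function (q i)"
    "\<And>x. (p has_derivative (\<lambda>v. \<Sum>i\<in>UNIV. v $ i * q i x)) (at x)"
    using real_polynomial_gradient[OF assms] by blast
  have "partial_deriv i p = q i" for i
  proof
    fix x
    have "partial_deriv i p x = (\<Sum>j\<in>UNIV. axis i 1 $ j * q j x)" by (rule partial_deriv_unique[OF q(2)])
    thus "partial_deriv i p x = q i x" by (simp only: sum_axis_mult)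
  qed
  thus "real_polynomial_function (partial_deriv i p)"
    and "(p has_derivative (\<lambda>v. \<Sum>i\<in>UNIV. v $ i * partial_deriv i p x)) (at x)" using q by simp_all
qed

lemma real_polynomial_component [intro]: "real_polynomial_function (\<lambda>x::real^'n. x $ i)"
  by (intro real_polynomial_function.intros(1) bounded_linear_vec_nth)

lemma partial_deriv_component [simp]: "partial_deriv j (\<lambda>x. x $ i) x = (if i = j then 1 else 0)"
proof -
  have "((\<lambda>x. x $ i) has_derivative (\<lambda>x. x $ i)) (at x)"
    by (intro bounded_linear_imp_has_derivative bounded_linear_vec_nth)
  from partial_deriv_unique[OF this, of j] show ?thesis by (simp add: axis_def)
qed

lemma partial_deriv_const [simp]: "partial_deriv j (\<lambda>x. c) x = 0"
  using partial_deriv_unique[of "\<lambda>x. c" "\<lambda>x. 0"] by auto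

lemma partial_deriv_add:
  assumes "real_polynomial_function p" "real_polynomial_function q"
  shows "partial_deriv i (\<lambda>x. p x + q x) x = partial_deriv i p x + partial_deriv i q x"
  using partial_deriv_unique[OF has_derivative_add[OF assms[THEN has_derivative_partial_deriv]], of i]
  by (simp add: sum_axis_mult)

lemma partial_deriv_diff:
  assumes "real_polynomial_function p" "real_polynomial_function q"
  shows "partial_deriv i (\<lambda>x. p x - q x) x = partial_deriv i p x - partial_deriv i q x"
  using partial_deriv_unique[OF has_derivative_diff[OF assms[THEN has_derivative_partial_deriv]], of i]
  by (simp add: sum_axis_mult)

lemma partial_deriv_mult:
  assumes "real_polynomial_function p" "real_polynomial_function q"
  shows "partial_deriv i (\<lambda>x. p x * q x) x = partial_deriv i p x * q x + p x * partial_deriv i q x"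
  using partial_deriv_unique[OF has_derivative_mult[OF assms[THEN has_derivative_partial_deriv]], of i]
  by (simp add: sum_axis_mult)

lemma partial_deriv_cmult:
  assumes "real_polynomial_function q"
  shows "partial_deriv i (\<lambda>x. c * q x) x = c * partial_deriv i q x"
  using partial_deriv_mult[OF real_polynomial_function.intros(2) assms, of i c] by simp

lemma partial_deriv_sum:
  assumes "finite A" "\<And>a. a \<in> A \<Longrightarrow> real_polynomial_function (p a)"
  shows "partial_deriv i (\<lambda>x. \<Sum>a\<in>A. p a x) x = (\<Sum>a\<in>A. partial_deriv i (p a) x)"
  using assms
proof (induction A)
  case (insert a A)
  hence "real_polynomial_function (\<lambda>x. \<Sum>a\<in>A. p a x)" by auto
  with insert show ?case by (simp add: partial_deriv_add)
qed auto

lemma laplacian_partial_deriv: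
  fixes p :: "real^'n \<Rightarrow> real"
  assumes "real_polynomial_function p"
  shows "laplacian p x = (\<Sum>i\<in>UNIV. partial_deriv i (partial_deriv i p) x)"
proof -
  have "deriv (\<lambda>t. p (x + t *\<^sub>R axis i 1)) s = partial_deriv i p (x + s *\<^sub>R axis i 1)" for i s
    using DERIV_along_axis[where x = x and s = s and i = i, OF has_derivative_partial_deriv[OF assms]]
    by (simp add: DERIV_imp_deriv sum_axis_mult)
  hence "deriv (\<lambda>t. p (x + t *\<^sub>R axis i 1)) = (\<lambda>s. partial_deriv i p (x + s *\<^sub>R axis i 1))" for i
    by (intro ext)
  thus ?thesis by (simp add: laplacian_def numeral_2_eq_2 partial_deriv_def[of _ "partial_deriv _ p"])
qed

text \<open>
  Euler's identity: differentiate \<open>p (c x) = c\<^sup>l p x\<close> at \<open>c = 1\<close>.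
\<close>

lemma euler_homogeneous:
  fixes p :: "real^'n \<Rightarrow> real"
  assumes p: "real_polynomial_function p" and hom: "\<And>c x. p (c *\<^sub>R x) = c ^ l * p x"
  shows "(\<Sum>i\<in>UNIV. x $ i * partial_deriv i p x) = real l * p x"
proof -
  have "((\<lambda>c::real. p (c *\<^sub>R x)) has_derivative (\<lambda>c. \<Sum>i\<in>UNIV. (c *\<^sub>R x) $ i * partial_deriv i p x)) (at 1)"
  proof (rule has_derivative_compose[where g = p and f = "\<lambda>c. c *\<^sub>R x"])
    show "((\<lambda>c. c *\<^sub>R x) has_derivative (\<lambda>c. c *\<^sub>R x)) (at 1)"
      by (auto intro!: derivative_eq_intros)
  qed (use has_derivative_partial_deriv[OF p] in simp)
  moreover have "(\<lambda>c. \<Sum>i\<in>UNIV. (c *\<^sub>R x) $ i * partial_deriv i p x)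
      = (\<lambda>c. (\<Sum>i\<in>UNIV. x $ i * partial_deriv i p x) * c)"
    by (simp add: sum_distrib_left mult_ac)
  ultimately have "((\<lambda>c::real. p (c *\<^sub>R x)) has_field_derivative (\<Sum>i\<in>UNIV. x $ i * partial_deriv i p x)) (at 1)"
    by (simp add: has_field_derivative_def)
  moreover have "((\<lambda>c::real. c ^ l * p x) has_field_derivative (real l * p x)) (at 1)"
    by (auto intro!: derivative_eq_intros)
  ultimately show ?thesis using DERIV_unique hom by simp
qed

section \<open>Solid Gegenbauer polynomials\<close>

text \<open>
  For \<open>q = 1\<close> these are the Gegenbauer polynomials \<open>C\<^sub>n\<^sup>\<mu>\<close> divided by their value at \<open>1\<close>, which makes
  sense for \<open>\<mu> = 0\<close> as well: \<open>\<mu> = 0\<close> gives the Chebyshev and \<open>\<mu> = 1/2\<close> the Legendre polynomials.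
  The variable \<open>q\<close> homogenises them, so that \<open>s = x\<^sub>k\<close> and \<open>q = |x|\<^sup>2\<close> give a homogeneous polynomial in
  \<open>x\<close>. Degree one is listed separately because the recurrence would divide by \<open>2 \<mu> = 0\<close>.
\<close>

fun gegenbauer :: "real \<Rightarrow> nat \<Rightarrow> real \<Rightarrow> real \<Rightarrow> real" where
  "gegenbauer \<mu> 0 s q = 1"
| "gegenbauer \<mu> (Suc 0) s q = s"
| "gegenbauer \<mu> (Suc (Suc n)) s q =
     (2 * (real n + 1 + \<mu>) * s * gegenbauer \<mu> (Suc n) s q - (real n + 1) * q * gegenbauer \<mu> n s q)
       / (real n + 1 + 2 * \<mu>)"

lemma gegenbauer_one:
  assumes "\<mu> \<ge> 0"
  shows "gegenbauer \<mu> n 1 1 = 1"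
  using assms by (induction n rule: induct_nat_012) (auto simp: field_simps add_nonneg_eq_0_iff)

lemma gegenbauer_scale: "gegenbauer \<mu> n (c * s) (c^2 * q) = c ^ n * gegenbauer \<mu> n s q"
proof (induction n rule: induct_nat_012)
  case (ge2 n)
  show ?case
    unfolding gegenbauer.simps ge2 by (simp add: algebra_simps power2_eq_square diff_divide_distrib)
qed auto

lemma real_polynomial_inner_self [intro]: "real_polynomial_function (\<lambda>x::real^'n. x \<bullet> x)"
  unfolding inner_vec_def by (auto intro!: real_polynomial_function_sum)

lemma real_polynomial_gegenbauer:
  "real_polynomial_function (\<lambda>x::real^'n. gegenbauer \<mu> n (x $ i) (x \<bullet> x))"
proof (induction n rule: induct_nat_012)
  case (ge2 n)
  show ?case unfolding gegenbauer.simps using ge2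
    by (intro real_polynomial_inner_self real_polynomial_function_divide real_polynomial_function_diff
          real_polynomial_function.intros(4) real_polynomial_function.intros(2) real_polynomial_component)
qed auto

lemma partial_deriv_inner_self: "partial_deriv j (\<lambda>x::real^'n. x \<bullet> x) x = 2 * x $ j"
proof -
  have "((\<lambda>x::real^'n. x \<bullet> x) has_derivative (\<lambda>v. x \<bullet> v + v \<bullet> x)) (at x)"
    by (auto intro!: derivative_eq_intros)
  from partial_deriv_unique[OF this, of j] show ?thesis by (simp add: inner_axis inner_commute)
qed

definition zonal :: "real \<Rightarrow> 'n::finite \<Rightarrow> nat \<Rightarrow> real^'n \<Rightarrow> real" where
  "zonal \<mu> k n x = gegenbauer \<mu> n (x $ k) (x \<bullet> x)"

lemma real_polynomial_zonal [intro]: "real_polynomial_function (zonal \<mu> k n)"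
  unfolding zonal_def by (rule real_polynomial_gegenbauer)

lemma zonal_Suc_Suc:
  "zonal \<mu> k (Suc (Suc n)) =
     (\<lambda>x. (2 * (real n + 1 + \<mu>) / (real n + 1 + 2 * \<mu>)) * (x $ k * zonal \<mu> k (Suc n) x)
         - ((real n + 1) / (real n + 1 + 2 * \<mu>)) * ((x \<bullet> x) * zonal \<mu> k n x))"
  by (simp add: zonal_def fun_eq_iff diff_divide_distrib mult_ac)

lemma partial_deriv_combination:
  fixes f g :: "real^'n \<Rightarrow> real"
  assumes "real_polynomial_function f" "real_polynomial_function g"
  shows "partial_deriv i (\<lambda>x. a * f x - b * g x) x = a * partial_deriv i f x - b * partial_deriv i g x"
  using assms by (subst partial_deriv_diff) (auto simp: partial_deriv_cmult intro: real_polynomial_function.intros)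

lemma partial_deriv_component_mult:
  fixes p :: "real^'n \<Rightarrow> real"
  assumes "real_polynomial_function p"
  shows "partial_deriv i (\<lambda>x. x $ k * p x) x = (if i = k then p x else 0) + x $ k * partial_deriv i p x"
  using assms by (subst partial_deriv_mult) (auto intro: real_polynomial_component)

lemma partial_deriv_inner_self_mult:
  fixes p :: "real^'n \<Rightarrow> real"
  assumes "real_polynomial_function p"
  shows "partial_deriv i (\<lambda>x. (x \<bullet> x) * p x) x = 2 * (x $ i * p x) + (x \<bullet> x) * partial_deriv i p x"
  using assms by (subst partial_deriv_mult) (auto simp: partial_deriv_inner_self)

text \<open>
  The zonal polynomials form an Appell sequence in the direction of their axis. This identity
  carries the induction for their harmonicity.
\<close>

lemma partial_deriv_zonal:
  fixes k :: "'n::finite"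
  assumes "\<mu> \<ge> 0"
  shows "partial_deriv k (zonal \<mu> k n) x = real n * zonal \<mu> k (n - 1) x"
proof (induction n rule: induct_nat_012)
  case 0
  have "zonal \<mu> k 0 = (\<lambda>x. 1)" by (simp add: zonal_def fun_eq_iff)
  thus ?case by simp
next
  case 1
  have "zonal \<mu> k (Suc 0) = (\<lambda>x. x $ k)" by (simp add: zonal_def fun_eq_iff)
  thus ?case by (simp add: zonal_def)
next
  case (ge2 n)
  define D where "D = real n + 1 + 2 * \<mu>"
  have D: "D > 0" using assms by (simp add: D_def)
  have "partial_deriv k (zonal \<mu> k (Suc (Suc n))) x =
          (2 * (real n + 1 + \<mu>) / D) * (zonal \<mu> k (Suc n) x + x $ k * (real (Suc n) * zonal \<mu> k n x))
        - ((real n + 1) / D) * (2 * (x $ k * zonal \<mu> k n x) + (x \<bullet> x) * (real n * zonal \<mu> k (n - 1) x))"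
    unfolding zonal_Suc_Suc[of \<mu> k n] D_def
    by (subst partial_deriv_combination)
       (auto intro: real_polynomial_function.intros simp: partial_deriv_component_mult partial_deriv_inner_self_mult
          real_polynomial_zonal ge2)
  moreover have "(real n + 2 * \<mu>) * zonal \<mu> k (Suc n) x = 2 * (real n + \<mu>) * (x $ k * zonal \<mu> k n x)
      - real n * ((x \<bullet> x) * zonal \<mu> k (n - 1) x)"
  proof (cases n)
    case (Suc m)
    define E where "E = real m + 1 + 2 * \<mu>"
    have "E > 0" using assms by (simp add: E_def)
    hence "E * zonal \<mu> k (Suc (Suc m)) x = 2 * (real m + 1 + \<mu>) * (x $ k * zonal \<mu> k (Suc m) x)
             - (real m + 1) * ((x \<bullet> x) * zonal \<mu> k m x)"
      unfolding zonal_Suc_Suc[of \<mu> k m] E_def[symmetric] by (simp add: right_diff_distrib)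
    thus ?thesis by (simp add: Suc E_def add_ac)
  qed (auto simp: zonal_def)
  hence "real n * ((x \<bullet> x) * zonal \<mu> k (n - 1) x) =
     2 * (real n + \<mu>) * (x $ k * zonal \<mu> k n x) - (real n + 2 * \<mu>) * zonal \<mu> k (Suc n) x" by simp
  ultimately have "D * partial_deriv k (zonal \<mu> k (Suc (Suc n))) x =
       2 * (real n + 1 + \<mu>) * (zonal \<mu> k (Suc n) x + x $ k * (real (Suc n) * zonal \<mu> k n x))
        - (real n + 1) * (2 * (x $ k * zonal \<mu> k n x) +
         (2 * (real n + \<mu>) * (x $ k * zonal \<mu> k n x) - (real n + 2 * \<mu>) * zonal \<mu> k (Suc n) x))"
    using D by (simp add: right_diff_distrib mult_ac)
  also have "\<dots> = D * (real (Suc (Suc n)) * zonal \<mu> k (Suc n) x)"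
    by (simp add: D_def algebra_simps)
  finally show ?case using D by simp
qed

lemma
  fixes p :: "real^'n \<Rightarrow> real"
  assumes p: "real_polynomial_function p"
  shows laplacian_component_mult:
      "laplacian (\<lambda>x. x $ k * p x) x = x $ k * laplacian p x + 2 * partial_deriv k p x"
    and laplacian_inner_self_mult:
      "laplacian (\<lambda>x. (x \<bullet> x) * p x) x = (x \<bullet> x) * laplacian p x
         + 4 * (\<Sum>i\<in>UNIV. x $ i * partial_deriv i p x) + 2 * real CARD('n) * p x"
proof -
  have "partial_deriv i (partial_deriv i (\<lambda>x. x $ k * p x)) x = x $ k * partial_deriv i (partial_deriv i p) x + (if i = k then 2 * partial_deriv k p x else 0)" for i
  proof -
    have "partial_deriv i (\<lambda>x. x $ k * p x) = (\<lambda>x. (if i = k then 1 else 0) * p x + x $ k * partial_deriv i p x)"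
      using p by (auto simp: fun_eq_iff partial_deriv_component_mult)
    thus ?thesis using p
      by (simp add: partial_deriv_add partial_deriv_cmult partial_deriv_component_mult real_polynomial_function.intros real_polynomial_partial_deriv
          real_polynomial_component)
  qed
  thus "laplacian (\<lambda>x. x $ k * p x) x = x $ k * laplacian p x + 2 * partial_deriv k p x"
    using p by (simp add: laplacian_partial_deriv real_polynomial_function.intros real_polynomial_component
        sum.distrib sum_distrib_left)
  have "partial_deriv i (partial_deriv i (\<lambda>x. (x \<bullet> x) * p x)) x =
          (x \<bullet> x) * partial_deriv i (partial_deriv i p) x + 4 * (x $ i * partial_deriv i p x) + 2 * p x" for i
  proof -
    have "partial_deriv i (\<lambda>x. (x \<bullet> x) * p x) = (\<lambda>x. 2 * (x $ i * p x) + (x \<bullet> x) * partial_deriv i p x)"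
      using p by (auto simp: fun_eq_iff partial_deriv_inner_self_mult)
    thus ?thesis using p
      by (simp add: partial_deriv_add partial_deriv_cmult partial_deriv_component_mult partial_deriv_inner_self_mult real_polynomial_function.intros
          real_polynomial_partial_deriv real_polynomial_component real_polynomial_inner_self)
  qed
  thus "laplacian (\<lambda>x. (x \<bullet> x) * p x) x = (x \<bullet> x) * laplacian p x
         + 4 * (\<Sum>i\<in>UNIV. x $ i * partial_deriv i p x) + 2 * real CARD('n) * p x"
    using p by (simp add: laplacian_partial_deriv real_polynomial_function.intros real_polynomial_inner_self
        sum.distrib sum_distrib_left)
qed

lemma laplacian_combination:
  fixes f g :: "real^'n \<Rightarrow> real"
  assumes "real_polynomial_function f" "real_polynomial_function g"
  shows "laplacian (\<lambda>x. a * f x - b * g x) x = a * laplacian f x - b * laplacian g x"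
proof -
  have "partial_deriv i (\<lambda>x. a * f x - b * g x) = (\<lambda>x. a * partial_deriv i f x - b * partial_deriv i g x)" for i
    using assms by (simp add: partial_deriv_combination fun_eq_iff)
  moreover have "real_polynomial_function (\<lambda>x. a * f x - b * g x)"
    using assms by (intro real_polynomial_function_diff real_polynomial_function.intros(2,4))
  ultimately show ?thesis using assms
    by (simp add: laplacian_partial_deriv partial_deriv_combination real_polynomial_partial_deriv sum_subtractf sum_distrib_left)
qed

lemma zonal_scale: "zonal \<mu> k n (c *\<^sub>R x) = c ^ n * zonal \<mu> k n x"
  using gegenbauer_scale[of \<mu> n c "x $ k" "x \<bullet> x"] by (simp add: zonal_def power2_eq_square mult_ac)

text \<open>
  Apply the Laplacian to the recurrence. Multiplication by \<open>x\<^sub>k\<close> and by \<open>|x|\<^sup>2\<close> produces the extra terms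
  \<open>2 \<partial>\<^sub>k H\<^sub>n\<^sub>+\<^sub>1\<close> and \<open>(4 n + 2 N) H\<^sub>n\<close>, with \<open>N\<close> the dimension of the space; by the Appell property
  both are multiples of \<open>H\<^sub>n\<close>, and they cancel for \<open>N = 2 \<mu> + 2\<close>.
\<close>

lemma harmonic_zonal:
  fixes k :: "'n::finite"
  assumes \<mu>: "real CARD('n) = 2 * \<mu> + 2" "\<mu> \<ge> 0"
  shows "harmonic_homogeneous_polynomial n (zonal \<mu> k n)"
proof -
  have "laplacian (zonal \<mu> k n) x = 0" for x
  proof (induction n rule: induct_nat_012)
    case 0
    have "zonal \<mu> k 0 = (\<lambda>x. 1)" by (simp add: zonal_def fun_eq_iff)
    thus ?case by (simp add: laplacian_def numeral_2_eq_2)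
  next
    case 1
    have "zonal \<mu> k (Suc 0) = (\<lambda>x. x $ k * 1)" by (simp add: zonal_def fun_eq_iff)
    moreover have "laplacian (\<lambda>x. 1::real) x = 0" by (simp add: laplacian_def numeral_2_eq_2)
    ultimately show ?case
      using laplacian_component_mult[OF real_polynomial_function.intros(2)[of 1], of k x] by simp
  next
    case (ge2 n)
    have e: "(\<Sum>i\<in>UNIV. x $ i * partial_deriv i (zonal \<mu> k n) x) = real n * zonal \<mu> k n x"
      by (rule euler_homogeneous[OF real_polynomial_zonal zonal_scale])
    have "laplacian (zonal \<mu> k (Suc (Suc n))) x =
      (2 * (real n + 1 + \<mu>) / (real n + 1 + 2 * \<mu>)) * (2 * (real (Suc n) * zonal \<mu> k n x))
      - ((real n + 1) / (real n + 1 + 2 * \<mu>)) * (4 * (real n * zonal \<mu> k n x) + 2 * real CARD('n) * zonal \<mu> k n x)"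
      unfolding zonal_Suc_Suc[of \<mu> k n]
      by (subst laplacian_combination)
         (auto intro: real_polynomial_function.intros simp: laplacian_component_mult e partial_deriv_zonal[OF \<mu>(2)]
          laplacian_inner_self_mult real_polynomial_zonal ge2)
    also have "\<dots> = 0" by (simp add: \<mu>(1) algebra_simps flip: add_divide_distrib)
    finally show ?case .
  qed
  thus ?thesis by (auto simp: harmonic_homogeneous_polynomial_def zonal_scale)
qed

section \<open>Integration over the sphere\<close>

locale sphere_measure =
  fixes \<sigma> :: "(real^'n) measure"
  assumes inv: "rotation_invariant_sphere_measure \<sigma>"
begin

lemma space_sphere [simp]: "space \<sigma> = sphere 0 1"
  and sets_sphere [measurable_cong]: "sets \<sigma> = sets (restrict_space borel (sphere 0 1))"
  and distr_rotation: "rotation_matrix Q \<Longrightarrow> distr \<sigma> \<sigma> ((*v) Q) = \<sigma>"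
  and emeasure_sphere: "emeasure \<sigma> (sphere 0 1) = 1"
  using inv by (auto simp: rotation_invariant_sphere_measure_def)

sublocale prob_space \<sigma>
  by standard (simp add: emeasure_sphere)

lemma measurable_continuous:
  fixes f :: "real^'n \<Rightarrow> real"
  assumes "continuous_on (sphere 0 1) f"
  shows "f \<in> borel_measurable \<sigma>"
  using borel_measurable_continuous_on_restrict[OF assms]
  by (simp add: measurable_cong_sets[OF sets_sphere refl])

lemma bounded_continuous:
  fixes f :: "real^'n \<Rightarrow> real"
  assumes "continuous_on (sphere 0 1) f"
  shows "\<exists>B. \<forall>x\<in>sphere 0 1. \<bar>f x\<bar> \<le> B"
proof -
  have "bounded (f ` sphere 0 1)"
    by (intro compact_imp_bounded compact_continuous_image assms compact_sphere)
  thus ?thesis by (auto simp: bounded_iff)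
qed

lemma integrable_continuous:
  fixes f :: "real^'n \<Rightarrow> real"
  assumes "continuous_on (sphere 0 1) f"
  shows "integrable \<sigma> f"
proof -
  obtain B where "\<forall>x\<in>sphere 0 1. \<bar>f x\<bar> \<le> B" using bounded_continuous[OF assms] by blast
  thus ?thesis using measurable_continuous[OF assms]
    by (intro integrable_const_bound[of f B]) auto
qed

lemma continuous_polynomial: "real_polynomial_function p \<Longrightarrow> continuous_on A p"
  by (simp add: real_polynomial_function_eq continuous_on_polymonial_function)

lemmas integrable_polynomial = integrable_continuous[OF continuous_polynomial]

lemma norm_rotation:
  assumes "rotation_matrix Q"
  shows "norm (Q *v x) = norm (x::real^'n)"
proof -
  have "orthogonal_transformation ((*v) Q)"
    using assms by (simp add: rotation_matrix_def orthogonal_transformation_matrix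
        matrix_vector_mul_linear matrix_of_matrix_vector_mul)
  thus ?thesis by (simp add: orthogonal_transformation)
qed

lemma measurable_rotation:
  assumes "rotation_matrix Q"
  shows "(*v) Q \<in> measurable \<sigma> \<sigma>"
proof -
  have "(*v) Q \<in> measurable (restrict_space borel (sphere 0 1)) (restrict_space borel (sphere 0 1))"
  proof (rule measurable_restrict_space3)
    show "(*v) Q \<in> measurable borel borel"
      by (intro borel_measurable_continuous_onI matrix_vector_mult_linear_continuous_on)
    show "(*v) Q \<in> sphere 0 1 \<rightarrow> sphere 0 1" using norm_rotation[OF assms] by auto
  qed
  thus ?thesis by (simp add: measurable_cong_sets[OF sets_sphere sets_sphere])
qed

lemma integral_rotation:
  fixes f :: "real^'n \<Rightarrow> real"
  assumes "rotation_matrix Q" "f \<in> borel_measurable \<sigma>"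
  shows "(LINT x|\<sigma>. f (Q *v x)) = (LINT x|\<sigma>. f x)"
  using integral_distr[OF measurable_rotation[OF assms(1)] assms(2)] distr_rotation[OF assms(1)]
  by simp

end

section \<open>Rotations in a coordinate plane\<close>

definition plane_rotation :: "'n::finite \<Rightarrow> 'n \<Rightarrow> real \<Rightarrow> real^'n \<Rightarrow> real^'n" where
  "plane_rotation i j t x = x + ((cos t - 1) * x $ i - sin t * x $ j) *\<^sub>R axis i 1
      + (sin t * x $ i + (cos t - 1) * x $ j) *\<^sub>R axis j 1"

lemma linear_plane_rotation: "linear (plane_rotation i j t)"
  by (rule linearI) (auto simp: plane_rotation_def algebra_simps)

lemma norm_plane_rotation:
  assumes "i \<noteq> j"
  shows "norm (plane_rotation i j t x) = norm x"
proof -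
  define a where "a = (cos t - 1) * x $ i - sin t * x $ j"
  define b where "b = sin t * x $ i + (cos t - 1) * x $ j"
  have [simp]: "axis i (1::real) $ j = 0" "axis j (1::real) $ i = 0" using assms by (simp_all add: axis_def)
  have "(norm (plane_rotation i j t x))\<^sup>2 = x \<bullet> x + 2 * a * x $ i + 2 * b * x $ j + a\<^sup>2 + b\<^sup>2"
    unfolding plane_rotation_def a_def[symmetric] b_def[symmetric] power2_norm_eq_inner
    by (simp add: inner_add_left inner_add_right inner_axis inner_axis' inner_axis_axis
        power2_eq_square algebra_simps)
  also have "\<dots> = x \<bullet> x + ((sin t)\<^sup>2 + (cos t)\<^sup>2 - 1) * ((x $ i)\<^sup>2 + (x $ j)\<^sup>2)"
  proof -
    have "2 * ((c - 1) * u - s * v) * u + 2 * (s * u + (c - 1) * v) * v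
          + ((c - 1) * u - s * v)\<^sup>2 + (s * u + (c - 1) * v)\<^sup>2
        = (s\<^sup>2 + c\<^sup>2 - 1) * (u\<^sup>2 + v\<^sup>2)" for c s u v :: real
      by (simp add: power2_eq_square algebra_simps)
    from this[of "cos t" "x $ i" "sin t" "x $ j"] show ?thesis by (simp only: a_def b_def add.assoc)
  qed
  finally show ?thesis by (simp add: power2_norm_eq_inner[symmetric])
qed

lemma plane_rotation_add:
  assumes "i \<noteq> j"
  shows "plane_rotation i j (s + t) x = plane_rotation i j s (plane_rotation i j t x)"
  using assms unfolding plane_rotation_def
  by (simp add: vec_eq_iff axis_def sin_add cos_add algebra_simps)

text \<open>
  A plane rotation is the square of an orthogonal transformation, so its determinant is \<open>1\<close>.
\<close>

lemma rotation_matrix_plane_rotation: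
  assumes "i \<noteq> j"
  shows "rotation_matrix (matrix (plane_rotation i j t))"
proof -
  have o: "orthogonal_matrix (matrix (plane_rotation i j s))" for s
    using linear_plane_rotation[of i j s] norm_plane_rotation[OF assms, of s]
      orthogonal_transformation_matrix[of "plane_rotation i j s"]
    by (simp add: orthogonal_transformation)
  have "plane_rotation i j t = plane_rotation i j (t/2) \<circ> plane_rotation i j (t/2)"
    using plane_rotation_add[OF assms, of "t/2" "t/2"] by (auto simp: fun_eq_iff)
  hence "matrix (plane_rotation i j t) = matrix (plane_rotation i j (t/2)) ** matrix (plane_rotation i j (t/2))"
    by (simp add: matrix_compose linear_plane_rotation)
  hence "det (matrix (plane_rotation i j t)) = det (matrix (plane_rotation i j (t/2))) * det (matrix (plane_rotation i j (t/2)))"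
    by (simp add: det_mul)
  also have "\<dots> = 1" using det_orthogonal_matrix[OF o[of "t/2"]] by auto
  finally show ?thesis using o by (simp add: rotation_matrix_def)
qed

lemma matrix_plane_rotation: "matrix (plane_rotation i j t) *v x = plane_rotation i j t x"
  by (simp add: matrix_works linear_plane_rotation)

text \<open>
  The generator of the rotations in the plane of \<open>x\<^sub>i\<close> and \<open>x\<^sub>j\<close>.
\<close>

definition angular :: "'n \<Rightarrow> 'n \<Rightarrow> (real^'n \<Rightarrow> real) \<Rightarrow> real^'n \<Rightarrow> real" where
  "angular i j p x = x $ i * partial_deriv j p x - x $ j * partial_deriv i p x"

lemma real_polynomial_angular [intro]:
  "real_polynomial_function p \<Longrightarrow> real_polynomial_function (angular i j p)"
  unfolding angular_def
  by (intro real_polynomial_function_diff real_polynomial_function.intros(4)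
      real_polynomial_component real_polynomial_partial_deriv)

lemma DERIV_plane_rotation:
  assumes ij: "i \<noteq> j" and p: "real_polynomial_function p"
  shows "((\<lambda>t. p (plane_rotation i j t x)) has_real_derivative
            angular i j p (plane_rotation i j t x)) (at t)"
proof -
  define z where "z = plane_rotation i j t x"
  have z: "z $ i = cos t * x $ i - sin t * x $ j" "z $ j = sin t * x $ i + cos t * x $ j"
    using ij by (auto simp: z_def plane_rotation_def axis_def algebra_simps)
  have "((\<lambda>t. p (plane_rotation i j t x)) has_derivative
      (\<lambda>h. \<Sum>k\<in>UNIV. ((- h * z $ j) *\<^sub>R axis i 1 + (h * z $ i) *\<^sub>R axis j 1) $ k * partial_deriv k p z)) (at t)"
  proof (rule has_derivative_compose[where g = p and f = "\<lambda>t. plane_rotation i j t x"])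
    show "((\<lambda>t. plane_rotation i j t x) has_derivative
         (\<lambda>h. (- h * z $ j) *\<^sub>R axis i 1 + (h * z $ i) *\<^sub>R axis j 1)) (at t)"
      unfolding plane_rotation_def
      by (rule derivative_eq_intros refl | simp add: z algebra_simps)+
  qed (use has_derivative_partial_deriv[OF p] in \<open>simp add: z_def\<close>)
  moreover have "(\<Sum>k\<in>UNIV. ((- h * z $ j) *\<^sub>R axis i 1 + (h * z $ i) *\<^sub>R axis j 1) $ k * partial_deriv k p z)
      = angular i j p z * h" for h
  proof -
    have "(\<Sum>k\<in>UNIV. ((- h * z $ j) *\<^sub>R axis i 1 + (h * z $ i) *\<^sub>R axis j 1) $ k * partial_deriv k p z)
      = (\<Sum>k\<in>UNIV. (- h * z $ j) * (axis i 1 $ k * partial_deriv k p z) + (h * z $ i) * (axis j 1 $ k * partial_deriv k p z))"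
      by (intro sum.cong refl) (simp add: algebra_simps)
    also have "\<dots> = (- h * z $ j) * partial_deriv i p z + (h * z $ i) * partial_deriv j p z"
      unfolding sum.distrib sum_distrib_left[symmetric] sum_axis_mult ..
    finally show ?thesis by (simp add: angular_def algebra_simps)
  qed
  ultimately show ?thesis by (simp add: has_field_derivative_def z_def)
qed

context sphere_measure
begin

text \<open>
  The integral of \<open>p\<close> rotated by the angle \<open>t\<close> does not depend on \<open>t\<close>; its derivative at \<open>t = 0\<close>
  may be taken under the integral by dominated convergence.
\<close>

lemma integral_angular:
  assumes p: "real_polynomial_function p"
  shows "(LINT x|\<sigma>. angular i j p x) = 0"
proof (cases "i = j")
  case True
  thus ?thesis by (simp add: angular_def)
next
  case ij: False
  define s where "s n x = (p (plane_rotation i j (inverse (real (Suc n))) x) - p x) / inverse (real (Suc n))" for n x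
  obtain B where B: "\<And>x. x \<in> sphere 0 1 \<Longrightarrow> \<bar>angular i j p x\<bar> \<le> B"
    using bounded_continuous[OF continuous_polynomial[OF real_polynomial_angular[OF p]]] by metis
  have cont: "continuous_on UNIV (plane_rotation i j t)" for t
    using linear_plane_rotation by (rule linear_continuous_on_compose[OF continuous_on_id, simplified])
  have contp: "continuous_on A (\<lambda>x. p (plane_rotation i j t x))" for t A
    using continuous_on_compose2[OF continuous_polynomial[OF p, of UNIV] cont] continuous_on_subset by blast
  have s0: "(LINT x|\<sigma>. s n x) = 0" for n
  proof -
    have "(LINT x|\<sigma>. p (plane_rotation i j t x)) = (LINT x|\<sigma>. p x)" for t
      using integral_rotation[OF rotation_matrix_plane_rotation[OF ij] measurable_continuous[OF continuous_polynomial[OF p]], of t]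
      by (simp add: matrix_plane_rotation)
    thus ?thesis unfolding s_def
      by (simp add: Bochner_Integration.integral_diff integrable_continuous contp integrable_polynomial p)
  qed
  have "(\<lambda>n. LINT x|\<sigma>. s n x) \<longlonglongrightarrow> (LINT x|\<sigma>. angular i j p x)"
  proof (rule integral_dominated_convergence[where w = "\<lambda>_. B"])
    show "angular i j p \<in> borel_measurable \<sigma>"
      by (intro measurable_continuous continuous_polynomial real_polynomial_angular p)
    show "s n \<in> borel_measurable \<sigma>" for n
      unfolding s_def by (intro measurable_continuous continuous_intros contp continuous_polynomial p) auto
    show "integrable \<sigma> (\<lambda>_. B)" by simp
    show "AE x in \<sigma>. (\<lambda>n. s n x) \<longlonglongrightarrow> angular i j p x"
    proof (rule AE_I2)
      fix x
      have "((\<lambda>h. (p (plane_rotation i j (0 + h) x) - p (plane_rotation i j 0 x)) / h) \<longlongrightarrow> angular i j p (plane_rotation i j 0 x)) (at 0)"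
        using DERIV_plane_rotation[OF ij p, of x 0] by (simp add: DERIV_def)
      moreover have "filterlim (\<lambda>n. inverse (real (Suc n))) (at 0) sequentially"
        by (rule filterlim_atI[OF LIMSEQ_inverse_real_of_nat]) auto
      ultimately have "((\<lambda>n. (p (plane_rotation i j (0 + inverse (real (Suc n))) x) - p (plane_rotation i j 0 x)) / inverse (real (Suc n))) \<longlongrightarrow> angular i j p (plane_rotation i j 0 x)) sequentially"
        by (rule filterlim_compose)
      thus "(\<lambda>n. s n x) \<longlonglongrightarrow> angular i j p x" by (simp add: s_def plane_rotation_def)
    qed
    show "AE x in \<sigma>. norm (s n x) \<le> B" for n
    proof (rule AE_I2)
      fix x assume x: "x \<in> space \<sigma>"
      define t where "t = inverse (real (Suc n))"
      have t: "t > 0" by (simp add: t_def)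
      have "\<exists>z>0. z < t \<and> p (plane_rotation i j t x) - p (plane_rotation i j 0 x) = (t - 0) * angular i j p (plane_rotation i j z x)"
        by (rule MVT2[OF t]) (use DERIV_plane_rotation[OF ij p] in auto)
      then obtain z where z: "p (plane_rotation i j t x) - p x = t * angular i j p (plane_rotation i j z x)"
        by (auto simp: plane_rotation_def)
      have "s n x = angular i j p (plane_rotation i j z x)"
        unfolding s_def t_def[symmetric] z using t by simp
      thus "norm (s n x) \<le> B" using B[of "plane_rotation i j z x"] x norm_plane_rotation[OF ij] by simp
    qed
  qed
  hence "(\<lambda>n. 0) \<longlonglongrightarrow> (LINT x|\<sigma>. angular i j p x)" by (simp only: s0)
  thus ?thesis using LIMSEQ_unique tendsto_const by metis
qed

end

section \<open>Spherical harmonics of different degrees are orthogonal\<close>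

lemma angular_mult:
  assumes "real_polynomial_function p" "real_polynomial_function q"
  shows "angular i j (\<lambda>x. p x * q x) x = angular i j p x * q x + p x * angular i j q x"
  using assms by (simp add: angular_def partial_deriv_mult algebra_simps)

text \<open>
  The sum over all pairs is twice the spherical Laplacian. Expanding the squares leaves
  \<open>2 |x|\<^sup>2 \<Delta> p\<close> and radial derivatives of \<open>p\<close>, and Euler's identity turns the latter into
  multiples of \<open>p\<close>.
\<close>

lemma sum_angular_angular:
  fixes p :: "real^'n \<Rightarrow> real"
  assumes harm: "harmonic_homogeneous_polynomial l p"
  shows "(\<Sum>i\<in>UNIV. \<Sum>j\<in>UNIV. angular i j (angular i j p) x) =
           - (2 * real l * (real l + real CARD('n) - 2)) * p x"
proof -
  have p: "real_polynomial_function p" and hom: "\<And>c x. p (c *\<^sub>R x) = c ^ l * p x"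
    and lap: "(\<Sum>i\<in>UNIV. partial_deriv i (partial_deriv i p) x) = 0" for x
    using harm by (auto simp: harmonic_homogeneous_polynomial_def laplacian_partial_deriv)
  have pdp: "real_polynomial_function (partial_deriv i p)" for i using p by (rule real_polynomial_partial_deriv)
  have euler: "(\<Sum>i\<in>UNIV. x $ i * partial_deriv i p x) = real l * p x" for x
    by (rule euler_homogeneous[OF p hom])
  have euler': "(\<Sum>i\<in>UNIV. x $ i * partial_deriv j (partial_deriv i p) x) = (real l - 1) * partial_deriv j p x" for j
  proof -
    have "(\<lambda>x. \<Sum>i\<in>UNIV. x $ i * partial_deriv i p x) = (\<lambda>x. real l * p x)" using euler by auto
    hence "partial_deriv j (\<lambda>x. \<Sum>i\<in>UNIV. x $ i * partial_deriv i p x) x = real l * partial_deriv j p x"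
      by (simp add: partial_deriv_cmult p)
    moreover have "partial_deriv j (\<lambda>x. \<Sum>i\<in>UNIV. x $ i * partial_deriv i p x) x
        = (\<Sum>i\<in>UNIV. (if j = i then partial_deriv i p x else 0) + x $ i * partial_deriv j (partial_deriv i p) x)"
      by (subst partial_deriv_sum) (auto simp: partial_deriv_component_mult pdp intro!: real_polynomial_function.intros(4)
          real_polynomial_component)
    ultimately show ?thesis by (simp add: sum.distrib algebra_simps)
  qed
  define d where "d i j = (if i = j then 1 else 0 :: real)" for i j :: 'n
  have partial_deriv_ang: "partial_deriv k (angular i j p) x = d i k * partial_deriv j p x + x $ i * partial_deriv k (partial_deriv j p) x
      - (d j k * partial_deriv i p x + x $ j * partial_deriv k (partial_deriv i p) x)" for i j k
    unfolding angular_def d_def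
    by (subst partial_deriv_diff) (auto simp: partial_deriv_component_mult pdp intro!: real_polynomial_function.intros(4)
          real_polynomial_component)
  have "angular i j (angular i j p) x =
      d i j * (x $ i * partial_deriv j p x) + d i j * (x $ j * partial_deriv i p x)
      + (x $ i * x $ i) * partial_deriv j (partial_deriv j p) x + (x $ j * x $ j) * partial_deriv i (partial_deriv i p) x
      - x $ i * partial_deriv i p x - x $ j * partial_deriv j p x
      - x $ j * (x $ i * partial_deriv j (partial_deriv i p) x) - x $ i * (x $ j * partial_deriv i (partial_deriv j p) x)" for i j
    unfolding angular_def[of i j "angular i j p"] partial_deriv_ang by (auto simp: d_def algebra_simps)
  hence "(\<Sum>i\<in>UNIV. \<Sum>j\<in>UNIV. angular i j (angular i j p) x) =
      (\<Sum>i\<in>UNIV. \<Sum>j\<in>UNIV. d i j * (x $ i * partial_deriv j p x))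
      + (\<Sum>i\<in>UNIV. \<Sum>j\<in>UNIV. d i j * (x $ j * partial_deriv i p x))
      + (\<Sum>i\<in>UNIV. \<Sum>j\<in>UNIV. (x $ i * x $ i) * partial_deriv j (partial_deriv j p) x)
      + (\<Sum>i\<in>UNIV. \<Sum>j\<in>UNIV. (x $ j * x $ j) * partial_deriv i (partial_deriv i p) x)
      - (\<Sum>i\<in>UNIV. \<Sum>j\<in>(UNIV::'n set). x $ i * partial_deriv i p x)
      - (\<Sum>i\<in>(UNIV::'n set). \<Sum>j\<in>UNIV. x $ j * partial_deriv j p x)
      - (\<Sum>i\<in>UNIV. \<Sum>j\<in>UNIV. x $ j * (x $ i * partial_deriv j (partial_deriv i p) x))
      - (\<Sum>i\<in>UNIV. \<Sum>j\<in>UNIV. x $ i * (x $ j * partial_deriv i (partial_deriv j p) x))"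
    (is "_ = ?a1 + ?a2 + ?a3 + ?a4 - ?a5 - ?a6 - ?a7 - ?a8")
    by (simp add: sum.distrib sum_subtractf)
  moreover have "?a1 = real l * p x" "?a2 = real l * p x"
    by (simp_all add: d_def if_distrib[of "\<lambda>c. c * _"] euler cong: if_cong)
  moreover have "?a3 = 0" "?a4 = 0"
  proof -
    show a3: "?a3 = 0" unfolding sum_distrib_left[symmetric] lap by simp
    show "?a4 = 0" by (subst sum.swap) (rule a3)
  qed
  moreover have "?a5 = real CARD('n) * (real l * p x)" "?a6 = real CARD('n) * (real l * p x)"
    by (simp_all add: euler flip: sum_distrib_left)
  moreover have "?a7 = (real l - 1) * (real l * p x)" "?a8 = (real l - 1) * (real l * p x)"
  proof -
    show a8: "?a8 = (real l - 1) * (real l * p x)"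
      unfolding sum_distrib_left[symmetric] euler'
      by (simp add: mult.left_commute[of _ "real l - 1"] euler flip: sum_distrib_left)
    show "?a7 = (real l - 1) * (real l * p x)" by (subst sum.swap) (rule a8)
  qed
  ultimately show ?thesis by (simp only:) (simp add: algebra_simps)
qed

context sphere_measure
begin

lemma integral_angular_angular:
  assumes p: "real_polynomial_function p" and q: "real_polynomial_function q"
  shows "(LINT x|\<sigma>. p x * angular i j (angular i j q) x) = - (LINT x|\<sigma>. angular i j p x * angular i j q x)"
proof -
  have int: "integrable \<sigma> (\<lambda>x. f x * g x)" if "real_polynomial_function f" "real_polynomial_function g" for f g
    using that by (intro integrable_polynomial real_polynomial_function.intros(4))
  have "0 = (LINT x|\<sigma>. angular i j (\<lambda>x. p x * angular i j q x) x)"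
    by (rule integral_angular[symmetric])
       (intro real_polynomial_function.intros(4) p q real_polynomial_angular)
  also have "\<dots> = (LINT x|\<sigma>. angular i j p x * angular i j q x + p x * angular i j (angular i j q) x)"
    by (simp add: angular_mult p q real_polynomial_angular)
  also have "\<dots> = (LINT x|\<sigma>. angular i j p x * angular i j q x) + (LINT x|\<sigma>. p x * angular i j (angular i j q) x)"
    by (intro Bochner_Integration.integral_add int real_polynomial_angular p q)
  finally show ?thesis by simp
qed

text \<open>
  Integration by parts moves the spherical Laplacian from one factor to the other, and its
  eigenvalues on the two degrees differ.
\<close>

lemma orthogonal_harmonics:
  assumes p: "harmonic_homogeneous_polynomial m p" and q: "harmonic_homogeneous_polynomial l q"
    and "m \<noteq> l" and n: "CARD('n) \<ge> 2"
  shows "(LINT x|\<sigma>. p x * q x) = 0"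
proof -
  have rp: "real_polynomial_function p" "real_polynomial_function q"
    using p q by (auto simp: harmonic_homogeneous_polynomial_def)
  have eig: "- (2 * real l * (real l + real CARD('n) - 2)) * (LINT x|\<sigma>. p x * q x)
      = - (\<Sum>i\<in>UNIV. \<Sum>j\<in>UNIV. (LINT x|\<sigma>. angular i j p x * angular i j q x))"
    if p: "real_polynomial_function p" and q: "harmonic_homogeneous_polynomial l q" for l p q
  proof -
    have rq: "real_polynomial_function q" using q by (simp add: harmonic_homogeneous_polynomial_def)
    have "- (2 * real l * (real l + real CARD('n) - 2)) * (LINT x|\<sigma>. p x * q x)
       = (LINT x|\<sigma>. - (2 * real l * (real l + real CARD('n) - 2)) * (p x * q x))"
      by simp
    also have "\<dots> = (LINT x|\<sigma>. (\<Sum>i\<in>UNIV. \<Sum>j\<in>UNIV. p x * angular i j (angular i j q) x))"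
      by (rule Bochner_Integration.integral_cong refl)+
         (use sum_angular_angular[OF q] in \<open>simp add: mult.left_commute flip: sum_distrib_left\<close>)
    also have "\<dots> = (\<Sum>i\<in>UNIV. \<Sum>j\<in>UNIV. LINT x|\<sigma>. p x * angular i j (angular i j q) x)"
      by (subst Bochner_Integration.integral_sum,
          intro Bochner_Integration.integrable_sum integrable_polynomial
            real_polynomial_function.intros(4) p rq real_polynomial_angular,
          intro sum.cong refl Bochner_Integration.integral_sum integrable_polynomial
            real_polynomial_function.intros(4) p rq real_polynomial_angular)
    finally show ?thesis by (simp add: integral_angular_angular[OF p rq] sum_negf)
  qed
  have "- (2 * real l * (real l + real CARD('n) - 2)) * (LINT x|\<sigma>. p x * q x) =
        - (2 * real m * (real m + real CARD('n) - 2)) * (LINT x|\<sigma>. q x * p x)"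
    unfolding eig[OF rp(1) q] eig[OF rp(2) p] by (simp add: mult.commute)
  hence "(real l * (real l + real CARD('n) - 2) - real m * (real m + real CARD('n) - 2)) * (LINT x|\<sigma>. p x * q x) = 0"
    by (simp add: mult.commute[of "q _"] algebra_simps)
  moreover have "real l * (real l + real CARD('n) - 2) - real m * (real m + real CARD('n) - 2)
      = (real l - real m) * (real l + real m + (real CARD('n) - 2))" by (simp add: algebra_simps)
  moreover have "real l + real m + (real CARD('n) - 2) > 0" using n \<open>m \<noteq> l\<close> by linarith
  ultimately show ?thesis using \<open>m \<noteq> l\<close> by simp
qed

section \<open>The essential supremum of a continuous function\<close>

text \<open>
  All caps of the same radius have the same measure, and finitely many of them cover the sphere.
\<close>

lemma emeasure_cap_pos:
  assumes n: "CARD('n) \<ge> 2" and e: "e \<in> sphere 0 1" and r: "r > 0"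
  shows "emeasure \<sigma> (sphere 0 1 \<inter> ball e r) \<noteq> 0"
proof
  assume null: "emeasure \<sigma> (sphere 0 1 \<inter> ball e r) = 0"
  have meas: "sphere 0 1 \<inter> ball x r \<in> sets \<sigma>" for x
    unfolding sets_sphere by (auto simp: sets_restrict_space)
  have caps: "sphere 0 1 \<inter> ball x r \<in> null_sets \<sigma>" if x: "x \<in> sphere 0 1" for x
  proof -
    obtain f where f: "orthogonal_transformation f" "det (matrix f) = 1" "f e = x"
      using rotation_exists[OF n, of e x] e x by auto
    define Q where "Q = matrix f"
    have Q: "rotation_matrix Q" "Q *v e = x"
      using f by (simp_all add: Q_def rotation_matrix_def orthogonal_transformation_matrix matrix_works)
    have d: "dist (Q *v e) (Q *v y) = dist e y" for y
      using norm_rotation[OF Q(1), of "e - y"] by (simp add: dist_norm matrix_vector_mult_diff_distrib)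
    have "emeasure \<sigma> (sphere 0 1 \<inter> ball x r) = emeasure (distr \<sigma> \<sigma> ((*v) Q)) (sphere 0 1 \<inter> ball x r)"
      by (simp add: distr_rotation[OF Q(1)])
    also have "\<dots> = emeasure \<sigma> ((*v) Q -` (sphere 0 1 \<inter> ball x r) \<inter> space \<sigma>)"
      by (rule emeasure_distr[OF measurable_rotation[OF Q(1)] meas])
    also have "(*v) Q -` (sphere 0 1 \<inter> ball x r) \<inter> space \<sigma> = sphere 0 1 \<inter> ball e r"
      using norm_rotation[OF Q(1)] d unfolding Q(2)[symmetric] by auto
    finally show ?thesis using null meas by (simp add: null_sets_def)
  qed
  have "sphere 0 1 \<subseteq> (\<Union>x\<in>sphere (0::real^'n) 1. ball x r)" using r by auto
  then obtain C where C: "C \<subseteq> sphere (0::real^'n) 1" "finite C" "sphere 0 1 \<subseteq> (\<Union>x\<in>C. ball x r)"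
    using compactE_image[OF compact_sphere, of "sphere 0 1" "\<lambda>x. ball x r"] by (metis open_ball)
  have "(\<Union>x\<in>C. sphere 0 1 \<inter> ball x r) \<in> null_sets \<sigma>"
    using C caps by (intro null_sets.finite_UN) auto
  moreover have "(\<Union>x\<in>C. sphere 0 1 \<inter> ball x r) = sphere 0 1" using C by auto
  ultimately show False using emeasure_sphere by (simp add: null_sets_def)
qed

lemma Linf_norm_ge_value:
  assumes n: "CARD('n) \<ge> 2" and g: "continuous_on (sphere 0 1) g" and e: "e \<in> sphere 0 1"
  shows "ereal \<bar>g e\<bar> \<le> Linf_norm \<sigma> g"
proof (rule ccontr)
  assume "\<not> ereal \<bar>g e\<bar> \<le> Linf_norm \<sigma> g"
  hence "Linf_norm \<sigma> g < ereal \<bar>g e\<bar>" by simp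
  then obtain c where c: "Linf_norm \<sigma> g < ereal c" "c < \<bar>g e\<bar>"
    by (metis ereal_dense2 less_ereal.simps(1))
  have "continuous_on (sphere 0 1) (\<lambda>x. \<bar>g x\<bar>)" using g by (intro continuous_intros)
  then obtain r where r: "r > 0" "\<And>x. x \<in> sphere 0 1 \<Longrightarrow> dist x e < r \<Longrightarrow> dist \<bar>g x\<bar> \<bar>g e\<bar> < \<bar>g e\<bar> - c"
    using e c(2) unfolding continuous_on_iff by (metis diff_gt_0_iff_gt)
  have "AE x in \<sigma>. ereal \<bar>g x\<bar> \<le> Linf_norm \<sigma> g" unfolding Linf_norm_def by (rule esssup_AE)
  hence "AE x in \<sigma>. x \<notin> sphere 0 1 \<inter> ball e r"
  proof eventually_elim
    case (elim x)
    show ?case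
    proof
      assume "x \<in> sphere 0 1 \<inter> ball e r"
      hence "dist \<bar>g x\<bar> \<bar>g e\<bar> < \<bar>g e\<bar> - c" using r(2)[of x] by (simp add: dist_commute)
      hence "\<bar>g x\<bar> > c" unfolding dist_real_def by linarith
      moreover have "ereal \<bar>g x\<bar> < ereal c" using elim c(1) by (rule le_less_trans)
      ultimately show False by simp
    qed
  qed
  moreover have "sphere 0 1 \<inter> ball e r \<in> sets \<sigma>"
    unfolding sets_sphere by (auto simp: sets_restrict_space)
  ultimately have "emeasure \<sigma> (sphere 0 1 \<inter> ball e r) = 0"
    by (metis AE_iff_null_sets null_setsD1)
  thus False using emeasure_cap_pos[OF n e r(1)] by simp
qed

end

section \<open>The filtered operator on zonal polynomials\<close>

context sphere_measure
begin

lemma continuous_spherical_harmonic: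
  assumes "f \<in> spherical_harmonics l"
  shows "continuous_on (sphere 0 1) f"
proof -
  obtain p where p: "harmonic_homogeneous_polynomial l p" "f = (\<lambda>x. if x \<in> sphere 0 1 then p x else 0)"
    using assms by (auto simp: spherical_harmonics_def)
  have "continuous_on (sphere 0 1) p"
    using p(1) by (intro continuous_polynomial) (simp add: harmonic_homogeneous_polynomial_def)
  thus ?thesis unfolding p(2) by (subst continuous_on_cong[OF refl, of _ _ p]) auto
qed

lemma basis_in_spherical_harmonics:
  assumes "orthonormal_harmonic_basis \<sigma> l Y" "k \<in> {1..harm_dim TYPE('n) l}"
  shows "Y k \<in> spherical_harmonics l"
  using assms unfolding orthonormal_harmonic_basis_def by (metis fun_space.span_base imageI)

text \<open>
  Both sides are linear in \<open>f\<close> and agree on the basis functions by orthonormality, so the identity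
  follows by induction over the span. The integrability needed for linearity is carried along.
\<close>

lemma harmonic_expansion:
  assumes Y: "orthonormal_harmonic_basis \<sigma> l Y" and f: "f \<in> spherical_harmonics l"
  shows "(\<Sum>k = 1..harm_dim TYPE('n) l. L2_inner \<sigma> f (Y k) * Y k x) = f x"
proof -
  define K where "K = {1..harm_dim TYPE('n) l}"
  have fin: "finite K" by (simp add: K_def)
  have contY: "continuous_on (sphere 0 1) (Y k)" if "k \<in> K" for k
    using basis_in_spherical_harmonics[OF Y] that continuous_spherical_harmonic by (auto simp: K_def)
  have int: "integrable \<sigma> (\<lambda>x. Y j x * Y k x)" if "j \<in> K" "k \<in> K" for j k
    using that by (intro integrable_continuous continuous_on_mult contY)
  have orth: "L2_inner \<sigma> (Y j) (Y k) = (if j = k then 1 else 0)" if "j \<in> K" "k \<in> K" for j k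
    using Y that by (auto simp: orthonormal_harmonic_basis_def K_def)
  have "f \<in> fun_space.span (Y ` K)"
    using Y f by (simp add: orthonormal_harmonic_basis_def K_def)
  hence "(\<forall>k\<in>K. integrable \<sigma> (\<lambda>x. f x * Y k x)) \<and> f = (\<lambda>x. \<Sum>k\<in>K. L2_inner \<sigma> f (Y k) * Y k x)"
  proof (induction rule: fun_space.span_induct_alt)
    case base
    show ?case by (simp add: L2_inner_def fun_eq_iff)
  next
    case (step c g f)
    then obtain j where j: "j \<in> K" "g = Y j" by auto
    have IH: "\<forall>k\<in>K. integrable \<sigma> (\<lambda>x. f x * Y k x)"
      and f: "(\<Sum>k\<in>K. L2_inner \<sigma> f (Y k) * Y k x) = f x" for x
      using step.IH by (blast, metis)
    have I: "integrable \<sigma> (\<lambda>x. (c * Y j x + f x) * Y k x)" if "k \<in> K" for k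
      using int[OF j(1) that] IH that by (simp add: distrib_right mult.assoc)
    have L2: "L2_inner \<sigma> (\<lambda>x. c * Y j x + f x) (Y k) = c * (if j = k then 1 else 0) + L2_inner \<sigma> f (Y k)"
      if "k \<in> K" for k
      using int[OF j(1) that] IH that orth[OF j(1) that]
      by (simp add: L2_inner_def distrib_right mult.assoc)
    have "(\<Sum>k\<in>K. L2_inner \<sigma> (\<lambda>x. c * Y j x + f x) (Y k) * Y k x) = c * Y j x + f x" for x
    proof -
      have "(\<Sum>k\<in>K. L2_inner \<sigma> (\<lambda>x. c * Y j x + f x) (Y k) * Y k x)
          = (\<Sum>k\<in>K. (if j = k then c * Y k x else 0) + L2_inner \<sigma> f (Y k) * Y k x)"
        by (intro sum.cong refl) (simp add: L2 distrib_right)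
      also have "\<dots> = c * Y j x + f x"
        using fin j(1) by (simp add: sum.distrib f)
      finally show ?thesis .
    qed
    thus ?case using I by (simp add: j plus_fun_def fun_eq_iff)
  qed
  thus ?thesis by (simp add: K_def fun_eq_iff)
qed

text \<open>
  The operator acts diagonally on zonal polynomials, by orthogonality of different degrees.
\<close>

lemma filtered_operator_zonal:
  fixes Y :: "nat \<Rightarrow> nat \<Rightarrow> real^'n \<Rightarrow> real"
  assumes Y: "\<And>l. orthonormal_harmonic_basis \<sigma> l (Y l)"
    and \<mu>: "real CARD('n) = 2 * \<mu> + 2" "\<mu> \<ge> 0" and x: "x \<in> sphere 0 1"
  shows "filtered_operator \<sigma> Y h L (\<lambda>x. \<Sum>m\<le>M. c m * zonal \<mu> i m x) x
       = (\<Sum>m\<le>M. c m * h (real m / real L) * zonal \<mu> i m x)"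
proof -
  have n: "CARD('n) \<ge> 2" using \<mu> by linarith
  define Z where "Z m x = (if x \<in> sphere 0 1 then zonal \<mu> i m x else 0)" for m and x :: "real^'n"
  have Z: "Z m \<in> spherical_harmonics m" for m
    unfolding Z_def[abs_def] spherical_harmonics_def using harmonic_zonal[OF \<mu>, of m i] by blast
  have L2Z: "L2_inner \<sigma> (Z m) (Y l k) = (LINT x|\<sigma>. zonal \<mu> i m x * Y l k x)" for m l k
    unfolding L2_inner_def by (rule Bochner_Integration.integral_cong) (auto simp: Z_def)
  have inner: "L2_inner \<sigma> (\<lambda>x. \<Sum>m\<le>M. c m * zonal \<mu> i m x) (Y l k)
      = (if l \<le> M then c l * L2_inner \<sigma> (Z l) (Y l k) else 0)"
    if k: "k \<in> {1..harm_dim TYPE('n) l}" for l k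
  proof -
    have Yl: "Y l k \<in> spherical_harmonics l" by (rule basis_in_spherical_harmonics[OF Y k])
    then obtain q where q: "harmonic_homogeneous_polynomial l q" "Y l k = (\<lambda>x. if x \<in> sphere 0 1 then q x else 0)"
      by (auto simp: spherical_harmonics_def)
    have int: "integrable \<sigma> (\<lambda>x. zonal \<mu> i m x * Y l k x)" for m
      by (intro integrable_continuous continuous_on_mult continuous_spherical_harmonic[OF Yl]
          continuous_polynomial real_polynomial_zonal)
    have orth: "(LINT x|\<sigma>. zonal \<mu> i m x * Y l k x) = 0" if "m \<noteq> l" for m
    proof -
      have "(LINT x|\<sigma>. zonal \<mu> i m x * Y l k x) = (LINT x|\<sigma>. zonal \<mu> i m x * q x)"
        by (rule Bochner_Integration.integral_cong) (auto simp: q)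
      also have "\<dots> = 0" by (rule orthogonal_harmonics[OF harmonic_zonal[OF \<mu>] q(1) that n])
      finally show ?thesis .
    qed
    have "L2_inner \<sigma> (\<lambda>x. \<Sum>m\<le>M. c m * zonal \<mu> i m x) (Y l k)
        = (\<Sum>m\<le>M. c m * (LINT x|\<sigma>. zonal \<mu> i m x * Y l k x))"
      using int by (simp add: L2_inner_def sum_distrib_right mult.assoc)
    also have "\<dots> = (\<Sum>m\<le>M. if m = l then c l * L2_inner \<sigma> (Z l) (Y l k) else 0)"
      by (intro sum.cong refl) (auto simp: orth L2Z)
    finally show ?thesis by simp
  qed
  have degree_part: "(\<Sum>k = 1..harm_dim TYPE('n) l. h (real l / real L) *
          L2_inner \<sigma> (\<lambda>x. \<Sum>m\<le>M. c m * zonal \<mu> i m x) (Y l k) * Y l k x)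
      = (if l \<in> {..M} then c l * h (real l / real L) * zonal \<mu> i l x else 0)" for l
  proof -
    have "(\<Sum>k = 1..harm_dim TYPE('n) l. h (real l / real L) *
          L2_inner \<sigma> (\<lambda>x. \<Sum>m\<le>M. c m * zonal \<mu> i m x) (Y l k) * Y l k x)
        = (\<Sum>k = 1..harm_dim TYPE('n) l. (if l \<le> M then c l * h (real l / real L) else 0) *
             (L2_inner \<sigma> (Z l) (Y l k) * Y l k x))"
      by (intro sum.cong refl) (simp add: inner)
    also have "\<dots> = (if l \<le> M then c l * h (real l / real L) else 0) * Z l x"
      unfolding sum_distrib_left[symmetric] harmonic_expansion[OF Y Z] ..
    finally show ?thesis using x by (simp add: Z_def)
  qed
  show ?thesis unfolding filtered_operator_def degree_part
    using sums_If_finite_set[of "{..M}" "\<lambda>l. c l * h (real l / real L) * zonal \<mu> i l x"]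
    by (simp add: sums_iff)
qed

text \<open>
  Evaluate the image of a zonal polynomial at its pole, where each normalised Gegenbauer polynomial
  is \<open>1\<close>.
\<close>

lemma filtered_operator_norm_ge:
  fixes Y :: "nat \<Rightarrow> nat \<Rightarrow> real^'n \<Rightarrow> real"
  assumes Y: "\<And>l. orthonormal_harmonic_basis \<sigma> l (Y l)"
    and \<mu>: "real CARD('n) = 2 * \<mu> + 2" "\<mu> \<ge> 0"
    and le1: "\<And>t. \<bar>t\<bar> \<le> 1 \<Longrightarrow> \<bar>\<Sum>m\<le>M. c m * gegenbauer \<mu> m t 1\<bar> \<le> 1"
  shows "ereal \<bar>\<Sum>m\<le>M. c m * h (real m / real L)\<bar> \<le> filtered_operator_norm \<sigma> Y h L"
proof -
  have n: "CARD('n) \<ge> 2" using \<mu> by linarith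
  obtain i :: 'n where True by simp
  define f where "f = (\<lambda>x. \<Sum>m\<le>M. c m * zonal \<mu> i m x)"
  define g where "g = filtered_operator \<sigma> Y h L f"
  have geq: "g x = (\<Sum>m\<le>M. c m * h (real m / real L) * zonal \<mu> i m x)" if "x \<in> sphere 0 1" for x
    unfolding g_def f_def by (rule filtered_operator_zonal[OF Y \<mu> that])
  have "continuous_on (sphere 0 1) (\<lambda>x. \<Sum>m\<le>M. c m * h (real m / real L) * zonal \<mu> i m x)"
    by (intro continuous_intros continuous_polynomial real_polynomial_zonal)
  hence contg: "continuous_on (sphere 0 1) g"
    by (subst continuous_on_cong[OF refl geq])
  have contf: "continuous_on (sphere 0 1) f"
    unfolding f_def by (intro continuous_intros continuous_polynomial real_polynomial_zonal)
  have "\<bar>f x\<bar> \<le> 1" if "x \<in> sphere 0 1" for x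
  proof -
    have "norm x = 1" using that by simp
    hence "\<bar>x $ i\<bar> \<le> 1" "x \<bullet> x = 1"
      using component_le_norm_cart[of x i] by (simp, simp add: norm_eq_1)
    thus ?thesis using le1 by (simp add: f_def zonal_def)
  qed
  hence "Linf_norm \<sigma> f \<le> 1" unfolding Linf_norm_def
    using measurable_continuous[OF contf] by (intro esssup_I) (auto intro!: AE_I2)
  moreover from this have "f \<in> Linf \<sigma>" using measurable_continuous[OF contf]
    by (auto simp: Linf_def)
  ultimately have "Linf_norm \<sigma> g \<le> filtered_operator_norm \<sigma> Y h L"
    unfolding filtered_operator_norm_def g_def by (intro SUP_upper) simp
  moreover have "axis i 1 \<in> sphere (0::real^'n) 1" by simp
  from Linf_norm_ge_value[OF n contg this] have "ereal \<bar>g (axis i 1)\<bar> \<le> Linf_norm \<sigma> g" .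
  moreover have "g (axis i 1) = (\<Sum>m\<le>M. c m * h (real m / real L))"
    by (subst geq) (simp_all add: zonal_def inner_axis_axis gegenbauer_one[OF \<mu>(2)])
  ultimately show ?thesis by (metis order_trans)
qed

end

section \<open>Changing the parameter of Gegenbauer polynomials\<close>

text \<open>
  The operator \<open>lower\<close> takes the sequence of Gegenbauer polynomials of parameter \<open>\<mu> + 1\<close> to the one
  of parameter \<open>\<mu>\<close>. Applied to a multiplier, it gives the multiplier by which zonal functions are
  acted upon when the dimension is reduced by two. The truncated \<open>n - 2\<close> is harmless since the
  coefficient vanishes for \<open>n < 2\<close>.
\<close>

definition lower_coeff :: "real \<Rightarrow> nat \<Rightarrow> real" where
  "lower_coeff \<mu> n = real n * (real n - 1) / (2 * (2 * \<mu> + 1) * (real n + \<mu>))"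

definition lower :: "real \<Rightarrow> (nat \<Rightarrow> real) \<Rightarrow> nat \<Rightarrow> real" where
  "lower \<mu> g n = (1 + lower_coeff \<mu> n) * g n - lower_coeff \<mu> n * g (n - 2)"

lemma one_plus_lower_coeff:
  assumes "\<mu> \<ge> 0" "n \<ge> 1"
  shows "1 + lower_coeff \<mu> n = (real n + 2 * \<mu> + 1) * (real n + 2 * \<mu>) / (2 * (2 * \<mu> + 1) * (real n + \<mu>))"
proof -
  have "2 * \<mu> + 1 > 0" "real n + \<mu> > 0" using assms by auto
  hence "2 * (2 * \<mu> + 1) * (real n + \<mu>) \<noteq> 0" by simp
  thus ?thesis unfolding lower_coeff_def by (simp add: add_divide_eq_iff) (simp add: algebra_simps)
qed

lemma gegenbauer_mult:
  assumes "\<mu> \<ge> 0"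
  shows "t * gegenbauer (\<mu> + 1) (Suc n) t 1 =
     ((real n + 3 + 2 * \<mu>) * gegenbauer (\<mu> + 1) (Suc (Suc n)) t 1 + (real n + 1) * gegenbauer (\<mu> + 1) n t 1)
       / (2 * (real n + 2 + \<mu>))"
proof -
  have "real n + 3 + 2 * \<mu> > 0" "real n + 2 + \<mu> > 0" using assms by auto
  hence "(real n + 3 + 2 * \<mu>) * gegenbauer (\<mu> + 1) (Suc (Suc n)) t 1 =
      2 * (real n + 2 + \<mu>) * (t * gegenbauer (\<mu> + 1) (Suc n) t 1) - (real n + 1) * gegenbauer (\<mu> + 1) n t 1"
    by (simp add: add_ac mult.assoc)
  thus ?thesis using \<open>real n + 2 + \<mu> > 0\<close> by (simp add: eq_divide_eq mult_ac)
qed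

text \<open>
  The right-hand side satisfies the three-term recurrence of parameter \<open>\<mu>\<close>: multiplication by \<open>t\<close>
  is expressed through the recurrence of parameter \<open>\<mu> + 1\<close>, and the coefficients of the terms of
  degree \<open>n + 2\<close>, \<open>n\<close> and \<open>n - 2\<close> are compared.
\<close>

lemma gegenbauer_lower:
  assumes \<mu>: "\<mu> \<ge> 0"
  shows "gegenbauer \<mu> n t 1 = lower \<mu> (\<lambda>l. gegenbauer (\<mu> + 1) l t 1) n"
proof (induction n rule: induct_nat_012)
  case 0
  show ?case by (simp add: lower_def lower_coeff_def)
next
  case 1
  show ?case by (simp add: lower_def lower_coeff_def)
next
  case (ge2 n)
  let ?S = "\<lambda>n. gegenbauer (\<mu> + 1) n t 1"
  define N where "N = real n"
  have N: "N \<ge> 0" by (simp add: N_def)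
  have pos: "2 * \<mu> + 1 > 0" "N + 1 + \<mu> > 0" "N + 2 + \<mu> > 0" "N + 1 + 2 * \<mu> > 0" using \<mu> N by auto
  have low: "lower \<mu> ?S (Suc (Suc n)) = (N + 3 + 2 * \<mu>) * (N + 2 + 2 * \<mu>) / (2 * (2 * \<mu> + 1) * (N + 2 + \<mu>)) * ?S (Suc (Suc n))
       - (N + 2) * (N + 1) / (2 * (2 * \<mu> + 1) * (N + 2 + \<mu>)) * ?S n"
    unfolding lower_def one_plus_lower_coeff[OF \<mu>, of "Suc (Suc n)", simplified]
    by (simp add: lower_coeff_def N_def add_ac)
  have up: "t * ?S (Suc n) = ((N + 3 + 2 * \<mu>) * ?S (Suc (Suc n)) + (N + 1) * ?S n) / (2 * (N + 2 + \<mu>))"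
    using gegenbauer_mult[OF \<mu>, of t n] by (simp only: N_def)
  show ?case
  proof (cases n)
    case 0
    thus ?thesis using \<mu> ge2 by (simp add: lower_def lower_coeff_def divide_simps) (simp add: algebra_simps)?
  next
    case (Suc m)
    have pos': "N + \<mu> > 0" using Suc \<mu> by (simp add: N_def)
    have t1: "t * ?S (n - 1) = ((N + 1 + 2 * \<mu>) * ?S n + (N - 1) * ?S (n - 2)) / (2 * (N + \<mu>))"
    proof (cases m)
      case 0
      have "2 + \<mu> * 2 \<noteq> 0" using \<mu> by simp
      thus ?thesis using 0 Suc \<mu> by (simp add: N_def divide_simps)
    next
      case (Suc k)
      thus ?thesis using gegenbauer_mult[OF \<mu>, of t k] \<open>n = Suc m\<close> by (simp add: N_def add_ac)
    qed
    have low1: "lower \<mu> ?S (Suc n) = (N + 2 + 2 * \<mu>) * (N + 1 + 2 * \<mu>) / (2 * (2 * \<mu> + 1) * (N + 1 + \<mu>)) * ?S (Suc n)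
       - (N + 1) * N / (2 * (2 * \<mu> + 1) * (N + 1 + \<mu>)) * ?S (n - 1)"
      unfolding lower_def one_plus_lower_coeff[OF \<mu>, of "Suc n", simplified]
      using Suc by (simp add: lower_coeff_def N_def add_ac)
    have low0: "lower \<mu> ?S n = (N + 1 + 2 * \<mu>) * (N + 2 * \<mu>) / (2 * (2 * \<mu> + 1) * (N + \<mu>)) * ?S n
       - N * (N - 1) / (2 * (2 * \<mu> + 1) * (N + \<mu>)) * ?S (n - 2)"
      unfolding lower_def using one_plus_lower_coeff[OF \<mu>, of n] Suc
      by (simp add: lower_coeff_def N_def add_ac)
    define a b c where "a = ?S (Suc (Suc n))" and "b = ?S n" and "c = ?S (n - 2)"
    have "t * lower \<mu> ?S (Suc n) = (N + 2 + 2 * \<mu>) * (N + 1 + 2 * \<mu>) / (2 * (2 * \<mu> + 1) * (N + 1 + \<mu>))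
             * (((N + 3 + 2 * \<mu>) * a + (N + 1) * b) / (2 * (N + 2 + \<mu>)))
       - (N + 1) * N / (2 * (2 * \<mu> + 1) * (N + 1 + \<mu>)) * (((N + 1 + 2 * \<mu>) * b + (N - 1) * c) / (2 * (N + \<mu>)))"
      unfolding low1 right_diff_distrib mult.left_commute[of t] up t1 a_def b_def c_def ..
    moreover have "gegenbauer \<mu> (Suc (Suc n)) t 1 =
        (2 * (N + 1 + \<mu>) * (t * lower \<mu> ?S (Suc n)) - (N + 1) * lower \<mu> ?S n) / (N + 1 + 2 * \<mu>)"
      using ge2 by (simp add: N_def)
    ultimately have "gegenbauer \<mu> (Suc (Suc n)) t 1 =
       (2 * (N + 1 + \<mu>) * ((N + 2 + 2 * \<mu>) * (N + 1 + 2 * \<mu>) / (2 * (2 * \<mu> + 1) * (N + 1 + \<mu>))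
             * (((N + 3 + 2 * \<mu>) * a + (N + 1) * b) / (2 * (N + 2 + \<mu>)))
       - (N + 1) * N / (2 * (2 * \<mu> + 1) * (N + 1 + \<mu>)) * (((N + 1 + 2 * \<mu>) * b + (N - 1) * c) / (2 * (N + \<mu>))))
       - (N + 1) * ((N + 1 + 2 * \<mu>) * (N + 2 * \<mu>) / (2 * (2 * \<mu> + 1) * (N + \<mu>)) * b
       - N * (N - 1) / (2 * (2 * \<mu> + 1) * (N + \<mu>)) * c)) / (N + 1 + 2 * \<mu>)"
      unfolding low0 a_def b_def c_def by simp
    also have "\<dots> = (N + 3 + 2 * \<mu>) * (N + 2 + 2 * \<mu>) / (2 * (2 * \<mu> + 1) * (N + 2 + \<mu>)) * a
       - (N + 2) * (N + 1) / (2 * (2 * \<mu> + 1) * (N + 2 + \<mu>)) * b"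
    proof -
      define u v w z y where "u = 2 * \<mu> + 1" and "v = N + 1 + \<mu>" and "w = N + 2 + \<mu>" and "z = N + \<mu>"
        and "y = N + 1 + 2 * \<mu>"
      have nz: "u \<noteq> 0" "v \<noteq> 0" "w \<noteq> 0" "z \<noteq> 0" "y \<noteq> 0"
        using pos pos' by (auto simp: u_def v_def w_def z_def y_def)
      have "(2 * v * ((N + 2 + 2 * \<mu>) * y / (2 * u * v) * (((N + 3 + 2 * \<mu>) * a + (N + 1) * b) / (2 * w))
         - (N + 1) * N / (2 * u * v) * ((y * b + (N - 1) * c) / (2 * z)))
         - (N + 1) * (y * (N + 2 * \<mu>) / (2 * u * z) * b - N * (N - 1) / (2 * u * z) * c)) / y
        = (N + 3 + 2 * \<mu>) * (N + 2 + 2 * \<mu>) / (2 * u * w) * a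
          + (N + 1) / (2 * u) * b * ((N + 2 + 2 * \<mu>) / w - N / z - (N + 2 * \<mu>) / z)"
        using nz by (simp add: divide_simps) (simp add: algebra_simps)
      also have "(N + 2 + 2 * \<mu>) / w - N / z - (N + 2 * \<mu>) / z = - ((N + 2) / w)"
        using nz unfolding z_def w_def by (simp add: divide_simps) (simp add: algebra_simps)
      also have "(N + 3 + 2 * \<mu>) * (N + 2 + 2 * \<mu>) / (2 * u * w) * a + (N + 1) / (2 * u) * b * (- ((N + 2) / w))
        = (N + 3 + 2 * \<mu>) * (N + 2 + 2 * \<mu>) / (2 * u * w) * a - (N + 2) * (N + 1) / (2 * u * w) * b"
        by (simp add: mult_ac)
      finally show ?thesis unfolding u_def v_def w_def z_def y_def .
    qed
    finally show ?thesis unfolding low a_def b_def .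
  qed
qed

lemma gegenbauer_zero_cos: "gegenbauer 0 n (cos \<theta>) 1 = cos (real n * \<theta>)"
proof (induction n rule: induct_nat_012)
  case (ge2 n)
  have "cos (real (Suc (Suc n)) * \<theta>) + cos (real n * \<theta>) = 2 * cos \<theta> * cos (real (Suc n) * \<theta>)"
    using cos_add[of "real (Suc n) * \<theta>" \<theta>] cos_diff[of "real (Suc n) * \<theta>" \<theta>]
    by (simp add: algebra_simps)
  moreover have "gegenbauer 0 (Suc (Suc n)) (cos \<theta>) 1
      = (real n + 1) * (2 * cos \<theta> * cos (real (Suc n) * \<theta>) - cos (real n * \<theta>)) / (real n + 1)"
    by (simp only: gegenbauer.simps ge2) (simp add: right_diff_distrib mult.assoc)
  ultimately show ?case by simp
qed auto

section \<open>Lowering the dimension of the sphere\<close>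

fun iterated_lower :: "real \<Rightarrow> nat \<Rightarrow> (nat \<Rightarrow> real) \<Rightarrow> nat \<Rightarrow> real" where
  "iterated_lower \<mu> 0 g = g"
| "iterated_lower \<mu> (Suc r) g = iterated_lower \<mu> r (lower (\<mu> + real r) g)"

lemma iterated_lower_gegenbauer:
  assumes "\<mu> \<ge> 0"
  shows "iterated_lower \<mu> r (\<lambda>l. gegenbauer (\<mu> + real r) l t 1) = (\<lambda>n. gegenbauer \<mu> n t 1)"
proof (induction r)
  case (Suc r)
  have "lower (\<mu> + real r) (\<lambda>l. gegenbauer (\<mu> + real (Suc r)) l t 1) = (\<lambda>l. gegenbauer (\<mu> + real r) l t 1)"
    using gegenbauer_lower[of "\<mu> + real r" _ t] assms by (simp add: fun_eq_iff add_ac)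
  thus ?case using Suc by simp
qed simp

text \<open>
  Such a functional is at the same time a test function, when applied to a sequence of
  polynomials, and the value of its image at the pole, when applied to a multiplier. The bound \<open>n\<close>
  limits the degrees that occur.
\<close>

definition finite_functional :: "nat \<Rightarrow> ((nat \<Rightarrow> real) \<Rightarrow> real) \<Rightarrow> bool" where
  "finite_functional n F \<longleftrightarrow> (\<exists>\<kappa>. \<forall>g. F g = (\<Sum>l\<le>n. \<kappa> l * g l))"

lemma finite_functional_eval: "m \<le> n \<Longrightarrow> finite_functional n (\<lambda>g. g m)"
  unfolding finite_functional_def
  by (rule exI[of _ "\<lambda>l. if l = m then 1 else 0"]) (simp add: if_distrib[of "\<lambda>c. c * _"] cong: if_cong)

lemma finite_functional_cmult: "finite_functional n F \<Longrightarrow> finite_functional n (\<lambda>g. c * F g)"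
  unfolding finite_functional_def
proof (elim exE)
  fix \<kappa> assume "\<forall>g. F g = (\<Sum>l\<le>n. \<kappa> l * g l)"
  thus "\<exists>\<kappa>. \<forall>g. c * F g = (\<Sum>l\<le>n. \<kappa> l * g l)"
    by (intro exI[of _ "\<lambda>l. c * \<kappa> l"]) (simp add: sum_distrib_left mult.assoc)
qed

lemma finite_functional_diff:
  "finite_functional n F \<Longrightarrow> finite_functional n G \<Longrightarrow> finite_functional n (\<lambda>g. F g - G g)"
  unfolding finite_functional_def
proof (elim exE)
  fix \<kappa> \<rho> assume "\<forall>g. F g = (\<Sum>l\<le>n. \<kappa> l * g l)" "\<forall>g. G g = (\<Sum>l\<le>n. \<rho> l * g l)"
  thus "\<exists>\<kappa>. \<forall>g. F g - G g = (\<Sum>l\<le>n. \<kappa> l * g l)"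
    by (intro exI[of _ "\<lambda>l. \<kappa> l - \<rho> l"]) (simp add: left_diff_distrib sum_subtractf)
qed

lemma finite_functional_sum:
  assumes "\<And>i. i \<in> I \<Longrightarrow> finite_functional n (F i)"
  shows "finite_functional n (\<lambda>g. \<Sum>i\<in>I. F i g)"
proof -
  obtain \<kappa> where \<kappa>: "\<And>i g. i \<in> I \<Longrightarrow> F i g = (\<Sum>l\<le>n. \<kappa> i l * g l)"
    using assms unfolding finite_functional_def by metis
  have "(\<Sum>i\<in>I. F i g) = (\<Sum>l\<le>n. (\<Sum>i\<in>I. \<kappa> i l) * g l)" for g
  proof -
    have "(\<Sum>i\<in>I. F i g) = (\<Sum>i\<in>I. \<Sum>l\<le>n. \<kappa> i l * g l)" by (intro sum.cong refl \<kappa>)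
    also have "\<dots> = (\<Sum>l\<le>n. \<Sum>i\<in>I. \<kappa> i l * g l)" by (rule sum.swap)
    finally show ?thesis by (simp add: sum_distrib_right)
  qed
  thus ?thesis unfolding finite_functional_def by (intro exI[of _ "\<lambda>l. \<Sum>i\<in>I. \<kappa> i l"] allI)
qed

lemma finite_functional_compose:
  assumes F: "finite_functional n F" and G: "\<And>m. m \<le> n \<Longrightarrow> finite_functional n (\<lambda>g. G g m)"
  shows "finite_functional n (\<lambda>g. F (G g))"
proof -
  obtain \<kappa> where \<kappa>: "F = (\<lambda>g. \<Sum>l\<le>n. \<kappa> l * g l)" using F unfolding finite_functional_def by blast
  show ?thesis unfolding \<kappa> by (intro finite_functional_sum finite_functional_cmult G) auto
qed

lemma finite_functional_iterated_lower:
  "m \<le> n \<Longrightarrow> finite_functional n (\<lambda>g. iterated_lower \<mu> r g m)"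
proof (induction r arbitrary: m)
  case (Suc r)
  have "finite_functional n (\<lambda>g. lower (\<mu> + real r) g m)" if "m \<le> n" for m
    unfolding lower_def using that
    by (intro finite_functional_diff finite_functional_cmult finite_functional_eval) auto
  moreover have "finite_functional n (\<lambda>g. iterated_lower \<mu> r g m)" by (rule Suc.IH[OF Suc.prems])
  ultimately have "finite_functional n (\<lambda>g. iterated_lower \<mu> r (lower (\<mu> + real r) g) m)"
    using finite_functional_compose[of n "\<lambda>g. iterated_lower \<mu> r g m" "lower (\<mu> + real r)"] by blast
  thus ?case by simp
qed (simp add: finite_functional_eval)

context sphere_measure
begin

text \<open>
  The duality between test functions and multipliers: a test function given in terms of
  Gegenbauer polynomials of parameter \<open>\<mu>\<close> sees the multiplier lowered \<open>r\<close> times.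
\<close>

lemma filtered_operator_norm_ge_functional:
  fixes Y :: "nat \<Rightarrow> nat \<Rightarrow> real^'n \<Rightarrow> real"
  assumes Y: "\<And>l. orthonormal_harmonic_basis \<sigma> l (Y l)"
    and \<mu>: "real CARD('n) = 2 * (\<mu> + real r) + 2" "\<mu> \<ge> 0"
    and F: "finite_functional M F" and B: "B > 0"
    and le: "\<And>t. \<bar>t\<bar> \<le> 1 \<Longrightarrow> \<bar>F (\<lambda>n. gegenbauer \<mu> n t 1)\<bar> \<le> B"
  shows "ereal (\<bar>F (iterated_lower \<mu> r (\<lambda>l. h (real l / real L)))\<bar> / B) \<le> filtered_operator_norm \<sigma> Y h L"
proof -
  have "finite_functional M (\<lambda>g. F (iterated_lower \<mu> r g))"
    by (rule finite_functional_compose[OF F finite_functional_iterated_lower])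
  then obtain \<kappa> where \<kappa>: "\<And>g. F (iterated_lower \<mu> r g) = (\<Sum>l\<le>M. \<kappa> l * g l)"
    unfolding finite_functional_def by blast
  have "\<bar>\<Sum>l\<le>M. (\<kappa> l / B) * gegenbauer (\<mu> + real r) l t 1\<bar> \<le> 1" if t: "\<bar>t\<bar> \<le> 1" for t
  proof -
    have "(\<Sum>l\<le>M. (\<kappa> l / B) * gegenbauer (\<mu> + real r) l t 1) = F (\<lambda>n. gegenbauer \<mu> n t 1) / B"
      using \<kappa>[of "\<lambda>l. gegenbauer (\<mu> + real r) l t 1"] iterated_lower_gegenbauer[OF \<mu>(2)]
      by (simp add: sum_divide_distrib)
    thus ?thesis using le[OF t] B by simp
  qed
  from filtered_operator_norm_ge[OF Y \<mu>(1) _ this, of h L] \<mu>(2)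
  have "ereal \<bar>\<Sum>l\<le>M. (\<kappa> l / B) * h (real l / real L)\<bar> \<le> filtered_operator_norm \<sigma> Y h L" by simp
  moreover have "(\<Sum>l\<le>M. (\<kappa> l / B) * h (real l / real L)) = F (iterated_lower \<mu> r (\<lambda>l. h (real l / real L))) / B"
    by (simp add: \<kappa> sum_divide_distrib)
  ultimately show ?thesis using B by simp
qed

end

section \<open>Legendre polynomials\<close>

abbreviation legendre :: "nat \<Rightarrow> real \<Rightarrow> real" where
  "legendre n t \<equiv> gegenbauer (1 / 2) n t 1"

lemma legendre_rec:
  "(real n + 2) * legendre (Suc (Suc n)) t = (2 * real n + 3) * t * legendre (Suc n) t - (real n + 1) * legendre n t"
proof -
  have "2 * (real n + 1 + 1 / 2) = 2 * real n + 3" "real n + 1 + 2 * (1 / 2) = real n + 2" by auto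
  thus ?thesis by (simp only: gegenbauer.simps) simp
qed

text \<open>
  Both identities are proved at once, since each of them is needed for the next degree of the
  other. Together they yield \<open>(1 - t\<^sup>2) P\<^sub>n' = n (P\<^sub>n\<^sub>-\<^sub>1 - t P\<^sub>n)\<close>.
\<close>

lemma legendre_derivatives:
  "\<exists>D E. (legendre (Suc n) has_real_derivative D) (at t) \<and> (legendre n has_real_derivative E) (at t) \<and>
     t * D - E = (real n + 1) * legendre (Suc n) t \<and> D - t * E = (real n + 1) * legendre n t"
proof (induction n)
  case 0
  have "(legendre (Suc 0) has_real_derivative 1) (at t)" "(legendre 0 has_real_derivative 0) (at t)"
    by (auto intro!: derivative_eq_intros)
  thus ?case by (intro exI[of _ 1] exI[of _ 0]) auto
next
  case (Suc n)
  then obtain D E where D: "(legendre (Suc n) has_real_derivative D) (at t)"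
    and E: "(legendre n has_real_derivative E) (at t)"
    and I: "t * D - E = (real n + 1) * legendre (Suc n) t" and II: "D - t * E = (real n + 1) * legendre n t"
    by blast
  define C where "C = ((2 * real n + 3) * (legendre (Suc n) t + t * D) - (real n + 1) * E) / (real n + 2)"
  have "legendre (Suc (Suc n)) = (\<lambda>t. ((2 * real n + 3) * (t * legendre (Suc n) t) - (real n + 1) * legendre n t) / (real n + 2))"
    by (rule ext) (use legendre_rec[of n] in \<open>simp add: eq_divide_eq mult_ac\<close>)
  moreover have "((\<lambda>t. ((2 * real n + 3) * (t * legendre (Suc n) t) - (real n + 1) * legendre n t) / (real n + 2))
      has_real_derivative C) (at t)"
    unfolding C_def by (rule derivative_eq_intros D E refl | simp)+
  ultimately have DC: "(legendre (Suc (Suc n)) has_real_derivative C) (at t)" by simp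
  \<comment> \<open>Eliminating the derivative of degree \<open>n\<close> leaves only \<open>D\<close>.\<close>
  have E_eq: "E = t * D - (real n + 1) * legendre (Suc n) t" using I by simp
  have "(real n + 2) * C = (real n + 2) * ((real n + 2) * legendre (Suc n) t + t * D)"
  proof -
    have "real n + 2 \<noteq> 0" by simp
    hence "(real n + 2) * C = (2 * real n + 3) * (legendre (Suc n) t + t * D) - (real n + 1) * E"
      unfolding C_def by simp
    thus ?thesis unfolding E_eq by (simp add: algebra_simps)
  qed
  hence C: "C = (real n + 2) * legendre (Suc n) t + t * D" by simp
  have "(1 - t\<^sup>2) * D = (real n + 1) * (legendre n t - t * legendre (Suc n) t)"
    using I II by (simp add: E_eq algebra_simps power2_eq_square)
  hence "t * C - D = (2 * real n + 3) * t * legendre (Suc n) t - (real n + 1) * legendre n t"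
    unfolding C by (simp add: algebra_simps power2_eq_square)
  also have "\<dots> = (real n + 2) * legendre (Suc (Suc n)) t" by (rule legendre_rec[symmetric])
  finally have "t * C - D = (real (Suc n) + 1) * legendre (Suc (Suc n)) t"
    by (simp add: add_ac del: gegenbauer.simps)
  moreover have "C - t * D = (real (Suc n) + 1) * legendre (Suc n) t"
    unfolding C by simp
  ultimately show ?case using DC D by blast
qed

lemma legendre_at_zero:
  shows legendre_odd_zero: "legendre (Suc (2 * k)) 0 = 0"
    and legendre_even_zero: "(2 * real k + 1) * (legendre (2 * k) 0)\<^sup>2 \<le> 1"
proof -
  show "legendre (Suc (2 * k)) 0 = 0" by (induction k) auto
  show "(2 * real k + 1) * (legendre (2 * k) 0)\<^sup>2 \<le> 1"
  proof (induction k)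
    case (Suc k)
    define p where "p = legendre (2 * k) 0"
    have eq: "legendre (2 * Suc k) 0 = - ((2 * real k + 1) / (2 * real k + 2)) * p"
      by (simp add: p_def)
    have "(2 * real (Suc k) + 1) * (legendre (2 * Suc k) 0)\<^sup>2
        = ((2 * real k + 3) * (2 * real k + 1) / (2 * real k + 2)\<^sup>2) * ((2 * real k + 1) * p\<^sup>2)"
      unfolding eq by (simp add: power_mult_distrib power_divide power2_eq_square add_ac)
    also have "\<dots> \<le> 1 * 1"
    proof (rule mult_mono)
      show "(2 * real k + 3) * (2 * real k + 1) / (2 * real k + 2)\<^sup>2 \<le> 1"
      proof -
        have "(2 * real k + 3) * (2 * real k + 1) \<le> (2 * real k + 2)\<^sup>2"
          by (simp add: power2_eq_square algebra_simps)
        moreover have "(2 * real k + 2)\<^sup>2 > 0" by (simp add: add_nonneg_pos)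
        ultimately show ?thesis by simp
      qed
    qed (use Suc in \<open>auto simp: p_def\<close>)
    finally show ?case by simp
  qed auto
qed

text \<open>
  With \<open>Q = (1 - s\<^sup>2) P\<^sub>n'\<close>, the energy \<open>E = n (n + 1) (1 - s\<^sup>2) P\<^sub>n\<^sup>2 + Q\<^sup>2\<close> has the derivative
  \<open>- 2 s n (n + 1) P\<^sub>n\<^sup>2\<close> by the Legendre equation. Hence it is largest at \<open>0\<close>.
\<close>

lemma legendre_energy:
  assumes n: "n = Suc m" and t: "\<bar>t\<bar> \<le> 1"
  shows "(real n * (legendre m t - t * legendre n t))\<^sup>2
       \<le> real n * (real n + 1) * (legendre n 0)\<^sup>2 + (real n * legendre m 0)\<^sup>2"
proof -
  define Q where "Q s = real n * (legendre m s - s * legendre n s)" for s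
  define E where "E s = real n * (real n + 1) * (1 - s\<^sup>2) * (legendre n s)\<^sup>2 + (Q s)\<^sup>2" for s
  have dE: "(E has_real_derivative - (2 * s * real n * (real n + 1) * (legendre n s)\<^sup>2)) (at s)" for s
  proof -
    obtain C D where C: "(legendre n has_real_derivative C) (at s)" and D: "(legendre m has_real_derivative D) (at s)"
      and I: "s * C - D = real n * legendre n s" and II: "C - s * D = real n * legendre m s"
      using legendre_derivatives[of m s] n by (auto simp: add.commute)
    have D_eq: "D = s * C - real n * legendre n s" using I by simp
    have Q': "(Q has_real_derivative - (real n * (real n + 1) * legendre n s)) (at s)"
      unfolding Q_def by (rule derivative_eq_intros C D refl | simp add: D_eq algebra_simps)+
    have Qs: "Q s = (1 - s\<^sup>2) * C" using II by (simp add: Q_def D_eq algebra_simps power2_eq_square)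
    have "(E has_real_derivative (real n * (real n + 1) * ((0 - 2 * s) * (legendre n s)\<^sup>2 + (1 - s\<^sup>2) * (2 * legendre n s * C))
         + 2 * Q s * - (real n * (real n + 1) * legendre n s))) (at s)"
      unfolding E_def by (rule derivative_eq_intros C Q' refl | simp add: algebra_simps)+
    also have "(real n * (real n + 1) * ((0 - 2 * s) * (legendre n s)\<^sup>2 + (1 - s\<^sup>2) * (2 * legendre n s * C))
         + 2 * Q s * - (real n * (real n + 1) * legendre n s)) = - (2 * s * real n * (real n + 1) * (legendre n s)\<^sup>2)"
      unfolding Qs by (simp add: algebra_simps)
    finally show ?thesis .
  qed
  have "E t \<le> E 0"
  proof (cases "t \<ge> 0")
    case True
    have "\<exists>y. (E has_real_derivative y) (at s) \<and> y \<le> 0" if "s \<ge> 0" for s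
      by (rule exI, rule conjI, rule dE) (use that in simp)
    with True show ?thesis by (intro DERIV_nonpos_imp_nonincreasing[of 0 t E])
  next
    case False
    have "\<exists>y. (E has_real_derivative y) (at s) \<and> y \<ge> 0" if "s \<le> 0" for s
      by (rule exI, rule conjI, rule dE) (use that in \<open>simp add: mult_nonpos_nonneg\<close>)
    with False show ?thesis by (intro DERIV_nonneg_imp_nondecreasing[of t 0 E]) auto
  qed
  moreover have "(Q t)\<^sup>2 \<le> E t" using t by (simp add: E_def abs_square_le_1)
  ultimately show ?thesis by (simp add: E_def Q_def)
qed

text \<open>
  Up to a factor \<open>(2 n + 1) / (n (n + 1))\<close> the difference is the quantity \<open>Q\<close> of the energy
  estimate, where \<open>n = m + 1\<close> is even. At \<open>0\<close> only \<open>P\<^sub>n(0)\<^sup>2 \<le> 1 / (n + 1)\<close> contributes to the energy.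
\<close>

lemma legendre_difference_bound:
  assumes m: "odd m" and t: "\<bar>t\<bar> \<le> 1"
  shows "\<bar>sqrt (real (Suc m)) * (legendre m t - legendre (Suc (Suc m)) t)\<bar> \<le> 2"
proof -
  define n where "n = Suc m"
  have n: "real n > 0" "real m = real n - 1" by (auto simp: n_def)
  obtain j where j: "m = Suc (2 * j)" using m by (auto elim: oddE)
  define Q where "Q = real n * (legendre m t - t * legendre n t)"
  have "legendre m 0 = 0" using legendre_odd_zero j by simp
  moreover have "(real n + 1) * (legendre n 0)\<^sup>2 \<le> 1"
    using legendre_even_zero[of "Suc j"] by (simp add: n_def j add_ac)
  hence "real n * ((real n + 1) * (legendre n 0)\<^sup>2) \<le> real n * 1" by (intro mult_left_mono) auto
  ultimately have "Q\<^sup>2 \<le> real n"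
    using legendre_energy[OF n_def t] by (simp add: Q_def mult.assoc)
  hence Q: "\<bar>Q\<bar> \<le> sqrt (real n)" by (simp add: real_le_rsqrt)
  have "(real n + 1) * (legendre m t - legendre (Suc n) t) = (2 * real n + 1) * (legendre m t - t * legendre n t)"
    using legendre_rec[of m t] by (simp only: n_def[symmetric] n(2)) (simp add: algebra_simps)
  hence "real n * (real n + 1) * (legendre m t - legendre (Suc n) t) = (2 * real n + 1) * Q"
    by (simp add: Q_def mult_ac)
  hence eq: "legendre m t - legendre (Suc n) t = (2 * real n + 1) * Q / (real n * (real n + 1))"
    using n by (simp add: eq_divide_eq mult_ac)
  have "\<bar>sqrt (real n) * (legendre m t - legendre (Suc n) t)\<bar>
      = (2 * real n + 1) / (real n * (real n + 1)) * (sqrt (real n) * \<bar>Q\<bar>)"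
    unfolding eq using n by (simp add: abs_mult)
  also have "\<dots> \<le> (2 * real n + 1) / (real n * (real n + 1)) * (sqrt (real n) * sqrt (real n))"
    using Q n by (intro mult_left_mono) auto
  also have "\<dots> = (2 * real n + 1) / (real n + 1)" using n by simp
  also have "\<dots> \<le> 2" using n by (simp add: divide_le_eq)
  finally show ?thesis by (simp add: n_def)
qed

section \<open>Fejer sums\<close>

text \<open>
  Fejer means of the sawtooth series \<open>\<Sum> sin(k\<theta>) / k\<close>. The index is shifted by one.
\<close>

definition fejer_coeff :: "nat \<Rightarrow> nat \<Rightarrow> real" where
  "fejer_coeff K k = (1 - real (Suc k) / real K) / real (Suc k)"

text \<open>
  This is \<open>K\<close> times the Fejer kernel, that is, the squared modulus of \<open>\<Sum>\<^bsub>j<K\<^esub> exp(i j \<theta>)\<close>.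
\<close>

lemma fejer_kernel_nonneg:
  "real K + 2 * (\<Sum>k<K. (real K - real (Suc k)) * cos (real (Suc k) * \<theta>)) \<ge> 0"
proof -
  have "real K + 2 * (\<Sum>k<K. (real K - real (Suc k)) * cos (real (Suc k) * \<theta>))
      = (\<Sum>j<K. cos (real j * \<theta>))\<^sup>2 + (\<Sum>j<K. sin (real j * \<theta>))\<^sup>2"
  proof (induction K)
    case (Suc K)
    define C S where "C = (\<Sum>j<K. cos (real j * \<theta>))" and "S = (\<Sum>j<K. sin (real j * \<theta>))"
    have "(\<Sum>k<Suc K. (real (Suc K) - real (Suc k)) * cos (real (Suc k) * \<theta>))
        = (\<Sum>k<K. (real K - real (Suc k)) * cos (real (Suc k) * \<theta>)) + (\<Sum>k<K. cos (real (Suc k) * \<theta>))"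
      by (simp add: algebra_simps flip: sum.distrib)
    also have "(\<Sum>k<K. cos (real (Suc k) * \<theta>)) = (\<Sum>j<K. cos (real (Suc (K - Suc j)) * \<theta>))"
      by (rule sum.nat_diff_reindex[symmetric])
    also have "\<dots> = (\<Sum>j<K. cos (real K * \<theta> - real j * \<theta>))"
      by (intro sum.cong refl arg_cong[where f = cos]) (auto simp: Suc_diff_Suc of_nat_diff algebra_simps)
    also have "\<dots> = cos (real K * \<theta>) * C + sin (real K * \<theta>) * S"
      by (simp add: cos_diff sum.distrib sum_distrib_left C_def S_def)
    finally have "real (Suc K) + 2 * (\<Sum>k<Suc K. (real (Suc K) - real (Suc k)) * cos (real (Suc k) * \<theta>))
        = 1 + (C\<^sup>2 + S\<^sup>2) + 2 * (cos (real K * \<theta>) * C + sin (real K * \<theta>) * S)"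
      using Suc by (simp add: C_def S_def)
    also have "\<dots> = (C + cos (real K * \<theta>))\<^sup>2 + (S + sin (real K * \<theta>))\<^sup>2"
      using sin_cos_squared_add[of "real K * \<theta>"] by (simp add: power2_sum)
    finally show ?case by (simp add: C_def S_def)
  qed simp
  thus ?thesis by simp
qed

text \<open>
  Twice the sum plus \<open>\<theta>\<close> has the Fejer kernel as its derivative. So it increases from \<open>0\<close> at \<open>0\<close> to
  \<open>\<pi>\<close> at \<open>\<pi>\<close>.
\<close>

lemma fejer_sum_bounded:
  assumes K: "K > 0" and \<theta>: "0 \<le> \<theta>" "\<theta> \<le> pi"
  shows "\<bar>\<Sum>k<K. fejer_coeff K k * sin (real (Suc k) * \<theta>)\<bar> \<le> pi"
proof -
  define g where "g x = x + 2 * (\<Sum>k<K. fejer_coeff K k * sin (real (Suc k) * x))" for x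
  have dg: "\<exists>y. (g has_real_derivative y) (at x) \<and> y \<ge> 0" for x
  proof (intro exI conjI)
    show "(g has_real_derivative 1 + 2 * (\<Sum>k<K. fejer_coeff K k * (cos (real (Suc k) * x) * real (Suc k)))) (at x)"
      unfolding g_def by (auto intro!: derivative_eq_intros sum.cong simp: mult_ac)
    have "fejer_coeff K k * (cos (real (Suc k) * x) * real (Suc k)) = ((real K - real (Suc k)) * cos (real (Suc k) * x)) / real K" for k
      using K by (simp add: fejer_coeff_def divide_simps del: of_nat_Suc)
    hence "1 + 2 * (\<Sum>k<K. fejer_coeff K k * (cos (real (Suc k) * x) * real (Suc k)))
       = (real K + 2 * (\<Sum>k<K. (real K - real (Suc k)) * cos (real (Suc k) * x))) / real K"
      using K by (simp add: add_divide_distrib sum_divide_distrib[symmetric] del: of_nat_Suc)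
    also have "\<dots> \<ge> 0" by (intro divide_nonneg_nonneg fejer_kernel_nonneg) auto
    finally show "1 + 2 * (\<Sum>k<K. fejer_coeff K k * (cos (real (Suc k) * x) * real (Suc k))) \<ge> 0" .
  qed
  have "g 0 \<le> g \<theta>" by (rule DERIV_nonneg_imp_nondecreasing[OF \<theta>(1) dg])
  moreover have "g \<theta> \<le> g pi" by (rule DERIV_nonneg_imp_nondecreasing[OF \<theta>(2) dg])
  moreover have "g 0 = 0" "g pi = pi" by (simp_all add: g_def del: of_nat_Suc)
  ultimately show ?thesis using \<theta> unfolding g_def by linarith
qed

lemma fejer_coeff_le: "k < K \<Longrightarrow> 0 \<le> fejer_coeff K k \<and> fejer_coeff K k \<le> 1"
proof -
  assume k: "k < K"
  have "real (Suc k) / real K \<le> 1" using k by (simp add: divide_le_eq)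
  moreover have "real (Suc k) / real K \<ge> 0" by simp
  ultimately have "0 \<le> 1 - real (Suc k) / real K" "1 - real (Suc k) / real K \<le> real (Suc k)" by linarith+
  thus ?thesis by (simp add: fejer_coeff_def divide_le_eq del: of_nat_Suc)
qed

lemma sum_fejer_coeff_at_top: "filterlim (\<lambda>K. \<Sum>k<K. fejer_coeff K k) at_top sequentially"
proof -
  have eq: "harm K + (-1) = (\<Sum>k<K. fejer_coeff K k)" if "K > 0" for K
  proof -
    have "fejer_coeff K k = inverse (real (Suc k)) - 1 / real K" for k
      using that by (simp add: fejer_coeff_def divide_simps del: of_nat_Suc)
    hence "(\<Sum>k<K. fejer_coeff K k) = (\<Sum>k<K. inverse (real (Suc k))) - 1"
      using that by (simp add: sum_subtractf)
    also have "(\<Sum>k<K. inverse (real (Suc k))) = harm K"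
      unfolding harm_def by (rule sum.reindex_bij_witness[of _ "\<lambda>k. k - 1" Suc]) auto
    finally show ?thesis by simp
  qed
  have "filterlim (\<lambda>K. harm K + (-1 :: real)) at_top sequentially"
    using filterlim_tendsto_add_at_top[OF tendsto_const[of "-1"] harm_at_top] by (simp add: add.commute)
  moreover have "eventually (\<lambda>K. harm K + (-1 :: real) = (\<Sum>k<K. fejer_coeff K k)) sequentially"
    using eventually_gt_at_top[of 0] by (rule eventually_mono) (rule eq)
  ultimately show ?thesis by (rule filterlim_mono_eventually[OF _ order_refl order_refl])
qed

section \<open>Absolute continuity and bounded variation\<close>

text \<open>
  A majorant \<open>G\<close> of the increments makes the variation telescope.
\<close>

lemma bounded_variation_onI:
  assumes "\<And>x y. x \<in> A \<Longrightarrow> y \<in> A \<Longrightarrow> x \<le> y \<Longrightarrow> \<bar>f y - f x\<bar> \<le> G y - G x"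
    and "\<And>x. x \<in> A \<Longrightarrow> \<bar>G x\<bar> \<le> B"
  shows "bounded_variation_on A f"
  unfolding bounded_variation_on_def
proof (intro exI[of _ "2 * B"] allI impI)
  fix n :: nat and x :: "nat \<Rightarrow> real"
  assume x: "x ` {..n} \<subseteq> A \<and> mono_on {..n} x"
  have "(\<Sum>i<n. \<bar>f (x (Suc i)) - f (x i)\<bar>) \<le> (\<Sum>i<n. G (x (Suc i)) - G (x i))"
    using x by (intro sum_mono assms(1)) (auto simp: mono_on_def)
  also have "\<dots> = G (x n) - G (x 0)" by (rule sum_lessThan_telescope)
  also have "\<dots> \<le> 2 * B"
  proof -
    have "x n \<in> A" "x 0 \<in> A" using x by auto
    from this[THEN assms(2)] show ?thesis by linarith
  qed
  finally show "(\<Sum>i<n. \<bar>f (x (Suc i)) - f (x i)\<bar>) \<le> 2 * B" .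
qed

text \<open>
  A monotone function maps disjoint intervals to disjoint intervals, whose total length is
  measured inside the range.
\<close>

lemma disjoint_intervals_antimono:
  fixes u :: "real \<Rightarrow> real"
  assumes anti: "\<And>x y. x \<in> A \<Longrightarrow> y \<in> A \<Longrightarrow> x \<le> y \<Longrightarrow> u y \<le> u x"
    and range: "\<And>x. x \<in> A \<Longrightarrow> 0 \<le> u x \<and> u x \<le> \<eta>"
    and ab: "\<And>i. i < n \<Longrightarrow> a i \<in> A \<and> b i \<in> A \<and> a i \<le> b i"
    and disj: "disjoint_family_on (\<lambda>i. {a i<..<b i}) {..<n::nat}"
    and \<eta>: "\<eta> \<ge> 0"
  shows "(\<Sum>i<n. \<bar>u (b i) - u (a i)\<bar>) \<le> \<eta>"
proof -
  have le: "u (b i) \<le> u (a i)" if "i < n" for i using ab[OF that] anti by auto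
  have disj': "disjoint_family_on (\<lambda>i. {u (b i)<..<u (a i)}) {..<n}"
    unfolding disjoint_family_on_def
  proof (intro ballI impI)
    fix i j assume ij: "i \<in> {..<n}" "j \<in> {..<n}" "i \<noteq> j"
    show "{u (b i)<..<u (a i)} \<inter> {u (b j)<..<u (a j)} = {}"
    proof (rule ccontr)
      assume "{u (b i)<..<u (a i)} \<inter> {u (b j)<..<u (a j)} \<noteq> {}"
      then obtain y where "y \<in> {u (b i)<..<u (a i)} \<inter> {u (b j)<..<u (a j)}" by blast
      hence y: "u (b i) < y" "y < u (a i)" "u (b j) < y" "y < u (a j)" by auto
      have "a i < b i" "a j < b j" using y ab[of i] ab[of j] ij by (force simp: order_le_less)+
      have "b i \<le> a j \<or> b j \<le> a i"
      proof (rule ccontr)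
        assume "\<not> (b i \<le> a j \<or> b j \<le> a i)"
        hence "max (a i) (a j) < min (b i) (b j)" using \<open>a i < b i\<close> \<open>a j < b j\<close> by auto
        then obtain z where "max (a i) (a j) < z" "z < min (b i) (b j)" using dense by blast
        hence "z \<in> {a i<..<b i} \<inter> {a j<..<b j}" by auto
        thus False using disj ij unfolding disjoint_family_on_def by blast
      qed
      thus False using y anti[of "b i" "a j"] anti[of "b j" "a i"] ab[of i] ab[of j] ij by force
    qed
  qed
  have "ennreal (\<Sum>i<n. u (a i) - u (b i)) = (\<Sum>i<n. emeasure lborel {u (b i)<..<u (a i)})"
    using le by (subst sum_ennreal[symmetric]) auto
  also have "\<dots> = emeasure lborel (\<Union>i<n. {u (b i)<..<u (a i)})"
    by (rule sum_emeasure) (use disj' in auto)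
  also have "\<dots> \<le> emeasure lborel {0..\<eta>}"
  proof (rule emeasure_mono)
    show "(\<Union>i<n. {u (b i)<..<u (a i)}) \<subseteq> {0..\<eta>}"
    proof
      fix y assume "y \<in> (\<Union>i<n. {u (b i)<..<u (a i)})"
      then obtain i where i: "i < n" "u (b i) < y" "y < u (a i)" by auto
      thus "y \<in> {0..\<eta>}" using range[of "a i"] range[of "b i"] ab[of i] by auto
    qed
  qed simp
  also have "\<dots> = ennreal \<eta>" using \<eta> by simp
  finally have "(\<Sum>i<n. u (a i) - u (b i)) \<le> \<eta>" using \<eta> by simp
  moreover have "(\<Sum>i<n. \<bar>u (b i) - u (a i)\<bar>) = (\<Sum>i<n. u (a i) - u (b i))"
    using le by (intro sum.cong) auto
  ultimately show ?thesis by simp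
qed

text \<open>
  A function is absolutely continuous if it is, for every \<open>\<eta>\<close>, the sum of a Lipschitz function and
  of a monotone function of oscillation at most \<open>\<eta>\<close>. This suits functions whose derivative is
  unbounded near a single point.
\<close>

lemma abs_continuous_onI:
  fixes f :: "real \<Rightarrow> real"
  assumes "\<And>\<eta>. 0 < \<eta> \<Longrightarrow> \<exists>u C.
      (\<forall>x\<in>A. \<forall>y\<in>A. x \<le> y \<longrightarrow> u y \<le> u x) \<and> (\<forall>x\<in>A. 0 \<le> u x \<and> u x \<le> \<eta>) \<and>
      (\<forall>x\<in>A. \<forall>y\<in>A. \<bar>(f x - u x) - (f y - u y)\<bar> \<le> C * \<bar>x - y\<bar>)"
  shows "abs_continuous_on A f"
  unfolding abs_continuous_on_def
proof (intro allI impI)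
  fix \<epsilon> :: real assume \<epsilon>: "\<epsilon> > 0"
  obtain u C where anti: "\<And>x y. x \<in> A \<Longrightarrow> y \<in> A \<Longrightarrow> x \<le> y \<Longrightarrow> u y \<le> u x"
    and range: "\<And>x. x \<in> A \<Longrightarrow> 0 \<le> u x \<and> u x \<le> \<epsilon> / 2"
    and lip: "\<And>x y. x \<in> A \<Longrightarrow> y \<in> A \<Longrightarrow> \<bar>(f x - u x) - (f y - u y)\<bar> \<le> C * \<bar>x - y\<bar>"
    using assms[of "\<epsilon> / 2"] \<epsilon> by (metis half_gt_zero)
  define K where "K = \<bar>C\<bar> + 1"
  have K: "K > 0" "C \<le> K" by (auto simp: K_def)
  define \<delta> where "\<delta> = \<epsilon> / (2 * K)"
  have \<delta>: "\<delta> > 0" using \<epsilon> K by (simp add: \<delta>_def)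
  show "\<exists>\<delta>>0. \<forall>(n::nat) a b. (\<forall>i<n. a i \<in> A \<and> b i \<in> A \<and> a i \<le> b i) \<and>
      disjoint_family_on (\<lambda>i. {a i<..<b i}) {..<n} \<and> (\<Sum>i<n. b i - a i) < \<delta> \<longrightarrow>
      (\<Sum>i<n. \<bar>f (b i) - f (a i)\<bar>) < \<epsilon>"
  proof (intro exI[of _ \<delta>] conjI \<delta> allI impI)
    fix n :: nat and a b :: "nat \<Rightarrow> real"
    assume H: "(\<forall>i<n. a i \<in> A \<and> b i \<in> A \<and> a i \<le> b i) \<and>
      disjoint_family_on (\<lambda>i. {a i<..<b i}) {..<n} \<and> (\<Sum>i<n. b i - a i) < \<delta>"
    have "(\<Sum>i<n. \<bar>f (b i) - f (a i)\<bar>) \<le> (\<Sum>i<n. \<bar>u (b i) - u (a i)\<bar> + K * (b i - a i))"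
    proof (rule sum_mono)
      fix i assume "i \<in> {..<n}"
      hence i: "a i \<in> A" "b i \<in> A" "a i \<le> b i" using H by auto
      have "\<bar>(f (b i) - u (b i)) - (f (a i) - u (a i))\<bar> \<le> C * \<bar>b i - a i\<bar>" by (rule lip[OF i(2,1)])
      also have "\<dots> \<le> K * (b i - a i)" using i(3) K by (intro mult_mono) auto
      finally show "\<bar>f (b i) - f (a i)\<bar> \<le> \<bar>u (b i) - u (a i)\<bar> + K * (b i - a i)" by linarith
    qed
    also have "\<dots> = (\<Sum>i<n. \<bar>u (b i) - u (a i)\<bar>) + K * (\<Sum>i<n. b i - a i)"
      by (simp add: sum.distrib sum_distrib_left)
    also have "\<dots> < \<epsilon> / 2 + K * \<delta>"
    proof (rule add_le_less_mono)
      show "(\<Sum>i<n. \<bar>u (b i) - u (a i)\<bar>) \<le> \<epsilon> / 2"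
        using H \<epsilon> by (intro disjoint_intervals_antimono[of A u, OF anti range]) auto
      show "K * (\<Sum>i<n. b i - a i) < K * \<delta>"
        using H K by (intro mult_strict_left_mono) auto
    qed
    also have "K * \<delta> = \<epsilon> / 2"
      using K by (simp add: \<delta>_def)
    finally show "(\<Sum>i<n. \<bar>f (b i) - f (a i)\<bar>) < \<epsilon>" by simp
  qed
qed

lemma abs_continuous_on_Lipschitz:
  assumes "\<And>x y. x \<in> A \<Longrightarrow> y \<in> A \<Longrightarrow> \<bar>f x - f y\<bar> \<le> C * \<bar>x - y\<bar>"
  shows "abs_continuous_on A f"
  by (rule abs_continuous_onI, rule exI[of _ "\<lambda>_. 0"], rule exI[of _ C]) (use assms in auto)

section \<open>A fourth root filter\<close>

text \<open>
  The exponent has to lie strictly between \<open>0\<close> and \<open>1/2\<close>: positive for absolute continuity, and such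
  that the value \<open>L\<^sup>-\<^sup>1\<^sup>/\<^sup>4\<close> at \<open>2 - 1/L\<close> is large compared with \<open>1 / \<surd>L\<close>.
\<close>

definition root_filter :: "real \<Rightarrow> real" where
  "root_filter t = min 1 (sqrt (sqrt (max 0 (2 - t))))"

lemma root_filter_antimono: "x \<le> y \<Longrightarrow> root_filter y \<le> root_filter x"
  unfolding root_filter_def by (intro min.mono order_refl real_sqrt_le_mono max.mono) auto

lemma root_filter_range: "0 \<le> root_filter t \<and> root_filter t \<le> 1"
  by (auto simp: root_filter_def)

lemma filter_function_root_filter: "filter_function root_filter"
  unfolding filter_function_def
proof (intro conjI ballI allI impI)
  show "continuous_on {0..} root_filter"
    unfolding root_filter_def by (intro continuous_intros)
qed (auto simp: root_filter_def)

lemma sqrt_Lipschitz: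
  assumes "c > 0" "a \<ge> c" "b \<ge> c"
  shows "\<bar>sqrt a - sqrt b\<bar> \<le> \<bar>a - b\<bar> / sqrt c"
proof -
  have s: "sqrt c > 0" "sqrt a \<ge> sqrt c" "sqrt b \<ge> sqrt c" using assms by auto
  have "\<bar>sqrt a - sqrt b\<bar> * sqrt c \<le> \<bar>sqrt a - sqrt b\<bar> * (sqrt a + sqrt b)"
    using s by (intro mult_left_mono) linarith+
  also have "\<dots> = \<bar>(sqrt a - sqrt b) * (sqrt a + sqrt b)\<bar>" using s by (simp add: abs_mult)
  also have "(sqrt a - sqrt b) * (sqrt a + sqrt b) = a - b" using assms by (simp add: algebra_simps)
  finally show ?thesis using s by (simp add: le_divide_eq)
qed

text \<open>
  Cut the filter at the height \<open>\<eta>\<close>. The part above is Lipschitz, because there \<open>2 - t \<ge> \<eta>\<^sup>4\<close>; the part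
  below is monotone.
\<close>

lemma abs_continuous_root_filter: "abs_continuous_on {0..} root_filter"
proof (rule abs_continuous_onI)
  fix \<eta> :: real assume \<eta>: "\<eta> > 0"
  define c where "c = \<eta>\<^sup>2"
  define d where "d = c\<^sup>2"
  have pos: "c > 0" "d > 0" using \<eta> by (auto simp: c_def d_def)
  have sq: "sqrt c = \<eta>" using \<eta> by (simp add: c_def)
  have sqd: "sqrt d = c" using pos by (simp add: d_def)
  define v where "v t = sqrt (sqrt (max d (2 - t)))" for t
  define u where "u t = min \<eta> (root_filter t)" for t
  have split: "root_filter t - u t = min 1 (v t) - min 1 \<eta>" for t
  proof -
    have "v t = max \<eta> (sqrt (sqrt (max 0 (2 - t))))"
    proof (cases "2 - t \<ge> d")
      case True
      hence "sqrt (sqrt (2 - t)) \<ge> sqrt (sqrt d)" by (simp only: real_sqrt_le_iff)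
      thus ?thesis using True pos by (simp add: v_def sq sqd max_def)
    next
      case False
      hence "sqrt (sqrt (max 0 (2 - t))) \<le> sqrt (sqrt d)" using pos by (intro real_sqrt_le_mono) auto
      thus ?thesis using False pos by (simp add: v_def sq sqd max_def)
    qed
    moreover have "min 1 q - min \<eta> (min 1 q) = min 1 (max \<eta> q) - min 1 \<eta>" for q
      by (auto simp: min_def max_def)
    ultimately show ?thesis by (simp only: u_def root_filter_def)
  qed
  have lip: "\<bar>(root_filter x - u x) - (root_filter y - u y)\<bar> \<le> (1 / (c * \<eta>)) * \<bar>x - y\<bar>" for x y
  proof -
    have "\<bar>(root_filter x - u x) - (root_filter y - u y)\<bar> \<le> \<bar>v x - v y\<bar>"
      unfolding split by (auto simp: min_def)
    also have "\<dots> \<le> \<bar>sqrt (max d (2 - x)) - sqrt (max d (2 - y))\<bar> / sqrt c"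
      unfolding v_def using pos by (intro sqrt_Lipschitz) (auto simp flip: sqd)
    also have "\<dots> \<le> (\<bar>max d (2 - x) - max d (2 - y)\<bar> / sqrt d) / sqrt c"
      using pos by (intro divide_right_mono sqrt_Lipschitz) auto
    also have "\<dots> \<le> (\<bar>x - y\<bar> / sqrt d) / sqrt c"
      using pos by (intro divide_right_mono) auto
    finally show ?thesis by (simp add: sq sqd)
  qed
  show "\<exists>u C. (\<forall>x\<in>{0..}. \<forall>y\<in>{0..}. x \<le> y \<longrightarrow> u y \<le> u x) \<and> (\<forall>x\<in>{0..}. 0 \<le> u x \<and> u x \<le> \<eta>) \<and>
      (\<forall>x\<in>{0..}. \<forall>y\<in>{0..}. \<bar>(root_filter x - u x) - (root_filter y - u y)\<bar> \<le> C * \<bar>x - y\<bar>)"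
    using lip root_filter_antimono root_filter_range \<eta>
    by (intro exI[of _ u] exI[of _ "1 / (c * \<eta>)"]) (auto simp: u_def intro: min.coboundedI2)
qed

lemma root_filter_WBV: "root_filter \<in> WBV 0"
proof -
  have "bounded_variation_on {0..} root_filter"
    by (rule bounded_variation_onI[where G = "\<lambda>t. - root_filter t" and B = 1])
       (use root_filter_antimono root_filter_range in \<open>auto simp: abs_le_iff\<close>)
  thus ?thesis by (simp add: WBV_def abs_continuous_root_filter)
qed

section \<open>Truncated powers\<close>

lemma truncated_power_derivative:
  "((\<lambda>t. max 0 (\<tau> - t) ^ Suc (Suc k)) has_real_derivative - (real (k + 2) * max 0 (\<tau> - t) ^ Suc k)) (at t)"
proof -
  have "((\<lambda>u. max 0 u ^ Suc (Suc k)) has_real_derivative real (k + 2) * max 0 u ^ Suc k) (at u)" for u :: real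
  proof -
    consider "u > 0" | "u < 0" | "u = 0" by linarith
    thus ?thesis
    proof cases
      case 1
      have "((\<lambda>u. u ^ Suc (Suc k)) has_real_derivative real (k + 2) * u ^ Suc k) (at u)"
        using DERIV_pow[of "Suc (Suc k)" u] by simp
      thus ?thesis using 1
        by (subst DERIV_cong_ev[OF refl _ refl, of _ "\<lambda>u. u ^ Suc (Suc k)"])
           (use eventually_nhds_in_open[of "{0<..}" u] in \<open>auto elim!: eventually_mono\<close>)
    next
      case 2
      have "((\<lambda>u. 0) has_real_derivative 0) (at u)" by simp
      thus ?thesis using 2
        by (subst DERIV_cong_ev[OF refl _ refl, of _ "\<lambda>u. 0"])
           (use eventually_nhds_in_open[of "{..<0}" u] in \<open>auto elim!: eventually_mono\<close>)
    next
      case 3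
      have "((\<lambda>h::real. max 0 h ^ Suc (Suc k) / h) \<longlongrightarrow> 0) (at 0)"
      proof (rule Lim_null_comparison)
        show "((\<lambda>h::real. \<bar>h\<bar> ^ Suc k) \<longlongrightarrow> 0) (at 0)"
          by (rule tendsto_eq_intros refl | simp)+
        show "\<forall>\<^sub>F h in at 0. norm (max 0 h ^ Suc (Suc k) / h) \<le> \<bar>h::real\<bar> ^ Suc k"
          by (intro always_eventually allI) (auto simp: max_def mult_nonpos_nonneg)
      qed
      thus ?thesis using 3 by (simp add: DERIV_def)
    qed
  qed
  moreover have "((\<lambda>t. \<tau> - t) has_real_derivative - 1) (at t)"
    by (auto intro!: derivative_eq_intros)
  ultimately have "((\<lambda>t. max 0 (\<tau> - t) ^ Suc (Suc k)) has_real_derivative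
      (real (k + 2) * max 0 (\<tau> - t) ^ Suc k) * - 1) (at t)" by (rule DERIV_chain2)
  thus ?thesis by (simp only: mult_minus1_right)
qed

lemma truncated_linear_right_derivative:
  "((\<lambda>t. max 0 (\<tau> - t)) has_real_derivative - (if t < \<tau> then 1 else 0 :: real)) (at_right t)"
proof -
  have "((\<lambda>t. max 0 (\<tau> - t)) has_real_derivative - (if t < \<tau> then 1 else 0)) (at t within {t..})"
  proof (cases "t < \<tau>")
    case True
    have "((\<lambda>t. \<tau> - t) has_real_derivative - 1) (at t within {t..})" by (auto intro!: derivative_eq_intros)
    from has_field_derivative_transform_within[OF this, of "\<tau> - t"] show ?thesis
      using True by (auto simp: dist_real_def)
  next
    case False
    have "((\<lambda>t. 0) has_real_derivative 0) (at t within {t..})" by simp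
    from has_field_derivative_transform_within[OF this, of 1 "\<lambda>t. max 0 (\<tau> - t)"] show ?thesis
      using False by auto
  qed
  thus ?thesis by (rule has_field_derivative_subset) auto
qed

lemma truncated_linear_left_derivative:
  "((\<lambda>t. max 0 (\<tau> - t)) has_real_derivative - (if t \<le> \<tau> then 1 else 0 :: real)) (at_left t)"
proof -
  have "((\<lambda>t. max 0 (\<tau> - t)) has_real_derivative - (if t \<le> \<tau> then 1 else 0)) (at t within {..t})"
  proof (cases "t \<le> \<tau>")
    case True
    have "((\<lambda>t. \<tau> - t) has_real_derivative - 1) (at t within {..t})" by (auto intro!: derivative_eq_intros)
    from has_field_derivative_transform_within[OF this, of 1 "\<lambda>t. max 0 (\<tau> - t)"] show ?thesis
      using True by auto
  next
    case False
    have "((\<lambda>t. 0) has_real_derivative 0) (at t within {..t})" by simp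
    from has_field_derivative_transform_within[OF this, of "t - \<tau>" "\<lambda>t. max 0 (\<tau> - t)"] show ?thesis
      using False by (auto simp: dist_real_def)
  qed
  thus ?thesis by (rule has_field_derivative_subset) auto
qed

lemma truncated_power_Lipschitz:
  fixes \<tau> :: real
  assumes "\<tau> \<ge> 0"
  shows "\<exists>C. \<forall>x\<in>{0..}. \<forall>y\<in>{0..}. \<bar>max 0 (\<tau> - x) ^ k - max 0 (\<tau> - y) ^ k\<bar> \<le> C * \<bar>x - y\<bar>"
proof (induction k)
  case 0
  show ?case by (rule exI[of _ 0]) simp
next
  case (Suc k)
  then obtain C where C: "\<And>x y. x \<ge> 0 \<Longrightarrow> y \<ge> 0 \<Longrightarrow> \<bar>max 0 (\<tau> - x) ^ k - max 0 (\<tau> - y) ^ k\<bar> \<le> C * \<bar>x - y\<bar>"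
    by auto
  show ?case
  proof (intro exI[of _ "\<tau> * C + \<tau> ^ k"] ballI)
    fix x y :: real assume xy: "x \<in> {0..}" "y \<in> {0..}"
    define p q where "p = max 0 (\<tau> - x)" and "q = max 0 (\<tau> - y)"
    have pq: "0 \<le> p" "p \<le> \<tau>" "0 \<le> q" "q \<le> \<tau>" "\<bar>p - q\<bar> \<le> \<bar>x - y\<bar>"
      using xy assms by (auto simp: p_def q_def)
    have "\<bar>p ^ Suc k - q ^ Suc k\<bar> = \<bar>p * (p ^ k - q ^ k) + (p - q) * q ^ k\<bar>"
      by (simp add: algebra_simps)
    also have "\<dots> \<le> p * \<bar>p ^ k - q ^ k\<bar> + \<bar>p - q\<bar> * q ^ k"
      using pq by (intro order_trans[OF abs_triangle_ineq]) (simp add: abs_mult)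
    also have "\<dots> \<le> \<tau> * (C * \<bar>x - y\<bar>) + \<bar>x - y\<bar> * \<tau> ^ k"
      using pq C[of x y] xy by (intro add_mono mult_mono power_mono) (auto simp: p_def q_def)
    finally show "\<bar>max 0 (\<tau> - x) ^ Suc k - max 0 (\<tau> - y) ^ Suc k\<bar> \<le> (\<tau> * C + \<tau> ^ k) * \<bar>x - y\<bar>"
      by (simp add: p_def q_def algebra_simps)
  qed
qed

lemma bounded_variation_sum_steps:
  fixes s :: "'i \<Rightarrow> real \<Rightarrow> real"
  assumes "\<And>i x y. i \<in> I \<Longrightarrow> x \<le> y \<Longrightarrow> s i y \<le> s i x" "\<And>i x. i \<in> I \<Longrightarrow> 0 \<le> s i x \<and> s i x \<le> 1"
  shows "bounded_variation_on A (\<lambda>t. \<Sum>i\<in>I. c i * s i t)"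
proof (rule bounded_variation_onI[where G = "\<lambda>t. - (\<Sum>i\<in>I. \<bar>c i\<bar> * s i t)" and B = "\<Sum>i\<in>I. \<bar>c i\<bar>"])
  fix x y :: real assume "x \<le> y"
  have "\<bar>(\<Sum>i\<in>I. c i * s i y) - (\<Sum>i\<in>I. c i * s i x)\<bar> = \<bar>\<Sum>i\<in>I. c i * (s i y - s i x)\<bar>"
    by (simp add: sum_subtractf right_diff_distrib)
  also have "\<dots> \<le> (\<Sum>i\<in>I. \<bar>c i * (s i y - s i x)\<bar>)" by (rule sum_abs)
  also have "\<dots> = (\<Sum>i\<in>I. \<bar>c i\<bar> * (s i x - s i y))"
    using assms(1)[OF _ \<open>x \<le> y\<close>] by (intro sum.cong) (auto simp: abs_mult)
  finally show "\<bar>(\<Sum>i\<in>I. c i * s i y) - (\<Sum>i\<in>I. c i * s i x)\<bar>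
      \<le> - (\<Sum>i\<in>I. \<bar>c i\<bar> * s i y) - - (\<Sum>i\<in>I. \<bar>c i\<bar> * s i x)"
    by (simp add: sum_subtractf right_diff_distrib)
next
  fix x
  have "0 \<le> (\<Sum>i\<in>I. \<bar>c i\<bar> * s i x)" using assms(2) by (intro sum_nonneg) auto
  moreover have "(\<Sum>i\<in>I. \<bar>c i\<bar> * s i x) \<le> (\<Sum>i\<in>I. \<bar>c i\<bar> * 1)"
    using assms(2) by (intro sum_mono mult_left_mono) auto
  ultimately show "\<bar>- (\<Sum>i\<in>I. \<bar>c i\<bar> * s i x)\<bar> \<le> (\<Sum>i\<in>I. \<bar>c i\<bar>)" by simp
qed

text \<open>
  Each derivative is again a combination of truncated powers, Lipschitz up to the order \<open>r - 1\<close>;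
  the one-sided derivatives of order \<open>r\<close> are step functions.
\<close>

lemma truncated_powers_WBV:
  fixes a \<tau> :: "nat \<Rightarrow> real"
  assumes r: "r \<ge> 1" and \<tau>: "\<And>i. i \<le> n \<Longrightarrow> \<tau> i \<ge> 0"
  shows "(\<lambda>t. \<Sum>i\<le>n. a i * max 0 (\<tau> i - t) ^ r) \<in> WBV r"
proof -
  define w :: "nat \<Rightarrow> real" where "w j = (-1) ^ j * (fact r / fact (r - j))" for j
  define D where "D j t = (\<Sum>i\<le>n. (a i * w j) * max 0 (\<tau> i - t) ^ (r - j))" for j t
  define gp where "gp t = (\<Sum>i\<le>n. (a i * w r) * (if t < \<tau> i then 1 else 0))" for t
  define gm where "gm t = (\<Sum>i\<le>n. (a i * w r) * (if t \<le> \<tau> i then 1 else 0))" for t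
  have w_Suc: "w (Suc j) = - (real (r - j) * w j)" if "j < r" for j
  proof -
    have "fact (r - j) = real (r - j) * fact (r - Suc j)"
      using that by (metis fact_Suc of_nat_mult Suc_diff_Suc of_nat_fact)
    thus ?thesis using that by (simp add: w_def)
  qed
  have "D 0 = (\<lambda>t. \<Sum>i\<le>n. a i * max 0 (\<tau> i - t) ^ r)" by (simp add: D_def w_def fun_eq_iff)
  moreover have "(D j has_real_derivative D (Suc j) t) (at t within {0..})" if j: "Suc j < r" for j t
  proof -
    obtain k where k: "r - j = Suc (Suc k)" "r - Suc j = Suc k"
      using j by (metis Suc_diff_Suc Suc_lessD)
    have "((\<lambda>t. \<Sum>i\<le>n. (a i * w j) * max 0 (\<tau> i - t) ^ Suc (Suc k)) has_real_derivative
            (\<Sum>i\<le>n. (a i * w j) * - (real (k + 2) * max 0 (\<tau> i - t) ^ Suc k))) (at t)"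
      by (intro DERIV_sum DERIV_cmult truncated_power_derivative)
    also have "(\<Sum>i\<le>n. (a i * w j) * - (real (k + 2) * max 0 (\<tau> i - t) ^ Suc k)) = D (Suc j) t"
      unfolding D_def k w_Suc[OF Suc_lessD[OF j]] by (intro sum.cong) auto
    finally show ?thesis unfolding D_def[of j, abs_def] k by (rule DERIV_subset) simp
  qed
  moreover have "abs_continuous_on {0..} (D j)" for j
  proof -
    have "\<exists>C. \<forall>x\<in>{0..}. \<forall>y\<in>{0..}. \<bar>max 0 (\<tau> i - x) ^ (r - j) - max 0 (\<tau> i - y) ^ (r - j)\<bar> \<le> C * \<bar>x - y\<bar>"
      if "i \<le> n" for i by (rule truncated_power_Lipschitz[OF \<tau>[OF that]])
    then obtain C where C: "\<And>i x y. i \<le> n \<Longrightarrow> x \<ge> 0 \<Longrightarrow> y \<ge> 0 \<Longrightarrow>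
        \<bar>max 0 (\<tau> i - x) ^ (r - j) - max 0 (\<tau> i - y) ^ (r - j)\<bar> \<le> C i * \<bar>x - y\<bar>"
      by (metis atLeast_iff)
    show ?thesis
    proof (rule abs_continuous_on_Lipschitz)
      fix x y :: real assume xy: "x \<in> {0..}" "y \<in> {0..}"
      have "\<bar>D j x - D j y\<bar> = \<bar>\<Sum>i\<le>n. (a i * w j) * (max 0 (\<tau> i - x) ^ (r - j) - max 0 (\<tau> i - y) ^ (r - j))\<bar>"
        by (simp add: D_def sum_subtractf right_diff_distrib)
      also have "\<dots> \<le> (\<Sum>i\<le>n. \<bar>(a i * w j) * (max 0 (\<tau> i - x) ^ (r - j) - max 0 (\<tau> i - y) ^ (r - j))\<bar>)"
        by (rule sum_abs)
      also have "\<dots> \<le> (\<Sum>i\<le>n. \<bar>a i * w j\<bar> * (C i * \<bar>x - y\<bar>))"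
        unfolding abs_mult[of "a _ * w j"] using C xy by (intro sum_mono mult_left_mono) auto
      finally show "\<bar>D j x - D j y\<bar> \<le> (\<Sum>i\<le>n. \<bar>a i * w j\<bar> * C i) * \<bar>x - y\<bar>"
        by (simp add: sum_distrib_right mult.assoc)
    qed
  qed
  moreover have rj: "D (r - 1) = (\<lambda>t. \<Sum>i\<le>n. (a i * w (r - 1)) * max 0 (\<tau> i - t))" and wr: "w r = - w (r - 1)"
    using r w_Suc[of "r - 1"] by (auto simp: D_def fun_eq_iff)
  have "(D (r - 1) has_real_derivative gp t) (at_right t)" for t
  proof -
    have "(D (r - 1) has_real_derivative (\<Sum>i\<le>n. (a i * w (r - 1)) * - (if t < \<tau> i then 1 else 0))) (at_right t)"
      unfolding rj by (intro DERIV_sum DERIV_cmult truncated_linear_right_derivative)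
    thus ?thesis by (simp add: gp_def wr)
  qed
  moreover have "(D (r - 1) has_real_derivative gm t) (at_left t)" for t
  proof -
    have "(D (r - 1) has_real_derivative (\<Sum>i\<le>n. (a i * w (r - 1)) * - (if t \<le> \<tau> i then 1 else 0))) (at_left t)"
      unfolding rj by (intro DERIV_sum DERIV_cmult truncated_linear_left_derivative)
    thus ?thesis by (simp add: gm_def wr)
  qed
  moreover have "bounded_variation_on {0..} gp" unfolding gp_def by (rule bounded_variation_sum_steps) auto
  moreover have "bounded_variation_on {0<..} gm" unfolding gm_def by (rule bounded_variation_sum_steps) auto
  ultimately have "\<exists>D gp gm. D 0 = (\<lambda>t. \<Sum>i\<le>n. a i * max 0 (\<tau> i - t) ^ r) \<and>
       (\<forall>j. Suc j < r \<longrightarrow> (\<forall>t\<ge>0. (D j has_real_derivative D (Suc j) t) (at t within {0..}))) \<and>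
       (\<forall>j<r. abs_continuous_on {0..} (D j)) \<and>
       (\<forall>t\<ge>0. (D (r - 1) has_real_derivative gp t) (at_right t)) \<and>
       (\<forall>t>0. (D (r - 1) has_real_derivative gm t) (at_left t)) \<and>
       bounded_variation_on {0..} gp \<and> bounded_variation_on {0<..} gm"
    by (intro exI[of _ D] exI[of _ gp] exI[of _ gm] conjI allI impI)
  thus ?thesis using r unfolding WBV_def by (simp only: mem_Collect_eq split: if_split) simp
qed

section \<open>A spline filter\<close>

text \<open>
  The \<open>r\<close>-th difference with step \<open>c\<close> of a power of degree at most \<open>r\<close>. Induction on \<open>s\<close> through
  \<open>(x + c i)\<^sup>s\<^sup>+\<^sup>1 = x (x + c i)\<^sup>s + c i (x + c i)\<^sup>s\<close>, where the factor \<open>i\<close> is absorbed by the binomial coefficient.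
\<close>

lemma finite_difference_power:
  fixes c x :: real
  assumes "s \<le> r"
  shows "(\<Sum>i\<le>r. (-1) ^ i * real (r choose i) * (x + c * real i) ^ s) = (if s < r then 0 else (- c) ^ r * fact r)"
  using assms
proof (induction s arbitrary: r x)
  case 0
  show ?case using choose_alternating_sum[of r, where ?'a = real] by (cases "r = 0") auto
next
  case (Suc s)
  then obtain q where q: "r = Suc q" by (cases r) auto
  have "(\<Sum>i\<le>r. (-1) ^ i * real (r choose i) * (x + c * real i) ^ Suc s)
      = (\<Sum>i\<le>r. x * ((-1) ^ i * real (r choose i) * (x + c * real i) ^ s)
           + c * ((-1) ^ i * (real i * real (r choose i)) * (x + c * real i) ^ s))"
    by (intro sum.cong) (auto simp: algebra_simps)
  also have "\<dots> = x * (\<Sum>i\<le>r. (-1) ^ i * real (r choose i) * (x + c * real i) ^ s)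
      + c * (\<Sum>i\<le>r. (-1) ^ i * (real i * real (r choose i)) * (x + c * real i) ^ s)"
    by (simp add: sum.distrib sum_distrib_left)
  also have "(\<Sum>i\<le>r. (-1) ^ i * real (r choose i) * (x + c * real i) ^ s) = 0"
    using Suc.IH[of r x] Suc.prems by simp
  also have "(\<Sum>i\<le>r. (-1) ^ i * (real i * real (r choose i)) * (x + c * real i) ^ s)
      = (\<Sum>i\<le>q. (-1) ^ Suc i * (real (Suc i) * real (r choose Suc i)) * (x + c * real (Suc i)) ^ s)"
    unfolding q by (subst sum.atMost_Suc_shift) simp
  also have "\<dots> = (\<Sum>i\<le>q. - real r * ((-1) ^ i * real (q choose i) * ((x + c) + c * real i) ^ s))"
  proof (intro sum.cong refl)
    fix i
    have "real (Suc i) * real (r choose Suc i) = real r * real (q choose i)"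
      unfolding q of_nat_mult[symmetric] by (rule arg_cong[of _ _ real]) (metis Suc_times_binomial_eq mult.commute)
    thus "(-1) ^ Suc i * (real (Suc i) * real (r choose Suc i)) * (x + c * real (Suc i)) ^ s =
        - real r * ((-1) ^ i * real (q choose i) * ((x + c) + c * real i) ^ s)"
      by (simp add: algebra_simps)
  qed
  also have "\<dots> = - real r * (if s < q then 0 else (- c) ^ q * fact q)"
    using Suc.IH[of q "x + c"] Suc.prems q by (simp add: sum_distrib_left[symmetric])
  finally show ?case using q Suc.prems by (auto simp: algebra_simps)
qed

text \<open>
  An integrated B-spline: up to normalisation the \<open>r\<close>-th difference, over the knots \<open>1 + i/r\<close>, of
  truncated powers of degree \<open>r\<close>. For \<open>t \<le> 1\<close> no power is truncated and the difference is a constant;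
  near \<open>2\<close> only the last knot remains.
\<close>

definition spline_filter :: "nat \<Rightarrow> real \<Rightarrow> real" where
  "spline_filter r t = (\<Sum>i\<le>r. (real r ^ r / fact r * (-1) ^ (r - i) * real (r choose i))
      * max 0 (1 + real i / real r - t) ^ r)"

lemma spline_filter_WBV: "r \<ge> 1 \<Longrightarrow> spline_filter r \<in> WBV r"
  unfolding spline_filter_def[abs_def] by (rule truncated_powers_WBV) auto

lemma filter_function_spline_filter:
  assumes r: "r \<ge> 1"
  shows "filter_function (spline_filter r)"
  unfolding filter_function_def
proof (intro conjI ballI allI impI)
  show "continuous_on {0..} (spline_filter r)"
    unfolding spline_filter_def by (intro continuous_intros)
next
  fix t :: real assume t: "t \<in> {0..1}"
  have "spline_filter r t = (\<Sum>i\<le>r. (real r ^ r / fact r * (-1) ^ r) *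
       ((-1) ^ i * real (r choose i) * ((1 - t) + (1 / real r) * real i) ^ r))"
    unfolding spline_filter_def
  proof (intro sum.cong refl)
    fix i assume "i \<in> {..r}"
    hence "(-1 :: real) ^ (r - i) = (-1) ^ r * (-1) ^ i" by (simp add: power_diff minus_one_power_iff)
    moreover have "max 0 (1 + real i / real r - t) = (1 - t) + (1 / real r) * real i"
    proof -
      have "0 \<le> real i / real r" "t \<le> 1" using t by auto
      hence "0 \<le> 1 + real i / real r - t" by linarith
      thus ?thesis by (simp only: max_absorb2) simp
    qed
    ultimately show "(real r ^ r / fact r * (-1) ^ (r - i) * real (r choose i)) * max 0 (1 + real i / real r - t) ^ r
      = (real r ^ r / fact r * (-1) ^ r) * ((-1) ^ i * real (r choose i) * ((1 - t) + (1 / real r) * real i) ^ r)"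
      by simp
  qed
  also have "\<dots> = (real r ^ r / fact r * (-1) ^ r) * ((- (1 / real r)) ^ r * fact r)"
    unfolding sum_distrib_left[symmetric] finite_difference_power[OF order_refl] by simp
  also have "\<dots> = (real r * (-1) * - (1 / real r)) ^ r" by (simp only: power_mult_distrib) simp
  also have "\<dots> = 1" using r by simp
  finally show "spline_filter r t = 1" .
next
  fix t :: real assume t: "2 \<le> t"
  show "spline_filter r t = 0" unfolding spline_filter_def
  proof (intro sum.neutral ballI)
    fix i assume "i \<in> {..r}"
    hence "real i / real r \<le> 1" using r by simp
    hence "max 0 (1 + real i / real r - t) = 0" using t by simp
    thus "(real r ^ r / fact r * (-1) ^ (r - i) * real (r choose i)) * max 0 (1 + real i / real r - t) ^ r = 0"
      using r by (simp add: power_0_left)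
  qed
qed

lemma spline_filter_near_two:
  assumes r: "r \<ge> 1" and t: "t \<ge> 2 - 1 / real r"
  shows "spline_filter r t = real r ^ r / fact r * max 0 (2 - t) ^ r"
proof -
  have "spline_filter r t = (\<Sum>i\<le>r. if i = r then real r ^ r / fact r * max 0 (2 - t) ^ r else 0)"
    unfolding spline_filter_def
  proof (intro sum.cong refl)
    fix i assume i: "i \<in> {..r}"
    show "(real r ^ r / fact r * (-1) ^ (r - i) * real (r choose i)) * max 0 (1 + real i / real r - t) ^ r
       = (if i = r then real r ^ r / fact r * max 0 (2 - t) ^ r else 0)"
    proof (cases "i = r")
      case False
      hence "real i \<le> real r - 1" using i by auto
      hence "real i / real r \<le> (real r - 1) / real r" by (intro divide_right_mono) auto
      also have "\<dots> = 1 - 1 / real r" using r by (simp add: diff_divide_distrib)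
      finally have "max 0 (1 + real i / real r - t) = 0" using t by simp
      thus ?thesis using r False by (simp add: power_0_left)
    qed (use r in simp)
  qed
  thus ?thesis by simp
qed

section \<open>The multiplier near the end of its support\<close>

text \<open>
  The index \<open>k\<close> stands for the frequency \<open>2 L - k\<close>, so \<open>k + 2\<close> is the frequency lower by two.
\<close>

definition nabla :: "(int \<Rightarrow> real) \<Rightarrow> int \<Rightarrow> real" where
  "nabla v k = v k - v (k + 2)"

lemma nabla_power:
  "(nabla ^^ r) v k = (\<Sum>i\<le>r. (-1) ^ i * real (r choose i) * v (k + 2 * int i))"
proof (induction r arbitrary: k)
  case (Suc r)
  have split: "(\<Sum>i\<le>r. (-1) ^ i * real (r choose i) * v (k + 2 * int i))
      = v k + (\<Sum>i\<le>r. (-1) ^ Suc i * real (r choose Suc i) * v (k + 2 * int (Suc i)))"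
  proof -
    have "(\<Sum>i\<le>r. (-1) ^ i * real (r choose i) * v (k + 2 * int i))
      = (\<Sum>i\<le>Suc r. (-1) ^ i * real (r choose i) * v (k + 2 * int i))" by simp
    thus ?thesis by (subst (asm) sum.atMost_Suc_shift) simp
  qed
  have "(nabla ^^ Suc r) v k = (nabla ^^ r) v k - (nabla ^^ r) v (k + 2)" by (simp add: nabla_def)
  also have "\<dots> = v k + (\<Sum>i\<le>r. (-1) ^ Suc i * real (r choose Suc i) * v (k + 2 * int (Suc i)))
       - (\<Sum>i\<le>r. (-1) ^ i * real (r choose i) * v (k + 2 + 2 * int i))"
    unfolding Suc.IH split ..
  also have "\<dots> = v k + (\<Sum>i\<le>r. (-1) ^ Suc i * real (Suc r choose Suc i) * v (k + 2 * int (Suc i)))"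
    by (simp add: algebra_simps sum.distrib sum_negf sum_subtractf)
  also have "\<dots> = (\<Sum>i\<le>Suc r. (-1) ^ i * real (Suc r choose i) * v (k + 2 * int i))"
    by (subst sum.atMost_Suc_shift) simp
  finally show ?case .
qed simp

lemma nabla_power_cmult: "(nabla ^^ r) (\<lambda>k. a * v k) k = a * (nabla ^^ r) v k"
  by (simp add: nabla_power sum_distrib_left mult_ac)

lemma lower_coeff_limit:
  assumes \<mu>: "\<mu> \<ge> 0"
  shows "(\<lambda>L. lower_coeff \<mu> (nat (2 * int L - k)) / real L) \<longlonglongrightarrow> 1 / (2 * \<mu> + 1)"
proof -
  define \<kappa> where "\<kappa> = real_of_int k"
  have "(\<lambda>L. ((2 * real L - \<kappa>) / real L) * ((2 * real L - \<kappa> - 1) / (2 * real L - \<kappa> + \<mu>)) / (2 * (2 * \<mu> + 1)))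
     \<longlonglongrightarrow> 2 * 1 / (2 * (2 * \<mu> + 1))"
  proof (intro tendsto_intros)
    show "(\<lambda>L. (2 * real L - \<kappa>) / real L) \<longlonglongrightarrow> 2" by real_asymp
    show "(\<lambda>L. (2 * real L - \<kappa> - 1) / (2 * real L - \<kappa> + \<mu>)) \<longlonglongrightarrow> 1" by real_asymp
    show "2 * (2 * \<mu> + 1) \<noteq> 0" using \<mu> by simp
  qed
  moreover have "eventually (\<lambda>L. ((2 * real L - \<kappa>) / real L) * ((2 * real L - \<kappa> - 1) / (2 * real L - \<kappa> + \<mu>)) / (2 * (2 * \<mu> + 1))
      = lower_coeff \<mu> (nat (2 * int L - k)) / real L) sequentially"
    using eventually_ge_at_top[of "nat \<bar>k\<bar>"]
  proof eventually_elim
    case (elim L)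
    hence "real (nat (2 * int L - k)) = 2 * real L - \<kappa>" by (simp add: \<kappa>_def)
    thus ?case by (simp add: lower_coeff_def mult_ac)
  qed
  ultimately have "(\<lambda>L. lower_coeff \<mu> (nat (2 * int L - k)) / real L) \<longlonglongrightarrow> 2 * 1 / (2 * (2 * \<mu> + 1))"
    by (rule Lim_transform_eventually)
  thus ?thesis by (simp only: mult_divide_mult_cancel_left_if) simp
qed

text \<open>
  In \<open>lower \<mu> g n = g n + lower_coeff \<mu> n * (g n - g (n - 2))\<close> the coefficient grows like
  \<open>L / (2 \<mu> + 1)\<close>, so the difference dominates and one power of \<open>L\<close> is gained.
\<close>

lemma lower_limit:
  assumes \<mu>: "\<mu> \<ge> 0"
    and g: "\<And>k. (\<lambda>L. real L ^ Suc s * g L (nat (2 * int L - k))) \<longlonglongrightarrow> v k"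
  shows "(\<lambda>L. real L ^ s * lower \<mu> (g L) (nat (2 * int L - k))) \<longlonglongrightarrow> 1 / (2 * \<mu> + 1) * nabla v k"
proof -
  define c where "c L = lower_coeff \<mu> (nat (2 * int L - k)) / real L" for L
  have "(\<lambda>L. 1 / real L * (real L ^ Suc s * g L (nat (2 * int L - k))) +
      c L * (real L ^ Suc s * g L (nat (2 * int L - k)) - real L ^ Suc s * g L (nat (2 * int L - (k + 2)))))
     \<longlonglongrightarrow> 0 * v k + 1 / (2 * \<mu> + 1) * (v k - v (k + 2))"
    unfolding c_def by (intro tendsto_intros g lower_coeff_limit \<mu> lim_1_over_n)
  moreover have "eventually (\<lambda>L. 1 / real L * (real L ^ Suc s * g L (nat (2 * int L - k))) +
      c L * (real L ^ Suc s * g L (nat (2 * int L - k)) - real L ^ Suc s * g L (nat (2 * int L - (k + 2))))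
      = real L ^ s * lower \<mu> (g L) (nat (2 * int L - k))) sequentially"
    using eventually_gt_at_top[of 0]
  proof eventually_elim
    case (elim L)
    have n: "nat (2 * int L - (k + 2)) = nat (2 * int L - k) - 2" by linarith
    have c: "lower_coeff \<mu> (nat (2 * int L - k)) = c L * real L" using elim by (simp add: c_def)
    show ?case using elim unfolding lower_def n c by (simp add: algebra_simps)
  qed
  ultimately have "(\<lambda>L. real L ^ s * lower \<mu> (g L) (nat (2 * int L - k))) \<longlonglongrightarrow> 0 * v k + 1 / (2 * \<mu> + 1) * (v k - v (k + 2))"
    by (rule Lim_transform_eventually)
  thus ?thesis by (simp add: nabla_def)
qed

lemma iterated_lower_limit:
  assumes \<mu>: "\<mu> \<ge> 0"
    and g: "\<And>k. (\<lambda>L. real L ^ r * g L (nat (2 * int L - k))) \<longlonglongrightarrow> v k"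
  shows "(\<lambda>L. iterated_lower \<mu> r (g L) (nat (2 * int L - k)))
           \<longlonglongrightarrow> (\<Prod>j<r. 1 / (2 * (\<mu> + real j) + 1)) * (nabla ^^ r) v k"
  using g
proof (induction r arbitrary: g v k)
  case (Suc r)
  have "(\<lambda>L. real L ^ r * lower (\<mu> + real r) (g L) (nat (2 * int L - k))) \<longlonglongrightarrow>
      1 / (2 * (\<mu> + real r) + 1) * nabla v k" for k
    by (rule lower_limit) (use \<mu> Suc.prems in auto)
  from Suc.IH[where g = "\<lambda>L. lower (\<mu> + real r) (g L)" and v = "\<lambda>k. 1 / (2 * (\<mu> + real r) + 1) * nabla v k", OF this, of k]
  show ?case unfolding nabla_power_cmult by (simp add: funpow_swap1 mult_ac)
qed simp

lemma spline_filter_limit: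
  assumes r: "r \<ge> 1"
  shows "(\<lambda>L. real L ^ r * spline_filter r (real (nat (2 * int L - k)) / real L))
           \<longlonglongrightarrow> real r ^ r / fact r * max 0 (real_of_int k) ^ r"
proof (rule Lim_transform_eventually[OF tendsto_const])
  show "eventually (\<lambda>L. real r ^ r / fact r * max 0 (real_of_int k) ^ r =
      real L ^ r * spline_filter r (real (nat (2 * int L - k)) / real L)) sequentially"
    using eventually_ge_at_top[of "Suc (r * nat \<bar>k\<bar>)"]
  proof eventually_elim
    case (elim L)
    have L: "L > 0" using elim by simp
    have rk: "int r * \<bar>k\<bar> \<le> int L"
    proof -
      have "int (r * nat \<bar>k\<bar>) \<le> int L" using elim by linarith
      thus ?thesis by simp
    qed
    have "\<bar>k\<bar> \<le> int r * \<bar>k\<bar>" using r by (simp add: mult_le_cancel_right1)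
    hence "real (nat (2 * int L - k)) = 2 * real L - real_of_int k" using rk by simp
    hence t: "real (nat (2 * int L - k)) / real L = 2 - real_of_int k / real L"
      using L by (simp add: diff_divide_distrib)
    have "real r * real_of_int k \<le> real L"
    proof -
      have "int r * k \<le> int r * \<bar>k\<bar>" by (intro mult_left_mono) auto
      hence "int r * k \<le> int L" using rk by linarith
      hence "real_of_int (int r * k) \<le> real_of_int (int L)" by (simp only: of_int_le_iff)
      thus ?thesis by simp
    qed
    hence "real_of_int k / real L \<le> 1 / real r" using L r by (simp add: divide_simps mult.commute)
    hence "spline_filter r (2 - real_of_int k / real L) = real r ^ r / fact r * max 0 (real_of_int k / real L) ^ r"
      using spline_filter_near_two[OF r, of "2 - real_of_int k / real L"] by simp
    moreover have "max 0 (real_of_int k / real L) = max 0 (real_of_int k) / real L"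
      using L by (auto simp: max_def divide_le_0_iff zero_le_divide_iff)
    ultimately show ?case unfolding t using L by (simp add: power_divide)
  qed
qed

context
  fixes r :: nat assumes r: "r \<ge> 1"
begin

text \<open>
  The limit profile of the lowered multiplier: constant from \<open>0\<close> on, zero up to \<open>-2r\<close>, with a
  transition in between.
\<close>

definition kink :: "int \<Rightarrow> real" where
  "kink = (nabla ^^ r) (\<lambda>k. max 0 (real_of_int k) ^ r)"

lemma kink_nonneg:
  assumes "k \<ge> 0"
  shows "kink k = (- 2) ^ r * fact r"
proof -
  have "kink k = (\<Sum>i\<le>r. (-1) ^ i * real (r choose i) * (real_of_int k + 2 * real i) ^ r)"
    unfolding kink_def nabla_power using assms by (intro sum.cong refl) simp
  thus ?thesis by (simp add: finite_difference_power)
qed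

lemma kink_zero:
  assumes "k \<le> - 2 * int r"
  shows "kink k = 0"
  unfolding kink_def nabla_power
proof (intro sum.neutral ballI)
  fix i assume "i \<in> {..r}"
  hence "k + 2 * int i \<le> 0" using assms by simp
  hence "max 0 (real_of_int (k + 2 * int i)) = 0" by linarith
  thus "(-1) ^ i * real (r choose i) * max 0 (real_of_int (k + 2 * int i)) ^ r = 0"
    using r by (simp only: power_0_left) simp
qed

lemma kink_end: "kink (1 - 2 * int r) = (-1) ^ r"
proof -
  have "kink (1 - 2 * int r) = (\<Sum>i\<le>r. if i = r then (-1) ^ r else 0)"
    unfolding kink_def nabla_power
  proof (intro sum.cong refl)
    fix i assume i: "i \<in> {..r}"
    show "(-1) ^ i * real (r choose i) * max 0 (real_of_int (1 - 2 * int r + 2 * int i)) ^ r = (if i = r then (-1) ^ r else 0)"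
    proof (cases "i = r")
      case False
      hence "1 - 2 * int r + 2 * int i \<le> 0" using i by simp
      hence "max 0 (real_of_int (1 - 2 * int r + 2 * int i)) = 0" by linarith
      thus ?thesis using r False by (simp only: power_0_left) simp
    qed simp
  qed
  thus ?thesis by simp
qed

lemma spline_multiplier_limit:
  assumes \<mu>: "\<mu> \<ge> 0"
  shows "\<exists>P. P \<noteq> 0 \<and> (\<forall>k. (\<lambda>L. iterated_lower \<mu> r (\<lambda>l. spline_filter r (real l / real L)) (nat (2 * int L - k)))
            \<longlonglongrightarrow> P * kink k)"
proof -
  define P where "P = (\<Prod>j<r. 1 / (2 * (\<mu> + real j) + 1)) * (real r ^ r / fact r)"
  have "2 * (\<mu> + real j) + 1 \<noteq> 0" for j using \<mu> by (smt (verit) of_nat_0_le_iff)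
  hence "P \<noteq> 0" using r by (simp add: P_def)
  moreover have "(\<lambda>L. iterated_lower \<mu> r (\<lambda>l. spline_filter r (real l / real L)) (nat (2 * int L - k))) \<longlonglongrightarrow> P * kink k" for k
    using iterated_lower_limit[OF \<mu>, of r "\<lambda>L l. spline_filter r (real l / real L)", OF spline_filter_limit[OF r], of k]
    unfolding nabla_power_cmult P_def kink_def mult.assoc .
  ultimately show ?thesis by blast
qed

end

section \<open>Divergence of the operator norms\<close>

context sphere_measure
begin

lemma sup_filtered_operator_norm_infinite:
  assumes "\<And>B. \<exists>L\<ge>1. ereal B \<le> filtered_operator_norm \<sigma> Y h L"
  shows "(SUP L\<in>{1..}. filtered_operator_norm \<sigma> Y h L) = \<infinity>"
  by (rule SUP_PInfty) (use assms in auto)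

lemma even_functional:
  assumes m: "odd m" and t: "\<bar>t\<bar> \<le> 1"
  shows "\<bar>(\<lambda>u. sqrt (real (Suc m)) * (u m - u (Suc (Suc m)))) (\<lambda>n. gegenbauer (1 / 2) n t 1)\<bar> \<le> 2"
  using legendre_difference_bound[OF m t] by simp

lemma finite_functional_even:
  "finite_functional (Suc (Suc m)) (\<lambda>u. sqrt (real (Suc m)) * (u m - u (Suc (Suc m))))"
  by (intro finite_functional_cmult finite_functional_diff finite_functional_eval) auto

text \<open>
  The test function is \<open>\<surd>n (P\<^sub>n\<^sub>-\<^sub>1 - P\<^sub>n\<^sub>+\<^sub>1)\<close> with \<open>n = m + 1\<close>, divided by its bound \<open>2\<close>.
\<close>

lemma filtered_operator_norm_ge_even:
  fixes Y :: "nat \<Rightarrow> nat \<Rightarrow> real^'n \<Rightarrow> real" and h :: "real \<Rightarrow> real"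
  assumes Y: "\<And>l. orthonormal_harmonic_basis \<sigma> l (Y l)" and n: "CARD('n) = 2 * r + 3" and m: "odd m"
  defines "g \<equiv> \<lambda>L. iterated_lower (1 / 2) r (\<lambda>l. h (real l / real L))"
  shows "ereal (sqrt (real (Suc m)) * \<bar>g L m - g L (Suc (Suc m))\<bar> / 2) \<le> filtered_operator_norm \<sigma> Y h L"
  using filtered_operator_norm_ge_functional[where \<mu> = "1 / 2" and r = r and h = h and L = L,
      OF Y _ _ finite_functional_even _ even_functional[OF m]] n
  by (simp add: g_def abs_mult)

lemma unbounded_root_filter:
  fixes Y :: "nat \<Rightarrow> nat \<Rightarrow> real^'n \<Rightarrow> real"
  assumes Y: "\<And>l. orthonormal_harmonic_basis \<sigma> l (Y l)" and n: "CARD('n) = 3"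
  shows "(SUP L\<in>{1..}. filtered_operator_norm \<sigma> Y root_filter L) = \<infinity>"
proof (rule sup_filtered_operator_norm_infinite)
  fix B :: real
  \<comment> \<open>Taking \<open>L = q\<^sup>4\<close> makes the value of the filter at \<open>2 - 1/L\<close> equal to \<open>1/q\<close>.\<close>
  obtain q :: nat where q: "q \<ge> 1" "real q \<ge> 2 * B"
    by (metis real_arch_simple nat_le_linear of_nat_mono order_trans)
  define L where "L = q ^ 4"
  have L: "L \<ge> 1" using q by (simp add: L_def)
  define m where "m = 2 * L - 1"
  have m: "odd m" "Suc m = 2 * L" "Suc (Suc m) = 2 * L + 1" using L by (auto simp: m_def)
  have "real m / real L = 2 - 1 / real L" using L by (simp add: m_def of_nat_diff diff_divide_distrib)
  hence "root_filter (real m / real L) = sqrt (sqrt (1 / real L))"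
    using L by (simp add: root_filter_def max_def min_def)
  also have "\<dots> = 1 / real q"
  proof -
    have "sqrt (real L) = (real q)\<^sup>2"
      by (rule real_sqrt_unique) (auto simp: L_def simp flip: power_mult)
    thus ?thesis by (simp add: real_sqrt_divide)
  qed
  finally have h1: "root_filter (real m / real L) = 1 / real q" .
  have "real (2 * L + 1) / real L \<ge> 2" using L by (simp add: le_divide_eq)
  hence h2: "root_filter (real (Suc (Suc m)) / real L) = 0"
    unfolding m by (simp add: root_filter_def)
  have "sqrt (real (Suc m)) \<ge> (real q)\<^sup>2"
    unfolding m by (rule real_le_rsqrt) (simp add: L_def flip: power_mult)
  hence "(real q)\<^sup>2 * (1 / real q) / 2 \<le> sqrt (real (Suc m)) * (1 / real q) / 2"
    by (intro divide_right_mono mult_right_mono) auto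
  hence "B \<le> sqrt (real (Suc m)) * \<bar>root_filter (real m / real L) - root_filter (real (Suc (Suc m)) / real L)\<bar> / 2"
    unfolding h1 h2 using q by (simp add: power2_eq_square)
  moreover have "ereal (sqrt (real (Suc m)) * \<bar>root_filter (real m / real L) - root_filter (real (Suc (Suc m)) / real L)\<bar> / 2)
      \<le> filtered_operator_norm \<sigma> Y root_filter L"
    using filtered_operator_norm_ge_even[OF Y, of 0 m root_filter L] m n by simp
  ultimately have "ereal B \<le> filtered_operator_norm \<sigma> Y root_filter L"
    by (meson ereal_less_eq(3) order_trans)
  thus "\<exists>L\<ge>1. ereal B \<le> filtered_operator_norm \<sigma> Y root_filter L" using L by blast
qed

text \<open>
  The frequency \<open>2 L + 2 r - 1\<close> is the last one at which the limit profile is nonzero. Taking it as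
  \<open>m\<close>, the difference of the multiplier tends to a nonzero limit, and \<open>\<surd>n\<close> remains.
\<close>

lemma unbounded_spline_filter_even:
  fixes Y :: "nat \<Rightarrow> nat \<Rightarrow> real^'n \<Rightarrow> real"
  assumes Y: "\<And>l. orthonormal_harmonic_basis \<sigma> l (Y l)" and r: "r \<ge> 1" and n: "CARD('n) = 2 * r + 3"
  shows "(SUP L\<in>{1..}. filtered_operator_norm \<sigma> Y (spline_filter r) L) = \<infinity>"
proof (rule sup_filtered_operator_norm_infinite)
  fix B :: real
  define g where "g L = iterated_lower (1 / 2) r (\<lambda>l. spline_filter r (real l / real L))" for L
  obtain P where P: "P \<noteq> 0" "\<And>k. (\<lambda>L. g L (nat (2 * int L - k))) \<longlonglongrightarrow> P * kink r k"
    using spline_multiplier_limit[OF r, of "1 / 2"] by (auto simp: g_def)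
  have "(\<lambda>L. \<bar>g L (nat (2 * int L - (1 - 2 * int r))) - g L (nat (2 * int L - (- 1 - 2 * int r)))\<bar>)
      \<longlonglongrightarrow> \<bar>P * kink r (1 - 2 * int r) - P * kink r (- 1 - 2 * int r)\<bar>"
    by (intro tendsto_intros P)
  also have "\<bar>P * kink r (1 - 2 * int r) - P * kink r (- 1 - 2 * int r)\<bar> = \<bar>P\<bar>"
    by (simp add: kink_end[OF r] kink_zero[OF r] abs_mult power_abs)
  finally have lim: "(\<lambda>L. \<bar>g L (nat (2 * int L - (1 - 2 * int r))) - g L (nat (2 * int L - (- 1 - 2 * int r)))\<bar>) \<longlonglongrightarrow> \<bar>P\<bar>" .
  have "filterlim (\<lambda>L. sqrt (real L)) at_top sequentially" by real_asymp
  hence "filterlim (\<lambda>L. \<bar>g L (nat (2 * int L - (1 - 2 * int r))) - g L (nat (2 * int L - (- 1 - 2 * int r)))\<bar> * sqrt (real L)) at_top sequentially"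
    using P(1) by (intro filterlim_tendsto_pos_mult_at_top[OF lim]) auto
  hence "eventually (\<lambda>L. 2 * B \<le> \<bar>g L (nat (2 * int L - (1 - 2 * int r))) - g L (nat (2 * int L - (- 1 - 2 * int r)))\<bar> * sqrt (real L)) sequentially"
    by (simp add: filterlim_at_top)
  moreover have "eventually (\<lambda>L. L \<ge> 1) sequentially" by (rule eventually_ge_at_top)
  ultimately obtain L where L: "L \<ge> 1"
    "2 * B \<le> \<bar>g L (nat (2 * int L - (1 - 2 * int r))) - g L (nat (2 * int L - (- 1 - 2 * int r)))\<bar> * sqrt (real L)"
    using eventually_happens'[OF sequentially_bot eventually_conj] by blast
  define m where "m = 2 * L + 2 * r - 1"
  have m: "odd m" "nat (2 * int L - (1 - 2 * int r)) = m" "nat (2 * int L - (- 1 - 2 * int r)) = Suc (Suc m)"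
    "L \<le> Suc m" using L(1) by (auto simp: m_def)
  have "2 * B \<le> \<bar>g L m - g L (Suc (Suc m))\<bar> * sqrt (real L)" using L(2) unfolding m .
  also have "\<dots> \<le> \<bar>g L m - g L (Suc (Suc m))\<bar> * sqrt (real (Suc m))"
    using m(4) by (intro mult_left_mono real_sqrt_le_mono) auto
  finally have "B \<le> sqrt (real (Suc m)) * \<bar>g L m - g L (Suc (Suc m))\<bar> / 2" by (simp add: mult.commute)
  moreover have "ereal (sqrt (real (Suc m)) * \<bar>g L m - g L (Suc (Suc m))\<bar> / 2) \<le> filtered_operator_norm \<sigma> Y (spline_filter r) L"
    unfolding g_def by (rule filtered_operator_norm_ge_even[OF Y n m(1)])
  ultimately have "ereal B \<le> filtered_operator_norm \<sigma> Y (spline_filter r) L"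
    by (meson ereal_less_eq(3) order_trans)
  thus "\<exists>L\<ge>1. ereal B \<le> filtered_operator_norm \<sigma> Y (spline_filter r) L" using L by blast
qed

text \<open>
  The difference of cosines at \<open>(N - k) \<theta>\<close> and \<open>(N + k) \<theta>\<close> is \<open>2 sin(N \<theta>) sin(k \<theta>)\<close>.
\<close>

lemma cosine_functional_bound:
  assumes K: "K > 0" "K \<le> N" and t: "\<bar>t\<bar> \<le> 1"
  shows "\<bar>\<Sum>k<K. fejer_coeff K k * (gegenbauer 0 (N - Suc k) t 1 - gegenbauer 0 (N + Suc k) t 1)\<bar> \<le> 2 * pi"
proof -
  define \<theta> where "\<theta> = arccos t"
  have \<theta>: "cos \<theta> = t" "0 \<le> \<theta>" "\<theta> \<le> pi" using t by (auto simp: \<theta>_def arccos_lbound arccos_ubound)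
  have "(\<Sum>k<K. fejer_coeff K k * (gegenbauer 0 (N - Suc k) t 1 - gegenbauer 0 (N + Suc k) t 1))
      = (\<Sum>k<K. 2 * sin (real N * \<theta>) * (fejer_coeff K k * sin (real (Suc k) * \<theta>)))"
  proof (intro sum.cong refl)
    fix k assume "k \<in> {..<K}"
    hence "real (N - Suc k) = real N - real (Suc k)" using K by (intro of_nat_diff) auto
    hence "gegenbauer 0 (N - Suc k) t 1 - gegenbauer 0 (N + Suc k) t 1
        = cos (real N * \<theta> - real (Suc k) * \<theta>) - cos (real N * \<theta> + real (Suc k) * \<theta>)"
      unfolding \<theta>(1)[symmetric] gegenbauer_zero_cos by (simp add: algebra_simps)
    also have "\<dots> = 2 * sin (real N * \<theta>) * sin (real (Suc k) * \<theta>)"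
      by (simp only: cos_diff cos_add)
    finally show "fejer_coeff K k * (gegenbauer 0 (N - Suc k) t 1 - gegenbauer 0 (N + Suc k) t 1) =
       2 * sin (real N * \<theta>) * (fejer_coeff K k * sin (real (Suc k) * \<theta>))" by (simp only: mult_ac)
  qed
  also have "\<dots> = 2 * sin (real N * \<theta>) * (\<Sum>k<K. fejer_coeff K k * sin (real (Suc k) * \<theta>))"
    by (rule sum_distrib_left[symmetric])
  also have "\<bar>\<dots>\<bar> \<le> (2 * 1) * pi"
    unfolding abs_mult using fejer_sum_bounded[OF K(1) \<theta>(2,3)]
    by (intro mult_mono) auto
  finally show ?thesis by simp
qed

text \<open>
  The number \<open>K\<close> of terms is chosen first, then \<open>L\<close>. For fixed \<open>K\<close> the value at the pole tends to
  \<open>S K\<close> as \<open>L \<rightarrow> \<infinity>\<close>, and \<open>S K\<close> grows like the sum of the Fejer coefficients, because above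
  \<open>2 L\<close> only the transitional frequencies contribute, and their number is bounded in terms of \<open>r\<close>.
\<close>

lemma unbounded_spline_filter_odd:
  fixes Y :: "nat \<Rightarrow> nat \<Rightarrow> real^'n \<Rightarrow> real"
  assumes Y: "\<And>l. orthonormal_harmonic_basis \<sigma> l (Y l)" and r: "r \<ge> 1" and n: "CARD('n) = 2 * r + 2"
  shows "(SUP L\<in>{1..}. filtered_operator_norm \<sigma> Y (spline_filter r) L) = \<infinity>"
proof (rule sup_filtered_operator_norm_infinite)
  fix B :: real
  define g where "g L = iterated_lower 0 r (\<lambda>l. spline_filter r (real l / real L))" for L
  obtain P where P: "P \<noteq> 0" "\<And>k. (\<lambda>L. g L (nat (2 * int L - k))) \<longlonglongrightarrow> P * kink r k"
    using spline_multiplier_limit[OF r, of 0] by (auto simp: g_def)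
  define w where "w = (2 :: real) ^ r * fact r"
  define W where "W = (\<Sum>k<2 * r. \<bar>kink r (- int (Suc k))\<bar>)"
  define S where "S K = (\<Sum>k<K. fejer_coeff K k * (P * kink r (int (Suc k)) - P * kink r (- int (Suc k))))" for K
  have w: "w > 0" by (simp add: w_def)
  have S: "\<bar>S K\<bar> \<ge> \<bar>P\<bar> * (w * (\<Sum>k<K. fejer_coeff K k) - W)" for K
  proof -
    have "S K = P * ((- 2) ^ r * fact r * (\<Sum>k<K. fejer_coeff K k) - (\<Sum>k<K. fejer_coeff K k * kink r (- int (Suc k))))"
    proof -
      have "S K = (\<Sum>k<K. P * ((- 2) ^ r * fact r * fejer_coeff K k) - P * (fejer_coeff K k * kink r (- int (Suc k))))"
        unfolding S_def by (intro sum.cong refl) (simp add: kink_nonneg[OF r] algebra_simps)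
      thus ?thesis by (simp add: sum_subtractf right_diff_distrib flip: sum_distrib_left)
    qed
    hence "\<bar>S K\<bar> = \<bar>P\<bar> * \<bar>(- 2) ^ r * fact r * (\<Sum>k<K. fejer_coeff K k) - (\<Sum>k<K. fejer_coeff K k * kink r (- int (Suc k)))\<bar>"
      by (simp add: abs_mult)
    also have "\<dots> \<ge> \<bar>P\<bar> * (w * (\<Sum>k<K. fejer_coeff K k) - W)"
    proof (rule mult_left_mono)
      have "\<bar>(- 2) ^ r * fact r * (\<Sum>k<K. fejer_coeff K k)\<bar> = w * (\<Sum>k<K. fejer_coeff K k)"
      proof -
        have "(\<Sum>k<K. fejer_coeff K k) \<ge> 0" using fejer_coeff_le by (intro sum_nonneg) auto
        thus ?thesis by (simp add: abs_mult power_abs w_def)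
      qed
      moreover have "\<bar>\<Sum>k<K. fejer_coeff K k * kink r (- int (Suc k))\<bar> \<le> W"
      proof -
        have "\<bar>\<Sum>k<K. fejer_coeff K k * kink r (- int (Suc k))\<bar> \<le> (\<Sum>k<K. \<bar>fejer_coeff K k * kink r (- int (Suc k))\<bar>)"
          by (rule sum_abs)
        also have "\<dots> \<le> (\<Sum>k<K. \<bar>kink r (- int (Suc k))\<bar>)"
          using fejer_coeff_le by (intro sum_mono) (auto simp: abs_mult intro!: mult_left_le_one_le)
        also have "\<dots> \<le> (\<Sum>k\<in>{..<K} \<union> {..<2 * r}. \<bar>kink r (- int (Suc k))\<bar>)"
          by (intro sum_mono2) auto
        also have "\<dots> = W" unfolding W_def
          by (intro sum.mono_neutral_right) (auto simp: kink_zero[OF r])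
        finally show ?thesis .
      qed
      ultimately show "w * (\<Sum>k<K. fejer_coeff K k) - W \<le>
         \<bar>(- 2) ^ r * fact r * (\<Sum>k<K. fejer_coeff K k) - (\<Sum>k<K. fejer_coeff K k * kink r (- int (Suc k)))\<bar>"
        by linarith
    qed simp
    finally show ?thesis .
  qed
  have "eventually (\<lambda>K. ((2 * pi * B + 1) / \<bar>P\<bar> + W) / w \<le> (\<Sum>k<K. fejer_coeff K k)) sequentially"
    using sum_fejer_coeff_at_top by (simp add: filterlim_at_top)
  moreover have "eventually (\<lambda>K::nat. K > 0) sequentially" by (rule eventually_gt_at_top)
  ultimately obtain K where K: "K > 0" "((2 * pi * B + 1) / \<bar>P\<bar> + W) / w \<le> (\<Sum>k<K. fejer_coeff K k)"
    using eventually_happens'[OF sequentially_bot eventually_conj] by blast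
  have "(2 * pi * B + 1) / \<bar>P\<bar> + W \<le> w * (\<Sum>k<K. fejer_coeff K k)"
    using K(2) w by (simp add: divide_le_eq mult.commute)
  hence "(2 * pi * B + 1) / \<bar>P\<bar> \<le> w * (\<Sum>k<K. fejer_coeff K k) - W" by simp
  hence "2 * pi * B + 1 \<le> \<bar>P\<bar> * (w * (\<Sum>k<K. fejer_coeff K k) - W)"
    using P(1) by (simp add: divide_le_eq mult.commute)
  hence SK: "2 * pi * B < \<bar>S K\<bar>" using S[of K] by linarith
  have "(\<lambda>L. \<bar>\<Sum>k<K. fejer_coeff K k * (g L (nat (2 * int L - int (Suc k))) - g L (nat (2 * int L - - int (Suc k))))\<bar>) \<longlonglongrightarrow> \<bar>S K\<bar>"
    unfolding S_def by (intro tendsto_intros P)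
  hence "eventually (\<lambda>L. 2 * pi * B < \<bar>\<Sum>k<K. fejer_coeff K k * (g L (nat (2 * int L - int (Suc k))) - g L (nat (2 * int L - - int (Suc k))))\<bar>) sequentially"
    using SK by (rule order_tendstoD)
  moreover have "eventually (\<lambda>L. L \<ge> K) sequentially" by (rule eventually_ge_at_top)
  ultimately obtain L where L: "L \<ge> K"
    "2 * pi * B < \<bar>\<Sum>k<K. fejer_coeff K k * (g L (nat (2 * int L - int (Suc k))) - g L (nat (2 * int L - - int (Suc k))))\<bar>"
    using eventually_happens'[OF sequentially_bot eventually_conj] by blast
  define F where "F u = (\<Sum>k<K. fejer_coeff K k * (u (2 * L - Suc k) - u (2 * L + Suc k)))" for u :: "nat \<Rightarrow> real"
  have "(\<Sum>k<K. fejer_coeff K k * (g L (nat (2 * int L - int (Suc k))) - g L (nat (2 * int L - - int (Suc k))))) = F (g L)"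
    unfolding F_def
  proof (intro sum.cong refl)
    fix k assume "k \<in> {..<K}"
    hence "nat (2 * int L - int (Suc k)) = 2 * L - Suc k" "nat (2 * int L - - int (Suc k)) = 2 * L + Suc k"
      using L(1) by auto
    thus "fejer_coeff K k * (g L (nat (2 * int L - int (Suc k))) - g L (nat (2 * int L - - int (Suc k))))
        = fejer_coeff K k * (g L (2 * L - Suc k) - g L (2 * L + Suc k))" by (simp only:)
  qed
  hence "2 * pi * B < \<bar>F (g L)\<bar>" using L(2) by simp
  hence "B \<le> \<bar>F (g L)\<bar> / (2 * pi)" by (simp add: le_divide_eq mult.commute)
  moreover have "ereal (\<bar>F (g L)\<bar> / (2 * pi)) \<le> filtered_operator_norm \<sigma> Y (spline_filter r) L"
    unfolding g_def
  proof (rule filtered_operator_norm_ge_functional[OF Y])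
    show "finite_functional (2 * L + K) F"
      unfolding F_def[abs_def]
      by (intro finite_functional_sum finite_functional_cmult finite_functional_diff finite_functional_eval) auto
    show "\<bar>F (\<lambda>n. gegenbauer 0 n t 1)\<bar> \<le> 2 * pi" if "\<bar>t\<bar> \<le> 1" for t
      unfolding F_def by (rule cosine_functional_bound[OF K(1) _ that]) (use L in simp)
  qed (use n in auto)
  ultimately have "ereal B \<le> filtered_operator_norm \<sigma> Y (spline_filter r) L"
    by (meson ereal_less_eq(3) order_trans)
  thus "\<exists>L\<ge>1. ereal B \<le> filtered_operator_norm \<sigma> Y (spline_filter r) L" using L K by (intro exI[of _ L]) auto
qed

end

theorem lemma2p2:
  fixes d :: nat
    and \<sigma> :: "(real^'n) measure"
    and Y :: "nat \<Rightarrow> nat \<Rightarrow> real^'n \<Rightarrow> real"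
  assumes "d \<ge> 2" and "CARD('n) = d + 1"
    and "rotation_invariant_sphere_measure \<sigma>"
    and "\<And>l. orthonormal_harmonic_basis \<sigma> l (Y l)"
  shows "\<exists>h. filter_function h \<and> h \<in> WBV ((d - 1) div 2) \<and>
           (SUP L\<in>{1..}. filtered_operator_norm \<sigma> Y h L) = \<infinity>"
proof -
  interpret sphere_measure \<sigma> by standard (rule assms(3))
  define r where "r = (d - 1) div 2"
  have "r \<ge> 1" if "d \<noteq> 2" using that \<open>d \<ge> 2\<close> unfolding r_def by presburger
  then consider "d = 2" | "odd d" "r \<ge> 1" | "even d" "r \<ge> 1" by blast
  thus ?thesis
  proof cases
    case 1
    thus ?thesis using assms(2) unbounded_root_filter[OF assms(4)]
      by (intro exI[of _ root_filter]) (simp add: filter_function_root_filter root_filter_WBV)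
  next
    case 2
    hence "CARD('n) = 2 * r + 2" using assms(1,2) by (auto simp: r_def elim!: oddE)
    thus ?thesis unfolding r_def[symmetric] using 2 unbounded_spline_filter_odd[OF assms(4)]
      by (intro exI[of _ "spline_filter r"]) (simp add: filter_function_spline_filter spline_filter_WBV)
  next
    case 3
    hence "CARD('n) = 2 * r + 3" using assms(1,2) by (auto simp: r_def elim!: evenE)
    thus ?thesis unfolding r_def[symmetric] using 3 unbounded_spline_filter_even[OF assms(4)]
      by (intro exI[of _ "spline_filter r"]) (simp add: filter_function_spline_filter spline_filter_WBV)
  qed
qed

end
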